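(* Let $(M,H)$ be an $n$-dimensional Carnot manifold, $a\in M$, and $(X_1,\ldots,X_n)$ an $H$-frame near $a$. Then the nilpotent Lie group $G(a)$ belongs to the class $\mathscr{N}_X(a)$.
   Context: A Carnot manifold of step $r$ is a smooth manifold $M$ ($\dim M=n$) with a filtration by subbundles $H_1\subset\cdots\subset H_r=TM$ such that the Lie bracket of local sections of $H_w$ and $H_{w'}$ is a section of $H_{w+w'}$ whenever $w+w'\le r$. Its weights are $w_j=\min\{w:\ j\le \mathrm{rk}\,H_w\}$, $1\le j\le n$. An $H$-frame near $a$ is a tangent frame $(X_1,\ldots,X_n)$ near $a$ with each $X_j$ a section of $H_{w_j}$; then $[X_i,X_j]=\sum_{w_k\le w_i+w_j}L_{ij}^k X_k$ with smooth functions $L_{ij}^k$ near $a$. Tangent Lie algebra: $\mathfrak{g}M(a)=\bigoplus_{w=1}^r H_w(a)/H_{w-1}(a)$ ($H_0=0$) with bracket defined, for sections $X$ of $H_w$ and $Y$ of $H_{w'}$, by $[\text{class of }X(a),\text{class of }Y(a)]=$ class of $[X,Y](a)$ in $H_{w+w'}(a)/H_{w+w'-1}(a)$ if $w+w'\le r$, and $0$ otherwise. If $\xi_j(a)$ is the class of $X_j(a)$ in $H_{w_j}(a)/H_{w_j-1}(a)$, then $(\xi_1(a),\ldots,\xi_n(a))$ is a basis of $\mathfrak{g}M(a)$ with $[\xi_i(a),\xi_j(a)]=\sum_{w_k=w_i+w_j}L_{ij}^k(a)\xi_k(a)$ if $w_i+w_j\leq r$, and $0$ otherwise. The group $G(a)$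 is $\mathbb{R}^n$ equipped with the Dynkin (Baker-Campbell-Hausdorff) product of $\mathfrak{g}M(a)$ written in the coordinates of this basis: $x\cdot y=x+y+\frac12[x,y]+\frac1{12}([x,[x,y]]+[y,[y,x]])+\cdots$ (finite sum), where $[\cdot,\cdot]$ is the bracket on $\mathbb{R}^n$ with $[\epsilon_i,\epsilon_j]=\sum_{w_k=w_i+w_j}L_{ij}^k(a)\epsilon_k$ on the canonical basis. Dilations on $\mathbb{R}^n$: $\delta_t(x)=t\cdot x=(t^{w_1}x_1,\ldots,t^{w_n}x_n)$. $\mathfrak{g}(a)$ is the tangent space $T\mathbb{R}^n(0)$ with the Lie bracket $[\partial_i,\partial_j]=\sum_{w_k=w_i+w_j}L_{ij}^k(a)\partial_k$ if $w_i+w_j\le r$ and $[\partial_i,\partial_j]=0$ otherwise. The class $\mathscr{N}_X(a)$ consists of the nilpotent Lie groups $G$ obtained by equipping $\mathbb{R}^n$ with a group law such that (i) the dilations $\delta_t$, $t\neq0$, are group automorphisms of $G$ (so $0$ is the unit), and (ii) the Lie algebra $TG(0)$ of $G$ (tangent space at the unit, with the bracket induced by left-invariant vector fields) is precisely $\mathfrak{g}(a)$. *)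

theory Defs
  imports
    "HOL-Analysis.Analysis"
    "HOL-Algebra.Generated_Groups"
    "HOL-Library.Function_Algebras"
begin

section \<open>Smooth maps between normed spaces\<close>

text \<open>
  For an open set \<open>S\<close> of a finite-dimensional space, \<open>ck_on k S f\<close> says that \<open>f\<close> is of class
  \<open>C\<^sup>k\<close> on \<open>S\<close>: all directional derivatives of a differentiable map are required to be of class
  \<open>C\<^sup>k\<^sup>-\<^sup>1\<close>.  The predicate is only meant for open \<open>S\<close>.
\<close>

primrec ck_on ::
  "nat \<Rightarrow> 'a::real_normed_vector set \<Rightarrow> ('a \<Rightarrow> 'b::real_normed_vector) \<Rightarrow> bool" where
  "ck_on 0 S f \<longleftrightarrow> continuous_on S f"
| "ck_on (Suc k) S f \<longleftrightarrow>
     (\<forall>x\<in>S. f differentiable (at x)) \<and>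
     (\<forall>v. ck_on k S (\<lambda>x. frechet_derivative f (at x) v))"

definition smooth_on :: "'a::real_normed_vector set \<Rightarrow> ('a \<Rightarrow> 'b::real_normed_vector) \<Rightarrow> bool" where
  "smooth_on S f \<longleftrightarrow> (\<forall>k. ck_on k S f)"


section \<open>Smooth manifolds\<close>

text \<open>
  The manifold is the whole type \<open>'m\<close>; its topology is Hausdorff and second countable by the
  sort constraints below.  The model space is \<open>real ^ 'n\<close>, so that \<open>n = CARD('n)\<close>, and the
  linear order of \<open>'n\<close> plays the role of the order of the indices \<open>1, \<dots>, n\<close>.
\<close>

type_synonym ('m, 'n) chart = "'m set \<times> ('m \<Rightarrow> real ^ 'n)"

definition is_chart :: "('m::topological_space, 'n::finite) chart \<Rightarrow> bool" where
  "is_chart c \<longleftrightarrow> (case c of (D, \<phi>) \<Rightarrow>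
     open D \<and> open (\<phi> ` D) \<and> homeomorphism D (\<phi> ` D) \<phi> (inv_into D \<phi>))"

definition smooth_atlas ::
  "('m::{t2_space, second_countable_topology}, 'n::finite) chart set \<Rightarrow> bool" where
  "smooth_atlas A \<longleftrightarrow>
     (\<forall>c\<in>A. is_chart c) \<and> (\<Union>(fst ` A) = UNIV) \<and>
     (\<forall>(D, \<phi>)\<in>A. \<forall>(D', \<phi>')\<in>A. smooth_on (\<phi> ` (D \<inter> D')) (\<phi>' \<circ> inv_into D \<phi>))"

definition smooth_fun_on ::
  "('m::topological_space, 'n::finite) chart set \<Rightarrow> 'm set \<Rightarrow> ('m \<Rightarrow> real) \<Rightarrow> bool" where
  "smooth_fun_on A U f \<longleftrightarrow>
     open U \<and> (\<forall>(D, \<phi>)\<in>A. smooth_on (\<phi> ` (U \<inter> D)) (f \<circ> inv_into D \<phi>))"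

definition smooth_near ::
  "('m::topological_space, 'n::finite) chart set \<Rightarrow> 'm \<Rightarrow> ('m \<Rightarrow> real) \<Rightarrow> bool" where
  "smooth_near A p f \<longleftrightarrow> (\<exists>U. p \<in> U \<and> smooth_fun_on A U f)"


subsection \<open>Tangent vectors and vector fields\<close>

text \<open>
  A tangent vector at \<open>p\<close> is identified with its directional derivative, acting on the functions
  that are smooth near \<open>p\<close>.  To make this functional unique as a HOL function, it takes the value
  \<open>0\<close> on all functions that are not smooth near \<open>p\<close>.
\<close>

type_synonym 'm tvec = "('m \<Rightarrow> real) \<Rightarrow> real"

definition tscale :: "real \<Rightarrow> 'm tvec \<Rightarrow> 'm tvec" where
  "tscale c v = (\<lambda>f. c * v f)"

global_interpretation tvec: vector_space "tscale :: real \<Rightarrow> 'm tvec \<Rightarrow> 'm tvec"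
  by unfold_locales (auto simp: tscale_def plus_fun_def algebra_simps)

definition coord_vector ::
  "('m::topological_space, 'n::finite) chart set \<Rightarrow> ('m, 'n) chart \<Rightarrow> 'm \<Rightarrow> real ^ 'n \<Rightarrow> 'm tvec" where
  "coord_vector A c p u = (\<lambda>f.
     if smooth_near A p f
     then frechet_derivative (f \<circ> inv_into (fst c) (snd c)) (at (snd c p)) u
     else 0)"

definition tangent_space ::
  "('m::topological_space, 'n::finite) chart set \<Rightarrow> 'm \<Rightarrow> 'm tvec set" where
  "tangent_space A p = {coord_vector A c p u |c u. c \<in> A \<and> p \<in> fst c}"

text \<open>Vector fields are total functions on \<open>'m\<close>; only their values on \<open>U\<close> are meaningful.\<close>

definition smooth_vf ::
  "('m::topological_space, 'n::finite) chart set \<Rightarrow> 'm set \<Rightarrow> ('m \<Rightarrow> 'm tvec) \<Rightarrow> bool" where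
  "smooth_vf A U X \<longleftrightarrow>
     open U \<and> (\<forall>p\<in>U. X p \<in> tangent_space A p) \<and>
     (\<forall>V f. V \<subseteq> U \<and> smooth_fun_on A V f \<longrightarrow> smooth_fun_on A V (\<lambda>p. X p f))"

definition lie_bracket ::
  "('m::topological_space, 'n::finite) chart set \<Rightarrow>
    ('m \<Rightarrow> 'm tvec) \<Rightarrow> ('m \<Rightarrow> 'm tvec) \<Rightarrow> 'm \<Rightarrow> 'm tvec" where
  "lie_bracket A X Y p = (\<lambda>f.
     if smooth_near A p f then X p (\<lambda>q. Y q f) - Y p (\<lambda>q. X q f) else 0)"


section \<open>Carnot manifolds\<close>

text \<open>Subbundles have constant rank \<open>k\<close>, also if the manifold is not connected.\<close>

definition subbundle ::
  "('m::topological_space, 'n::finite) chart set \<Rightarrow> ('m \<Rightarrow> 'm tvec set) \<Rightarrow> bool" where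
  "subbundle A E \<longleftrightarrow>
     (\<exists>k. \<forall>p. \<exists>U (Y :: nat \<Rightarrow> 'm \<Rightarrow> 'm tvec). p \<in> U \<and> open U \<and>
       (\<forall>i<k. smooth_vf A U (Y i)) \<and>
       (\<forall>q\<in>U. inj_on (\<lambda>i. Y i q) {..<k} \<and>
              tvec.independent ((\<lambda>i. Y i q) ` {..<k}) \<and>
              tvec.span ((\<lambda>i. Y i q) ` {..<k}) = E q))"

definition bundle_rank :: "('m \<Rightarrow> 'm tvec set) \<Rightarrow> nat" where
  "bundle_rank E = (THE k. \<forall>p. tvec.dim (E p) = k)"

definition local_section ::
  "('m::topological_space, 'n::finite) chart set \<Rightarrow> ('m \<Rightarrow> 'm tvec set) \<Rightarrow>
    'm set \<Rightarrow> ('m \<Rightarrow> 'm tvec) \<Rightarrow> bool" where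
  "local_section A E U X \<longleftrightarrow> smooth_vf A U X \<and> (\<forall>p\<in>U. X p \<in> E p)"

text \<open>Only the values \<open>H w\<close> for \<open>1 \<le> w \<le> r\<close> are relevant.\<close>

definition carnot_manifold ::
  "('m::{t2_space, second_countable_topology}, 'n::finite) chart set \<Rightarrow> nat \<Rightarrow>
    (nat \<Rightarrow> 'm \<Rightarrow> 'm tvec set) \<Rightarrow> bool" where
  "carnot_manifold A r H \<longleftrightarrow>
     smooth_atlas A \<and> 1 \<le> r \<and>
     (\<forall>w\<in>{1..r}. subbundle A (H w)) \<and>
     (\<forall>w\<in>{1..<r}. \<forall>p. H w p \<subseteq> H (Suc w) p) \<and>
     (\<forall>p. H r p = tangent_space A p) \<and>
     (\<forall>w w' U X Y. 1 \<le> w \<and> 1 \<le> w' \<and> w + w' \<le> r \<and>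
        local_section A (H w) U X \<and> local_section A (H w') U Y \<longrightarrow>
        local_section A (H (w + w')) U (lie_bracket A X Y))"

text \<open>\<open>card {..j}\<close> is the position (starting from \<open>1\<close>) of the index \<open>j\<close> in the order of \<open>'n\<close>.\<close>

definition weight :: "(nat \<Rightarrow> 'm \<Rightarrow> 'm tvec set) \<Rightarrow> 'n::{finite, linorder} \<Rightarrow> nat" where
  "weight H j = (LEAST w. 1 \<le> w \<and> card {..j} \<le> bundle_rank (H w))"

definition tangent_frame ::
  "('m::topological_space, 'n::finite) chart set \<Rightarrow> 'm set \<Rightarrow> ('n \<Rightarrow> 'm \<Rightarrow> 'm tvec) \<Rightarrow> bool" where
  "tangent_frame A U X \<longleftrightarrow>
     (\<forall>j. smooth_vf A U (X j)) \<and>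
     (\<forall>p\<in>U. inj (\<lambda>j. X j p) \<and> tvec.independent (range (\<lambda>j. X j p)) \<and>
            tvec.span (range (\<lambda>j. X j p)) = tangent_space A p)"

definition H_frame_near ::
  "('m::topological_space, 'n::{finite, linorder}) chart set \<Rightarrow> (nat \<Rightarrow> 'm \<Rightarrow> 'm tvec set) \<Rightarrow>
    'm \<Rightarrow> ('n \<Rightarrow> 'm \<Rightarrow> 'm tvec) \<Rightarrow> bool" where
  "H_frame_near A H a X \<longleftrightarrow>
     (\<exists>U. open U \<and> a \<in> U \<and> tangent_frame A U X \<and>
          (\<forall>j. local_section A (H (weight H j)) U (X j)))"

text \<open>
  \<open>struct_fun A X i j k\<close> is the function \<open>L\<^sub>i\<^sub>j\<^sup>k\<close>: the coefficients of \<open>[X\<^sub>i, X\<^sub>j]\<close> in the frame are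
  unique at every point where \<open>X\<close> is a frame.  That they vanish for \<open>w\<^sub>k > w\<^sub>i + w\<^sub>j\<close> is a
  consequence of the definition of a Carnot manifold and is not imposed here.
\<close>

definition struct_fun ::
  "('m::topological_space, 'n::finite) chart set \<Rightarrow> ('n \<Rightarrow> 'm \<Rightarrow> 'm tvec) \<Rightarrow>
    'n \<Rightarrow> 'n \<Rightarrow> 'n \<Rightarrow> 'm \<Rightarrow> real" where
  "struct_fun A X i j k p =
     (THE c :: real ^ 'n. lie_bracket A (X i) (X j) p = (\<Sum>l\<in>UNIV. tscale (c $ l) (X l p))) $ k"


section \<open>The tangent group\<close>

text \<open>
  The bilinear bracket on \<open>\<real>\<^sup>n\<close> with \<open>[\<epsilon>\<^sub>i, \<epsilon>\<^sub>j] = \<Sum> L\<^sub>i\<^sub>j\<^sup>k(a) \<epsilon>\<^sub>k\<close>, summed over \<open>w\<^sub>k = w\<^sub>i + w\<^sub>j\<close>, if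
  \<open>w\<^sub>i + w\<^sub>j \<le> r\<close>, and \<open>[\<epsilon>\<^sub>i, \<epsilon>\<^sub>j] = 0\<close> otherwise.  Under the identification of the tangent space
  of \<open>\<real>\<^sup>n\<close> at \<open>0\<close> with \<open>\<real>\<^sup>n\<close> that sends \<open>\<partial>\<^sub>i\<close> to \<open>\<epsilon>\<^sub>i\<close>, it is also the bracket of \<open>\<gg>(a)\<close>.
\<close>

definition model_bracket ::
  "('m::topological_space, 'n::{finite, linorder}) chart set \<Rightarrow> nat \<Rightarrow>
    (nat \<Rightarrow> 'm \<Rightarrow> 'm tvec set) \<Rightarrow> ('n \<Rightarrow> 'm \<Rightarrow> 'm tvec) \<Rightarrow> 'm \<Rightarrow>
    real ^ 'n::{finite, linorder} \<Rightarrow> real ^ 'n::{finite, linorder} \<Rightarrow> real ^ 'n::{finite, linorder}" where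
  "model_bracket A r H X a x y =
     (\<Sum>i\<in>UNIV. \<Sum>j\<in>UNIV. (x $ i * y $ j) *\<^sub>R
        (if weight H i + weight H j \<le> r
         then \<Sum>k | weight H k = weight H i + weight H j. struct_fun A X i j k a *\<^sub>R axis k 1
         else 0))"

text \<open>The iterated bracket \<open>[x\<^sub>1, [x\<^sub>2, [\<dots>, x\<^sub>m]]]\<close>, which is \<open>x\<^sub>1\<close> for a single letter.\<close>

fun iterated_bracket :: "('v::zero \<Rightarrow> 'v \<Rightarrow> 'v) \<Rightarrow> 'v list \<Rightarrow> 'v" where
  "iterated_bracket B [] = 0"
| "iterated_bracket B [x] = x"
| "iterated_bracket B (x # y # zs) = B x (iterated_bracket B (y # zs))"

text \<open>
  Dynkin's formula: the sum over \<open>k \<ge> 1\<close> and over all \<open>(p\<^sub>1, q\<^sub>1), \<dots>, (p\<^sub>k, q\<^sub>k)\<close> with \<open>p\<^sub>i + q\<^sub>i > 0\<close> of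
  \<open>(-1)\<^sup>k\<^sup>-\<^sup>1 / k\<close> times the iterated bracket of \<open>x\<^bsup>p\<^sub>1\<^esup> y\<^bsup>q\<^sub>1\<^esup> \<dots> x\<^bsup>p\<^sub>k\<^esup> y\<^bsup>q\<^sub>k\<^esup>\<close>, divided by
  \<open>(\<Sum>\<^sub>i p\<^sub>i + q\<^sub>i) \<cdot> (\<Prod>\<^sub>i p\<^sub>i! q\<^sub>i!)\<close>.  The sum is truncated to brackets with at most \<open>N\<close> letters;
  this is the full sum when all brackets with more than \<open>N\<close> letters vanish.
\<close>

definition dynkin_index :: "nat \<Rightarrow> nat \<Rightarrow> (nat \<times> nat) list set" where
  "dynkin_index N k =
     {s. length s = k \<and> (\<forall>(p, q)\<in>set s. 0 < p + q) \<and> (\<Sum>(p, q)\<leftarrow>s. p + q) \<le> N}"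

definition dynkin_word :: "'v \<Rightarrow> 'v \<Rightarrow> (nat \<times> nat) list \<Rightarrow> 'v list" where
  "dynkin_word x y s = concat (map (\<lambda>(p, q). replicate p x @ replicate q y) s)"

definition dynkin_product ::
  "('v::real_vector \<Rightarrow> 'v \<Rightarrow> 'v) \<Rightarrow> nat \<Rightarrow> 'v \<Rightarrow> 'v \<Rightarrow> 'v" where
  "dynkin_product B N x y =
     (\<Sum>k=1..N. \<Sum>s\<in>dynkin_index N k.
        ((-1) ^ (k - 1) / (real k * real (\<Sum>(p, q)\<leftarrow>s. p + q) * (\<Prod>(p, q)\<leftarrow>s. fact p * fact q)))
          *\<^sub>R iterated_bracket B (dynkin_word x y s))"

text \<open>
  This is \<open>G(a)\<close>; the weights lie between \<open>1\<close> and \<open>r\<close> and are additive under the bracket, so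
  that brackets with more than \<open>r\<close> letters vanish.
\<close>

definition tangent_group ::
  "('m::topological_space, 'n::{finite, linorder}) chart set \<Rightarrow> nat \<Rightarrow>
    (nat \<Rightarrow> 'm \<Rightarrow> 'm tvec set) \<Rightarrow> ('n \<Rightarrow> 'm \<Rightarrow> 'm tvec) \<Rightarrow> 'm \<Rightarrow> (real ^ 'n::{finite, linorder}) monoid" where
  "tangent_group A r H X a =
     \<lparr>carrier = UNIV, mult = dynkin_product (model_bracket A r H X a) r, one = 0\<rparr>"


section \<open>The class of nilpotent groups\<close>

definition dilation ::
  "(nat \<Rightarrow> 'm \<Rightarrow> 'm tvec set) \<Rightarrow> real \<Rightarrow> real ^ 'n::{finite, linorder} \<Rightarrow> real ^ 'n::{finite, linorder}" where
  "dilation H t x = (\<chi> j. t ^ weight H j * x $ j)"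

primrec lower_central :: "('a, 'b) monoid_scheme \<Rightarrow> nat \<Rightarrow> 'a set" where
  "lower_central G 0 = carrier G"
| "lower_central G (Suc k) = generate G
     {x \<otimes>\<^bsub>G\<^esub> y \<otimes>\<^bsub>G\<^esub> inv\<^bsub>G\<^esub> x \<otimes>\<^bsub>G\<^esub> inv\<^bsub>G\<^esub> y |x y. x \<in> carrier G \<and> y \<in> lower_central G k}"

definition nilpotent_group :: "('a, 'b) monoid_scheme \<Rightarrow> bool" where
  "nilpotent_group G \<longleftrightarrow> group G \<and> (\<exists>k. lower_central G k = {\<one>\<^bsub>G\<^esub>})"

definition lie_group_on_Rn :: "(real ^ 'n::finite) monoid \<Rightarrow> bool" where
  "lie_group_on_Rn G \<longleftrightarrow>
     carrier G = UNIV \<and> group G \<and>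
     smooth_on UNIV (\<lambda>(x, y). x \<otimes>\<^bsub>G\<^esub> y) \<and> smooth_on UNIV (\<lambda>x. inv\<^bsub>G\<^esub> x)"

text \<open>
  Vector fields on \<open>\<real>\<^sup>n\<close> are given by their component functions, so that the bracket of \<open>V\<close> and \<open>W\<close>
  has components \<open>V(W\<^sub>k) - W(V\<^sub>k)\<close>.
\<close>

definition vf_bracket ::
  "(real ^ 'n::finite \<Rightarrow> real ^ 'n::finite) \<Rightarrow> (real ^ 'n::finite \<Rightarrow> real ^ 'n::finite) \<Rightarrow> real ^ 'n::finite \<Rightarrow> real ^ 'n::finite" where
  "vf_bracket V W x = frechet_derivative W (at x) (V x) - frechet_derivative V (at x) (W x)"

definition left_invariant_vf ::
  "(real ^ 'n::finite) monoid \<Rightarrow> real ^ 'n::finite \<Rightarrow> real ^ 'n::finite \<Rightarrow> real ^ 'n::finite" where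
  "left_invariant_vf G v x = frechet_derivative (\<lambda>y. x \<otimes>\<^bsub>G\<^esub> y) (at \<one>\<^bsub>G\<^esub>) v"

definition lie_algebra_bracket ::
  "(real ^ 'n::finite) monoid \<Rightarrow> real ^ 'n::finite \<Rightarrow> real ^ 'n::finite \<Rightarrow> real ^ 'n::finite" where
  "lie_algebra_bracket G u v = vf_bracket (left_invariant_vf G u) (left_invariant_vf G v) \<one>\<^bsub>G\<^esub>"

definition class_N ::
  "('m::topological_space, 'n::{finite, linorder}) chart set \<Rightarrow> nat \<Rightarrow>
    (nat \<Rightarrow> 'm \<Rightarrow> 'm tvec set) \<Rightarrow> ('n \<Rightarrow> 'm \<Rightarrow> 'm tvec) \<Rightarrow> 'm \<Rightarrow> (real ^ 'n::{finite, linorder}) monoid set" where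
  "class_N A r H X a =
     {G. lie_group_on_Rn G \<and> nilpotent_group G \<and>
         (\<forall>t. t \<noteq> 0 \<longrightarrow> dilation H t \<in> iso G G) \<and>
         (\<forall>u v. lie_algebra_bracket G u v = model_bracket A r H X a u v)}"

end

theory Submission
  imports Defs
begin

text \<open>
  The structure functions of weight zero, \<open>L\<^sub>i\<^sub>j\<^sup>k(a)\<close> with \<open>w\<^sub>k = w\<^sub>i + w\<^sub>j\<close>, satisfy the Jacobi identity:
  expand \<open>[[X\<^sub>i, X\<^sub>j], X\<^sub>l](a)\<close> in the frame; the terms with derivatives of structure functions only involve
  \<open>X\<^sub>k(a)\<close> with \<open>w\<^sub>k \<le> w\<^sub>i + w\<^sub>j\<close>, so they do not contribute in weight \<open>w\<^sub>i + w\<^sub>j + w\<^sub>l\<close>.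

  The only hard group axiom is associativity of the Dynkin product.  A Lie algebra \<open>\<gg>\<close> with positive
  weights has the invertible derivation \<open>\<delta>\<close> that multiplies by the weight, so \<open>\<gg>\<close> acts faithfully and by
  nilpotent maps on \<open>\<gg> \<oplus> \<real>\<close> through \<open>\<rho>(x)(v, s) = ([x, v] - s \<delta>(x), 0)\<close>.  Since \<open>exp \<circ> \<rho>\<close> is injective, it
  suffices to prove \<open>exp a \<cdot> exp b = exp (Dynkin a b)\<close> in an associative algebra with a nilpotent
  filtration.  There, \<open>W(t) = exp (t a) exp (t b)\<close> satisfies \<open>W' = c W\<close> with \<open>c = a + Ad\<^bsub>exp (t a)\<^esub> b\<close>, and the
  formula for the derivative of \<open>exp\<close> shows that \<open>L = ln W\<close> satisfies \<open>L' = \<psi>(Ad\<^sub>W - 1) c\<close> with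
  \<open>\<psi>(s) = ln (1 + s) / s\<close>.  Expanding \<open>\<psi>\<close> and integrating gives Dynkin's series.
\<close>

section \<open>The normed algebra of bounded endomorphisms\<close>

text \<open>The adjoint representation alone cannot serve: a nonzero nilpotent Lie algebra has a
  nonzero centre, which \<open>ad\<close> kills. The extra coordinate repairs this. Adjoin to the
  Lie algebra an element \<open>D\<close> with \<open>[D, x] = \<delta>(x)\<close>; then
  \<open>\<rho>(x)\<close> is the adjoint action of \<open>x\<close> on the larger algebra. It is
  faithful because positive weights make \<open>\<delta>\<close> injective, and \<open>x\<close>
  still acts nilpotently although the larger algebra is not nilpotent.

  Nilpotency replaces every convergence argument. An identity between formal power series can be
  evaluated at a nilpotent element of any size, so \<open>exp\<close> and \<open>ln\<close> invert
  each other without a smallness condition, and the path from \<open>t = 0\<close> to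
  \<open>t = 1\<close> never leaves the domain of \<open>ln\<close>. A norm is still present because
  the argument differentiates in \<open>t\<close>. Operators occur on two levels, as the matrices
  \<open>\<rho>(x)\<close> and as left and right multiplications on the algebra of these matrices;
  one type of bounded operators serves both.\<close>

typedef (overloaded) 'v endo = "UNIV :: ('v::{real_normed_vector,perfect_space} \<Rightarrow>\<^sub>L 'v) set"
  morphisms blinfun_of_endo endo_of_blinfun ..

setup_lifting type_definition_endo

instantiation endo :: ("{real_normed_vector,perfect_space}") real_normed_algebra_1
begin

lift_definition zero_endo :: "'a endo" is 0 .
lift_definition one_endo :: "'a endo" is id_blinfun .
lift_definition plus_endo :: "'a endo \<Rightarrow> 'a endo \<Rightarrow> 'a endo" is "(+)" .
lift_definition minus_endo :: "'a endo \<Rightarrow> 'a endo \<Rightarrow> 'a endo" is "(-)" .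
lift_definition uminus_endo :: "'a endo \<Rightarrow> 'a endo" is uminus .
lift_definition times_endo :: "'a endo \<Rightarrow> 'a endo \<Rightarrow> 'a endo" is "(o\<^sub>L)" .
lift_definition scaleR_endo :: "real \<Rightarrow> 'a endo \<Rightarrow> 'a endo" is "(*\<^sub>R)" .
lift_definition norm_endo :: "'a endo \<Rightarrow> real" is norm .
definition dist_endo :: "'a endo \<Rightarrow> 'a endo \<Rightarrow> real" where "dist_endo S T = norm (S - T)"
definition sgn_endo :: "'a endo \<Rightarrow> 'a endo" where "sgn_endo T = inverse (norm T) *\<^sub>R T"
definition uniformity_endo :: "('a endo \<times> 'a endo) filter" where
  "uniformity_endo = (INF e\<in>{0<..}. principal {(S, T). dist S T < e})"
definition open_endo :: "'a endo set \<Rightarrow> bool" where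
  "open_endo S \<longleftrightarrow> (\<forall>T\<in>S. \<forall>\<^sub>F (T', R) in uniformity. T' = T \<longrightarrow> R \<in> S)"

instance
proof
  fix a b c :: "'a endo" and r s :: real and U :: "'a endo set"
  show "dist a b = norm (a - b)" by (rule dist_endo_def)
  show "sgn a = inverse (norm a) *\<^sub>R a" by (rule sgn_endo_def)
  show "uniformity = (INF e\<in>{0<..}. principal {(x, y::'a endo). dist x y < e})"
    by (rule uniformity_endo_def)
  show "open U \<longleftrightarrow> (\<forall>x\<in>U. \<forall>\<^sub>F (x', y) in uniformity. x' = x \<longrightarrow> y \<in> U)"
    by (rule open_endo_def)
  show "a + b + c = a + (b + c)" by transfer (rule add.assoc)
  show "a + b = b + a" by transfer (rule add.commute)
  show "0 + a = a" by transfer simp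
  show "- a + a = 0" by transfer simp
  show "a - b = a + - b" by transfer simp
  show "r *\<^sub>R (a + b) = r *\<^sub>R a + r *\<^sub>R b" by transfer (rule scaleR_add_right)
  show "(r + s) *\<^sub>R a = r *\<^sub>R a + s *\<^sub>R a" by transfer (rule scaleR_add_left)
  show "r *\<^sub>R s *\<^sub>R a = (r * s) *\<^sub>R a" by transfer simp
  show "1 *\<^sub>R a = a" by transfer simp
  show "a * b * c = a * (b * c)" by transfer (rule blinfun_eqI, simp)
  show "1 * a = a" by transfer (rule blinfun_eqI, simp)
  show "a * 1 = a" by transfer (rule blinfun_eqI, simp)
  show "(a + b) * c = a * c + b * c"
    by transfer (rule blinfun_eqI, simp add: blinfun.bilinear_simps)
  show "a * (b + c) = a * b + a * c"
    by transfer (rule blinfun_eqI, simp add: blinfun.bilinear_simps)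
  show "(r *\<^sub>R a) * b = r *\<^sub>R (a * b)"
    by transfer (rule blinfun_eqI, simp add: blinfun.bilinear_simps)
  show "a * (r *\<^sub>R b) = r *\<^sub>R (a * b)"
    by transfer (rule blinfun_eqI, simp add: blinfun.bilinear_simps)
  show "norm a = 0 \<longleftrightarrow> a = 0" by transfer simp
  show "norm (a + b) \<le> norm a + norm b" by transfer (rule norm_triangle_ineq)
  show "norm (r *\<^sub>R a) = \<bar>r\<bar> * norm a" by transfer simp
  show "norm (a * b) \<le> norm a * norm b" by transfer (rule norm_blinfun_compose)
  \<comment> \<open>The sort \<open>perfect_space\<close> enters here: it excludes the zero space,
    whose identity has norm 0.\<close>
  show norm_one: "norm (1::'a endo) = 1" by transfer (rule norm_blinfun_id)
  show "(0::'a endo) \<noteq> 1"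
  proof
    assume "(0::'a endo) = 1"
    then have "norm (0::'a endo) = 1" using norm_one by simp
    moreover have "norm (0::'a endo) = 0" by transfer simp
    ultimately show False by simp
  qed
qed

end

instance endo :: ("{banach,perfect_space}") banach
proof
  fix X :: "nat \<Rightarrow> 'a endo"
  assume "Cauchy X"
  have d: "norm (S - T) = norm (blinfun_of_endo S - blinfun_of_endo T)" for S T :: "'a endo"
    by transfer simp
  from \<open>Cauchy X\<close> have "Cauchy (\<lambda>n. blinfun_of_endo (X n))"
    by (simp add: Cauchy_iff d)
  then obtain T where "(\<lambda>n. blinfun_of_endo (X n)) \<longlonglongrightarrow> T"
    using Cauchy_convergent convergent_def by blast
  then have "X \<longlonglongrightarrow> endo_of_blinfun T"
    by (simp add: LIMSEQ_iff d endo_of_blinfun_inverse)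
  then show "convergent X" by (rule convergentI)
qed

definition endo_apply :: "'v::{real_normed_vector,perfect_space} endo \<Rightarrow> 'v \<Rightarrow> 'v" where
  "endo_apply T = blinfun_apply (blinfun_of_endo T)"

lemma endo_eqI: "(\<And>v. endo_apply S v = endo_apply T v) \<Longrightarrow> S = T"
  by (metis endo_apply_def blinfun_of_endo_inject blinfun_eqI)

lemma bounded_bilinear_endo_apply: "bounded_bilinear endo_apply"
proof -
  have *: "norm (endo_apply T v) \<le> norm T * norm v * 1" for T :: "'a endo" and v
    unfolding endo_apply_def by transfer (simp add: norm_blinfun)
  show ?thesis
  proof
    show "\<exists>K. \<forall>(T::'a endo) v. norm (endo_apply T v) \<le> norm T * norm v * K"
      by (intro exI[of _ 1] allI *)
  qed (simp_all add: endo_apply_def plus_endo.rep_eq scaleR_endo.rep_eq blinfun.bilinear_simps)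
qed

interpretation endo: bounded_bilinear endo_apply
  by (rule bounded_bilinear_endo_apply)

lemma endo_apply_mult [simp]: "endo_apply (S * T) v = endo_apply S (endo_apply T v)"
  by (simp add: endo_apply_def times_endo.rep_eq)

lemma endo_apply_one [simp]: "endo_apply 1 v = v"
  by (simp add: endo_apply_def one_endo.rep_eq)

definition endo_of :: "('v::{real_normed_vector,perfect_space} \<Rightarrow> 'v) \<Rightarrow> 'v endo" where
  "endo_of f = endo_of_blinfun (Blinfun f)"

lemma endo_apply_endo_of [simp]: "bounded_linear f \<Longrightarrow> endo_apply (endo_of f) v = f v"
  by (simp add: endo_apply_def endo_of_def endo_of_blinfun_inverse bounded_linear_Blinfun_apply)

text \<open>Left and right multiplications commute even if the algebra does not. They turn a product
  such as \<open>L t ^ i * L' * L t ^ j\<close> into a polynomial in two commuting operators,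
  applied to \<open>L'\<close>.\<close>

definition lmul :: "'a::real_normed_algebra_1 \<Rightarrow> 'a endo" where
  "lmul a = endo_of (\<lambda>m. a * m)"

definition rmul :: "'a::real_normed_algebra_1 \<Rightarrow> 'a endo" where
  "rmul a = endo_of (\<lambda>m. m * a)"

lemma lmul_apply [simp]: "endo_apply (lmul a) m = a * m"
  and rmul_apply [simp]: "endo_apply (rmul a) m = m * a"
  by (simp_all add: lmul_def rmul_def bounded_linear_mult_right bounded_linear_mult_left)

lemma lmul_rmul_commute: "lmul a * rmul b = rmul b * lmul a"
  by (rule endo_eqI) (simp add: mult.assoc)

lemma lmul_mult: "lmul (a * b) = lmul a * lmul b"
  and rmul_mult: "rmul (a * b) = rmul b * rmul a"
  and lmul_one: "lmul 1 = 1"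
  and rmul_one: "rmul 1 = 1"
  by (rule endo_eqI; simp add: mult.assoc)+

lemma lmul_power: "lmul (a ^ n) = lmul a ^ n"
  and rmul_power: "rmul (a ^ n) = rmul a ^ n"
  by (induction n) (simp_all add: lmul_mult rmul_mult lmul_one rmul_one power_commutes del: power_Suc add: power_Suc2[of a] power_Suc)

lemma lmul_linear: "linear lmul"
  and rmul_linear: "linear rmul"
  by (intro linearI endo_eqI; simp add: endo.add_left endo.scaleR_left algebra_simps)+

section \<open>Power series evaluated at nilpotent elements\<close>

text \<open>Meant for nilpotent \<open>z\<close>, where the sum is finite and evaluation is a ring
  homomorphism compatible with composition. The infinite sum keeps the nilpotency index out of the
  definition.\<close>

definition fps_eval :: "real fps \<Rightarrow> 'a::{real_normed_algebra_1,banach} \<Rightarrow> 'a" where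
  "fps_eval f z = (\<Sum>k. fps_nth f k *\<^sub>R z ^ k)"

lemma power_eq_0_mono:
  fixes z :: "'a::semiring_1"
  assumes "z ^ M = 0" "M \<le> k"
  shows "z ^ k = 0"
proof -
  have "z ^ k = z ^ M * z ^ (k - M)" using assms(2) by (simp flip: power_add)
  then show ?thesis using assms(1) by simp
qed

lemma nilpotent_sums:
  fixes z :: "'a::real_normed_algebra_1"
  assumes "z ^ M = 0"
  shows "(\<lambda>k. c k *\<^sub>R z ^ k) sums (\<Sum>k<M. c k *\<^sub>R z ^ k)"
  by (rule sums_finite) (use power_eq_0_mono[OF assms] in auto)

lemma fps_eval_finite:
  assumes "z ^ M = 0"
  shows "fps_eval f z = (\<Sum>k<M. fps_nth f k *\<^sub>R z ^ k)"
  unfolding fps_eval_def by (rule sums_unique[symmetric]) (rule nilpotent_sums[OF assms])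

lemma nilpotent_summable_norm:
  fixes z :: "'a::real_normed_algebra_1"
  assumes "z ^ M = 0"
  shows "summable (\<lambda>k. norm (c k *\<^sub>R z ^ k))"
  by (rule summable_finite[of "{..<M}"]) (use power_eq_0_mono[OF assms] in auto)

lemma fps_eval_mult:
  assumes "z ^ M = 0"
  shows "fps_eval (f * g) z = fps_eval f z * fps_eval g z"
proof -
  have "fps_eval f z * fps_eval g z =
      (\<Sum>k. \<Sum>i\<le>k. (fps_nth f i *\<^sub>R z ^ i) * (fps_nth g (k - i) *\<^sub>R z ^ (k - i)))"
    unfolding fps_eval_def by (rule Cauchy_product; rule nilpotent_summable_norm[OF assms])
  also have "\<dots> = fps_eval (f * g) z"
    unfolding fps_eval_def
    by (intro suminf_cong)
       (simp add: fps_mult_nth scaleR_sum_left atLeast0AtMost mult.commute flip: power_add)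
  finally show ?thesis by simp
qed

lemma fps_eval_diff:
  assumes "z ^ M = 0"
  shows "fps_eval (f - g) z = fps_eval f z - fps_eval g z"
  by (simp add: fps_eval_finite[OF assms] scaleR_diff_left sum_subtractf)

lemma fps_eval_one [simp]: "fps_eval 1 z = 1"
proof -
  have "(\<lambda>k. fps_nth 1 k *\<^sub>R z ^ k) sums (\<Sum>k\<in>{0}. fps_nth 1 k *\<^sub>R z ^ k)"
    by (rule sums_finite) auto
  then show ?thesis unfolding fps_eval_def by (simp add: sums_iff)
qed

lemma fps_eval_X [simp]: "fps_eval fps_X z = z"
proof -
  have "(\<lambda>k. fps_nth fps_X k *\<^sub>R z ^ k) sums (\<Sum>k\<in>{1}. fps_nth fps_X k *\<^sub>R z ^ k)"
    by (rule sums_finite) auto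
  then show ?thesis unfolding fps_eval_def by (simp add: sums_iff)
qed

lemma fps_eval_power:
  assumes "z ^ M = 0"
  shows "fps_eval (f ^ n) z = fps_eval f z ^ n"
  by (induction n) (simp_all add: fps_eval_mult[OF assms])

text \<open>Without a constant term in \<open>g\<close>, the series \<open>g ^ M\<close> starts in
  degree \<open>M\<close>.\<close>

lemma fps_eval_nilpotent:
  assumes "z ^ M = 0" "fps_nth g 0 = 0"
  shows "fps_eval g z ^ M = 0"
proof -
  have "fps_eval g z ^ M = fps_eval (g ^ M) z" by (rule fps_eval_power[OF assms(1), symmetric])
  also have "\<dots> = 0"
    using startsby_zero_power_prefix[OF assms(2), of M] by (simp add: fps_eval_finite[OF assms(1)])
  finally show ?thesis .
qed

text \<open>Both series may be cut at degree \<open>M\<close>. Since \<open>g\<close> has no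
  constant term, \<open>g ^ i\<close> has no coefficient in degree \<open>k < i\<close>, so the
  reordered finite double sum contains exactly the terms that define the coefficients of the
  composition.\<close>

lemma fps_eval_compose:
  assumes "z ^ M = 0" "fps_nth g 0 = 0"
  shows "fps_eval (f oo g) z = fps_eval f (fps_eval g z)"
proof -
  have "fps_eval f (fps_eval g z) = (\<Sum>i<M. fps_nth f i *\<^sub>R fps_eval (g ^ i) z)"
    using fps_eval_finite[OF fps_eval_nilpotent[OF assms], of f]
    by (simp add: fps_eval_power[OF assms(1)])
  also have "\<dots> = (\<Sum>i<M. fps_nth f i *\<^sub>R (\<Sum>k<M. fps_nth (g ^ i) k *\<^sub>R z ^ k))"
    by (simp add: fps_eval_finite[OF assms(1)])
  also have "\<dots> = (\<Sum>k<M. (\<Sum>i<M. fps_nth f i * fps_nth (g ^ i) k) *\<^sub>R z ^ k)"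
    by (simp add: scaleR_sum_right scaleR_sum_left) (rule sum.swap)
  also have "\<dots> = (\<Sum>k<M. fps_nth (f oo g) k *\<^sub>R z ^ k)"
  proof (intro sum.cong refl arg_cong2[where f = scaleR])
    fix k assume "k \<in> {..<M}"
    then show "(\<Sum>i<M. fps_nth f i * fps_nth (g ^ i) k) = fps_nth (f oo g) k"
      unfolding fps_compose_nth
      by (intro sum.mono_neutral_right) (use startsby_zero_power_prefix[OF assms(2)] in auto)
  qed
  finally show ?thesis by (simp add: fps_eval_finite[OF assms(1)])
qed

lemma fps_eval_exp: "fps_eval (fps_exp 1) z = exp z"
  by (simp add: fps_eval_def exp_def divide_inverse)

lemma fps_ln_one_eq: "fps_ln (1::real) = fps_inv (fps_exp 1 - 1)"
  by (rule fps_ln_fps_exp_inv) simp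

text \<open>The formal identity \<open>(fps_exp 1 - 1) oo fps_ln 1 = fps_X\<close>, evaluated at
  \<open>W - 1\<close>.\<close>

lemma exp_fps_eval_ln:
  fixes W :: "'a::{real_normed_algebra_1,banach}"
  assumes "(W - 1) ^ M = 0"
  shows "exp (fps_eval (fps_ln 1) (W - 1)) = W"
proof -
  let ?L = "fps_eval (fps_ln 1) (W - 1)"
  have L: "?L ^ M = 0" by (rule fps_eval_nilpotent[OF assms]) simp
  have "exp ?L - 1 = fps_eval (fps_exp 1 - 1) ?L"
    by (simp add: fps_eval_exp fps_eval_diff[OF L])
  also have "\<dots> = fps_eval ((fps_exp 1 - 1) oo fps_ln 1) (W - 1)"
    by (rule fps_eval_compose[OF assms, symmetric]) simp
  also have "\<dots> = W - 1"
    using fps_inv_fps_exp_compose(2)[of "1::real"] by (simp add: fps_ln_one_eq)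
  finally show ?thesis by simp
qed

lemma exp_minus_one_nilpotent:
  fixes z :: "'a::{real_normed_algebra_1,banach}"
  assumes "z ^ M = 0"
  shows "(exp z - 1) ^ M = 0"
  using fps_eval_nilpotent[OF assms, of "fps_exp 1 - 1"]
  by (simp add: fps_eval_exp fps_eval_diff[OF assms])

lemma fps_eval_compose_exp:
  fixes z :: "'a::{real_normed_algebra_1,banach}"
  assumes "z ^ M = 0"
  shows "fps_eval f (exp z - 1) = fps_eval (f oo (fps_exp 1 - 1)) z"
  using fps_eval_compose[OF assms, of "fps_exp 1 - 1" f]
  by (simp add: fps_eval_exp fps_eval_diff[OF assms])

lemma fps_eval_ln_exp:
  fixes z :: "'a::{real_normed_algebra_1,banach}"
  assumes "z ^ M = 0"
  shows "fps_eval (fps_ln 1) (exp z - 1) = z"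
  using fps_inv_fps_exp_compose(1)[of "1::real"]
  by (simp add: fps_eval_compose_exp[OF assms] fps_ln_one_eq)

text \<open>The logarithm series recovers a nilpotent element from its exponential, however large
  the element is.\<close>

lemma exp_inject_nilpotent:
  fixes y z :: "'a::{real_normed_algebra_1,banach}"
  assumes "y ^ M = 0" "z ^ N = 0" "exp y = exp z"
  shows "y = z"
  by (metis assms fps_eval_ln_exp)

text \<open>These are \<open>(exp z - 1) / z\<close> and \<open>ln (1 + s) / s\<close>.\<close>

definition fps_exp_quot :: "real fps" where
  "fps_exp_quot = Abs_fps (\<lambda>n. 1 / fact (Suc n))"

definition fps_ln_quot :: "real fps" where
  "fps_ln_quot = Abs_fps (\<lambda>n. (- 1) ^ n / real (Suc n))"

text \<open>With \<open>s = exp z - 1\<close> this reads \<open>(z / s) * (s / z) = 1\<close>. A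
  nilpotent \<open>z\<close> has no inverse, so the identity is proved for formal series, by
  multiplying with \<open>fps_X\<close> and cancelling it, and evaluated only then.\<close>

lemma fps_eval_ln_quot_exp_quot:
  fixes z :: "'a::{real_normed_algebra_1,banach}"
  assumes "z ^ M = 0"
  shows "fps_eval fps_ln_quot (exp z - 1) * fps_eval fps_exp_quot z = 1"
proof -
  let ?e = "fps_exp 1 - 1 :: real fps"
  have e: "fps_exp_quot * fps_X = ?e"
    by (rule fps_ext) (simp add: fps_exp_quot_def fact_reduce)
  have l: "fps_ln_quot * fps_X = fps_ln 1"
    by (rule fps_ext) (auto simp: fps_ln_quot_def fps_ln_nth)
  have "(fps_ln_quot oo ?e) * fps_exp_quot * fps_X = (fps_ln_quot oo ?e) * (fps_X oo ?e)"
    by (simp add: mult.assoc e)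
  also have "\<dots> = fps_ln 1 oo ?e"
    unfolding l[symmetric] by (rule fps_compose_mult_distrib[symmetric]) simp
  also have "\<dots> = 1 * fps_X"
    using fps_inv_fps_exp_compose(1)[of "1::real"] by (simp add: fps_ln_one_eq)
  finally have "(fps_ln_quot oo ?e) * fps_exp_quot = 1"
    by (rule mult_right_cancel[THEN iffD1, rotated]) simp
  then show ?thesis
    by (simp add: fps_eval_compose_exp[OF assms] flip: fps_eval_mult[OF assms])
qed

lemma fps_eval_commute:
  assumes "z ^ M = 0" "a * z = z * a"
  shows "a * fps_eval f z = fps_eval f z * a"
proof -
  have "a * z ^ k = z ^ k * a" for k
    using power_commuting_commutes[OF assms(2)[symmetric]] by simp
  then show ?thesis
    by (simp add: fps_eval_finite[OF assms(1)] sum_distrib_left sum_distrib_right)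
qed

section \<open>The derivative of the exponential of a nilpotent curve\<close>

lemma binomial_commuting:
  fixes d r :: "'a::real_algebra_1"
  assumes "d * r = r * d"
  shows "(d + r) ^ n = (\<Sum>k\<le>n. real (n choose k) *\<^sub>R (d ^ k * r ^ (n - k)))"
proof (induction n)
  case (Suc n)
  have rd: "r * (d ^ k * x) = d ^ k * (r * x)" for k x
    using power_commuting_commutes[OF assms, of k] by (metis mult.assoc)
  have "(d + r) ^ Suc n = (\<Sum>k\<le>n. real (n choose k) *\<^sub>R (d ^ Suc k * r ^ (n - k))) +
      (\<Sum>k\<le>n. real (n choose k) *\<^sub>R (d ^ k * r ^ (Suc n - k)))"
    by (simp add: Suc.IH distrib_right sum_distrib_left mult.assoc Suc_diff_le rd
        scaleR_add_right sum.distrib)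
  also have "(\<Sum>k\<le>n. real (n choose k) *\<^sub>R (d ^ k * r ^ (Suc n - k))) =
      r ^ Suc n + (\<Sum>k\<le>n. real (n choose Suc k) *\<^sub>R (d ^ Suc k * r ^ (n - k)))"
  proof -
    have "(\<Sum>k\<le>n. real (n choose k) *\<^sub>R (d ^ k * r ^ (Suc n - k))) =
        (\<Sum>k\<le>Suc n. real (n choose k) *\<^sub>R (d ^ k * r ^ (Suc n - k)))"
      by simp
    then show ?thesis by (simp only: sum.atMost_Suc_shift) simp
  qed
  finally show ?case
    by (simp only: sum.atMost_Suc_shift[of _ n])
       (simp add: scaleR_add_left sum.distrib algebra_simps)
qed simp

text \<open>Both sides are \<open>(l ^ n - r ^ n) / (l - r)\<close> whenever the quotient makes
  sense; the right one is the binomial expansion of \<open>((l - r) + r) ^ n\<close>. In the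
  application \<open>l - r\<close> is nilpotent, so induction on \<open>n\<close> takes the place of
  the division.\<close>

lemma telescoping_powers_commuting:
  fixes l r :: "'a::real_algebra_1"
  assumes "l * r = r * l"
  shows "(\<Sum>i<n. l ^ i * r ^ (n - Suc i)) =
    (\<Sum>k<n. real (n choose Suc k) *\<^sub>R ((l - r) ^ k * r ^ (n - Suc k)))"
proof (induction n)
  case (Suc n)
  have c: "(l - r) * r = r * (l - r)" using assms by (simp add: algebra_simps)
  have ln: "l ^ n = (\<Sum>k\<le>n. real (n choose k) *\<^sub>R ((l - r) ^ k * r ^ (n - k)))"
    using binomial_commuting[OF c, of n] by simp
  have "(\<Sum>i<Suc n. l ^ i * r ^ (Suc n - Suc i)) = (\<Sum>i<n. l ^ i * r ^ (n - Suc i)) * r + l ^ n"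
    by (auto simp: sum_distrib_right mult.assoc Suc_diff_Suc simp flip: power_Suc2 intro!: sum.cong)
  also have "\<dots> = (\<Sum>k\<le>n. real (n choose Suc k) *\<^sub>R ((l - r) ^ k * r ^ (n - k))) + l ^ n"
    by (auto simp: Suc.IH sum_distrib_right mult.assoc Suc_diff_Suc lessThan_Suc_atMost[symmetric]
        simp flip: power_Suc2 intro!: sum.cong)
  also have "\<dots> = (\<Sum>k\<le>n. real (Suc n choose Suc k) *\<^sub>R ((l - r) ^ k * r ^ (n - k)))"
    by (simp add: ln scaleR_add_left sum.distrib algebra_simps)
  finally show ?case by (simp add: lessThan_Suc_atMost)
qed simp

text \<open>In every term of the binomial expansion one of the two exponents is at least
  \<open>M\<close>; hence the exponent \<open>2 * M\<close>.\<close>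

lemma diff_nilpotent_commuting:
  fixes l r :: "'a::real_algebra_1"
  assumes "l * r = r * l" "l ^ M = 0" "r ^ M = 0"
  shows "(l - r) ^ (2 * M) = 0"
proof -
  have "l ^ k * (- r) ^ (2 * M - k) = 0" for k
  proof (cases "M \<le> k")
    case True then show ?thesis using power_eq_0_mono[OF assms(2)] by simp
  next
    case False
    then have "r ^ (2 * M - k) = 0" by (intro power_eq_0_mono[OF assms(3)]) simp
    then show ?thesis by (metis mult_zero_right power_minus)
  qed
  then show ?thesis
    using binomial_commuting[of l "- r" "2 * M"] assms(1) by simp
qed

lemma has_vector_derivative_power_noncomm:
  fixes L :: "real \<Rightarrow> 'a::real_normed_algebra_1"
  assumes "(L has_vector_derivative L') (at t)"
  shows "((\<lambda>s. L s ^ n) has_vector_derivative (\<Sum>i<n. L t ^ i * L' * L t ^ (n - Suc i))) (at t)"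
proof (induction n)
  case (Suc n)
  have "((\<lambda>s. L s ^ n * L s) has_vector_derivative
      L t ^ n * L' + (\<Sum>i<n. L t ^ i * L' * L t ^ (n - Suc i)) * L t) (at t)"
    by (rule has_vector_derivative_mult[OF Suc.IH assms])
  also have "(\<Sum>i<n. L t ^ i * L' * L t ^ (n - Suc i)) * L t =
      (\<Sum>i<n. L t ^ i * L' * L t ^ (Suc n - Suc i))"
    unfolding sum_distrib_right
    by (intro sum.cong refl) (simp add: mult.assoc Suc_diff_Suc flip: power_Suc2)
  finally show ?case by (simp add: power_Suc2 add.commute del: power_Suc)
qed simp

lemma exp_lmul:
  fixes z :: "'a::{real_normed_algebra_1,banach}"
  assumes "z ^ M = 0"
  shows "exp (lmul z) = lmul (exp z)"
proof -
  have *: "lmul z ^ M = 0" using assms linear_0[OF lmul_linear] by (simp flip: lmul_power)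
  show ?thesis
    by (simp only: fps_eval_finite[OF assms] fps_eval_finite[OF *] linear_sum[OF lmul_linear]
        linear_scale[OF lmul_linear] lmul_power fps_eval_exp[symmetric])
qed

lemma exp_rmul:
  fixes z :: "'a::{real_normed_algebra_1,banach}"
  assumes "z ^ M = 0"
  shows "exp (rmul z) = rmul (exp z)"
proof -
  have *: "rmul z ^ M = 0" using assms linear_0[OF rmul_linear] by (simp flip: rmul_power)
  show ?thesis
    by (simp only: fps_eval_finite[OF assms] fps_eval_finite[OF *] linear_sum[OF rmul_linear]
        linear_scale[OF rmul_linear] rmul_power fps_eval_exp[symmetric])
qed

text \<open>Differentiating the exponential series term by term gives
  \<open>(exp l - exp r) / (l - r)\<close> applied to \<open>L'\<close>, where \<open>l\<close> and
  \<open>r\<close> are left and right multiplication by \<open>L t\<close>. As they commute, this is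
  \<open>(exp (l - r) - 1) / (l - r)\<close> times \<open>exp r\<close>, and \<open>exp r\<close> is
  right multiplication by \<open>exp (L t)\<close>.\<close>

lemma has_vector_derivative_exp_nilpotent:
  fixes L :: "real \<Rightarrow> 'a::{real_normed_algebra_1,banach}"
  assumes "(L has_vector_derivative L') (at t)" and nil: "\<And>s. L s ^ M = 0"
  shows "((\<lambda>s. exp (L s)) has_vector_derivative
    endo_apply (fps_eval fps_exp_quot (lmul (L t) - rmul (L t))) L' * exp (L t)) (at t)"
proof -
  define l r where "l = lmul (L t)" and "r = rmul (L t)"
  have lr: "l * r = r * l" by (simp add: l_def r_def lmul_rmul_commute)
  have lM: "l ^ M = 0" and rM: "r ^ M = 0"
    using nil[of t] linear_0[OF lmul_linear] linear_0[OF rmul_linear]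
    by (simp_all add: l_def r_def flip: lmul_power rmul_power)
  let ?T = "\<lambda>n. \<Sum>i<n. l ^ i * r ^ (n - Suc i)"
  \<comment> \<open>The two exponents add up to \<open>n - 1 \<ge> 2 * M\<close>, so one of them
    reaches \<open>M\<close>.\<close>
  have T0: "?T n = 0" if "2 * M < n" for n
  proof (rule sum.neutral, rule ballI)
    fix i assume "i \<in> {..<n}"
    show "l ^ i * r ^ (n - Suc i) = 0"
    proof (cases "M \<le> i")
      case True then show ?thesis using power_eq_0_mono[OF lM] by simp
    next
      case False
      then have "r ^ (n - Suc i) = 0" using that by (intro power_eq_0_mono[OF rM]) simp
      then show ?thesis by simp
    qed
  qed
  have "((\<lambda>s. \<Sum>n<Suc (2 * M). inverse (fact n) *\<^sub>R L s ^ n) has_vector_derivative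
      (\<Sum>n<Suc (2 * M). inverse (fact n) *\<^sub>R (\<Sum>i<n. L t ^ i * L' * L t ^ (n - Suc i)))) (at t)"
    by (intro has_vector_derivative_sum has_vector_derivative_power_noncomm assms(1)
        bounded_linear.has_vector_derivative[OF bounded_linear_scaleR_right])
  moreover have "exp (L s) = (\<Sum>n<Suc (2 * M). inverse (fact n) *\<^sub>R L s ^ n)" for s
  proof -
    have "L s ^ Suc (2 * M) = 0" by (rule power_eq_0_mono[OF nil]) simp
    from sums_unique[OF nilpotent_sums[OF this, of "\<lambda>n. inverse (fact n)"]] show ?thesis
      by (simp add: exp_def)
  qed
  moreover have "(\<Sum>n<Suc (2 * M). inverse (fact n) *\<^sub>R (\<Sum>i<n. L t ^ i * L' * L t ^ (n - Suc i))) =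
      endo_apply (\<Sum>n<Suc (2 * M). inverse (fact n) *\<^sub>R ?T n) L'"
    by (simp only: endo.sum_left endo.scaleR_left endo_apply_mult l_def r_def lmul_power[symmetric]
        rmul_power[symmetric] lmul_apply rmul_apply mult.assoc)
  moreover have "(\<Sum>n<Suc (2 * M). inverse (fact n) *\<^sub>R ?T n) = fps_eval fps_exp_quot (l - r) * exp r"
  proof -
    have "fps_eval fps_exp_quot (l - r) * exp r =
        (\<Sum>k. \<Sum>i\<le>k. (fps_nth fps_exp_quot i *\<^sub>R (l - r) ^ i) * (inverse (fact (k - i)) *\<^sub>R r ^ (k - i)))"
      unfolding fps_eval_def exp_def
      by (rule Cauchy_product; rule nilpotent_summable_norm[OF diff_nilpotent_commuting[OF lr lM rM]]
          nilpotent_summable_norm[OF rM])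
    also have "\<dots> = (\<Sum>k. inverse (fact (Suc k)) *\<^sub>R ?T (Suc k))"
    proof (intro suminf_cong)
      fix k
      \<comment> \<open>The factorials combine by
        \<open>1 / ((i + 1)! (k - i)!) = binomial(k + 1, i + 1) / (k + 1)!\<close>, which matches
        the coefficients of the telescoping formula for \<open>n = k + 1\<close>.\<close>
      have "(fps_nth fps_exp_quot i *\<^sub>R (l - r) ^ i) * (inverse (fact (k - i)) *\<^sub>R r ^ (k - i)) =
          inverse (fact (Suc k)) *\<^sub>R (real (Suc k choose Suc i) *\<^sub>R ((l - r) ^ i * r ^ (Suc k - Suc i)))"
        if "i \<le> k" for i
        using that by (simp add: fps_exp_quot_def binomial_fact del: binomial_Suc_Suc fact_Suc of_nat_Suc)
           (simp add: field_simps)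
      then show "(\<Sum>i\<le>k. (fps_nth fps_exp_quot i *\<^sub>R (l - r) ^ i) * (inverse (fact (k - i)) *\<^sub>R r ^ (k - i)))
          = inverse (fact (Suc k)) *\<^sub>R ?T (Suc k)"
        by (subst telescoping_powers_commuting[OF lr], simp only: scaleR_sum_right
            lessThan_Suc_atMost) (intro sum.cong refl, simp only: atMost_iff)
    qed
    also have "\<dots> = (\<Sum>k<2 * M. inverse (fact (Suc k)) *\<^sub>R ?T (Suc k))"
    proof (rule suminf_finite)
      show "inverse (fact (Suc k)) *\<^sub>R ?T (Suc k) = 0" if "k \<notin> {..<2 * M}" for k
        by (subst T0) (use that in auto)
    qed simp
    also have "\<dots> = (\<Sum>n<Suc (2 * M). inverse (fact n) *\<^sub>R ?T n)"
      by (simp only: sum.lessThan_Suc_shift[of _ "2 * M"]) simp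
    finally show ?thesis by simp
  qed
  moreover have "exp r = rmul (exp (L t))" unfolding r_def by (rule exp_rmul[OF nil])
  moreover have "fps_eval fps_exp_quot (l - r) * rmul (exp (L t)) =
      rmul (exp (L t)) * fps_eval fps_exp_quot (l - r)"
  proof (rule fps_eval_commute[OF diff_nilpotent_commuting[OF lr lM rM], symmetric])
    show "rmul (exp (L t)) * (l - r) = (l - r) * rmul (exp (L t))"
      by (rule endo_eqI)
         (simp add: l_def r_def endo.diff_left algebra_simps exp_times_arg_commute)
  qed
  ultimately show ?thesis by (simp add: l_def r_def)
qed

section \<open>The Baker-Campbell-Hausdorff formula in a filtered algebra\<close>

definition commutator :: "'a::ring \<Rightarrow> 'a \<Rightarrow> 'a" where
  "commutator a b = a * b - b * a"

definition ad :: "'a::real_normed_algebra_1 \<Rightarrow> 'a endo" where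
  "ad a = lmul a - rmul a"

lemma ad_apply [simp]: "endo_apply (ad a) m = commutator a m"
  by (simp add: ad_def endo.diff_left commutator_def)

lemma ad_scaleR: "ad (t *\<^sub>R a) = t *\<^sub>R ad a"
  by (simp add: ad_def linear_scale[OF lmul_linear] linear_scale[OF rmul_linear] scaleR_diff_right)

lemma ad_nilpotent:
  fixes a :: "'a::real_normed_algebra_1"
  assumes "a ^ M = 0"
  shows "ad a ^ (2 * M) = 0"
  unfolding ad_def
  using assms linear_0[OF lmul_linear] linear_0[OF rmul_linear]
  by (intro diff_nilpotent_commuting lmul_rmul_commute) (simp_all flip: lmul_power rmul_power)

text \<open>The operator \<open>ad a\<close> is the sum of the commuting operators
  \<open>lmul a\<close> and \<open>rmul (- a)\<close>. So the exponential of \<open>ad a\<close> is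
  conjugation by \<open>exp a\<close>.\<close>

lemma exp_ad:
  fixes a :: "'a::{real_normed_algebra_1,banach}"
  assumes "a ^ M = 0"
  shows "exp (ad a) = lmul (exp a) * rmul (exp (- a))"
proof -
  have m: "(- a) ^ M = 0" using assms by (metis power_minus mult_zero_right)
  have "ad a = lmul a + rmul (- a)" by (simp add: ad_def linear_neg[OF rmul_linear])
  then show ?thesis
    by (simp add: exp_add_commuting lmul_rmul_commute exp_lmul[OF assms] exp_rmul[OF m])
qed

section \<open>Iterated brackets and Dynkin words\<close>

lemma iterated_bracket_Cons:
  "ws \<noteq> [] \<Longrightarrow> iterated_bracket B (w # ws) = B w (iterated_bracket B ws)"
  by (cases ws) auto

lemma iterated_bracket_replicate_append:
  assumes "ws \<noteq> []"
  shows "iterated_bracket B (replicate p a @ ws) = (B a ^^ p) (iterated_bracket B ws)"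
  using assms by (induction p) (simp_all add: iterated_bracket_Cons)

text \<open>The innermost bracket is \<open>B a a\<close>.\<close>

lemma iterated_bracket_replicate_eq_0:
  assumes "\<And>v. B v v = 0" "\<And>v. B v 0 = 0" "2 \<le> p"
  shows "iterated_bracket B (replicate p a) = 0"
proof -
  have "replicate p a = replicate (p - 2) a @ [a, a]"
    using assms(3) by (metis add_diff_inverse_nat add.commute linorder_not_less numeral_2_eq_2
        replicate.simps replicate_add)
  moreover have "(B a ^^ n) 0 = 0" for n by (induction n) (simp_all add: assms)
  ultimately show ?thesis by (simp add: iterated_bracket_replicate_append assms)
qed

lemma iterated_bracket_scaleR:
  assumes "bilinear B"
  shows "iterated_bracket B (map (scaleR t) ws) = t ^ length ws *\<^sub>R iterated_bracket B ws"
  by (induction ws rule: induct_list012)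
     (simp_all add: bilinear_lmul[OF assms] bilinear_rmul[OF assms])

lemma length_dynkin_word [simp]: "length (dynkin_word x y s) = (\<Sum>(p, q)\<leftarrow>s. p + q)"
  by (induction s) (auto simp: dynkin_word_def)

lemma map_dynkin_word: "map f (dynkin_word x y s) = dynkin_word (f x) (f y) s"
  by (induction s) (auto simp: dynkin_word_def)

lemma dynkin_word_Cons:
  "dynkin_word x y ((p, q) # s) = replicate p x @ replicate q y @ dynkin_word x y s"
  by (simp add: dynkin_word_def)

lemma set_dynkin_word: "set (dynkin_word x y s) \<subseteq> {x, y}"
proof (induction s)
  case (Cons a s)
  then show ?case by (cases a) (simp add: dynkin_word_Cons set_replicate_conv_if)
qed (simp add: dynkin_word_def)

lemma dynkin_index_sum_pos:
  assumes "s \<in> dynkin_index N k" "k \<noteq> 0"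
  shows "0 < (\<Sum>(p, q)\<leftarrow>s. p + q)"
  using assms by (cases s) (auto simp: dynkin_index_def)

lemma dynkin_index_block_le:
  assumes "s \<in> dynkin_index N k" "(p, q) \<in> set s"
  shows "p + q \<le> N"
proof -
  have "p + q \<in> set (map (\<lambda>(p, q). p + q) s)" using assms(2) by force
  from member_le_sum_list[OF this] show ?thesis using assms(1) by (simp add: dynkin_index_def)
qed

lemma finite_dynkin_index [simp]: "finite (dynkin_index N k)"
proof (rule finite_subset)
  show "dynkin_index N k \<subseteq> {s. set s \<subseteq> {..N} \<times> {..N} \<and> length s = k}"
  proof
    fix s assume s: "s \<in> dynkin_index N k"
    have "p + q \<le> N" if "(p, q) \<in> set s" for p q
      by (rule dynkin_index_block_le[OF s that])
    then show "s \<in> {s. set s \<subseteq> {..N} \<times> {..N} \<and> length s = k}"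
      using s by (force simp: dynkin_index_def)
  qed
qed (simp add: finite_lists_length_eq)

lemma bilinear_commutator: "bilinear (commutator :: 'a::real_algebra \<Rightarrow> 'a \<Rightarrow> 'a)"
  unfolding bilinear_def commutator_def
  by (auto intro!: linearI simp: algebra_simps)

text \<open>Products of more than \<open>r\<close> elements of \<open>F 1\<close> vanish. Therefore
  elements of \<open>F 1\<close> are nilpotent, and cutting Dynkin's series at \<open>r\<close>
  letters loses nothing on \<open>F 1\<close>.\<close>

locale filtered_algebra =
  fixes F :: "nat \<Rightarrow> 'a::{real_normed_algebra_1,banach} set" and r :: nat
  assumes subspace_F: "subspace (F k)"
    and mult_F: "a \<in> F i \<Longrightarrow> b \<in> F j \<Longrightarrow> a * b \<in> F (i + j)"
    and one_F: "1 \<in> F 0"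
    and F_Suc: "F (Suc k) \<subseteq> F k"
    and F_Suc_r: "F (Suc r) = {0}"
    and r_pos: "1 \<le> r"
begin

lemma F_antimono: "i \<le> j \<Longrightarrow> F j \<subseteq> F i"
  by (rule lift_Suc_antimono_le) (use F_Suc in auto)

lemma F_eq_0: "r < k \<Longrightarrow> a \<in> F k \<Longrightarrow> a = 0"
  using F_antimono[of "Suc r" k] F_Suc_r by auto

lemma power_F: "a \<in> F 1 \<Longrightarrow> a ^ k \<in> F k"
  by (induction k) (use one_F mult_F[of a 1] in auto)

lemma power_eq_0: "a \<in> F 1 \<Longrightarrow> a ^ Suc r = 0"
  using power_F F_Suc_r by blast

lemma commutator_F: "a \<in> F i \<Longrightarrow> b \<in> F j \<Longrightarrow> commutator a b \<in> F (i + j)"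
  unfolding commutator_def
  using mult_F[of a i b j] mult_F[of b j a i] subspace_diff[OF subspace_F] by (simp add: add.commute)

lemma fps_eval_F:
  assumes "a \<in> F 1" "fps_nth f 0 = 0"
  shows "fps_eval f a \<in> F 1"
  unfolding fps_eval_finite[OF power_eq_0[OF assms(1)]]
proof (intro subspace_sum[OF subspace_F])
  fix k
  have "a ^ k \<in> F 1" if "k \<noteq> 0"
    using power_F[OF assms(1), of k] F_antimono[of 1 k] that by auto
  then show "fps_nth f k *\<^sub>R a ^ k \<in> F 1"
    using assms(2) by (cases "k = 0") (auto intro: subspace_scale subspace_0 subspace_F)
qed

lemma exp_F: "a \<in> F 1 \<Longrightarrow> exp a - 1 \<in> F 1"
  using fps_eval_F[of a "fps_exp 1 - 1"] by (simp add: fps_eval_diff[OF power_eq_0] fps_eval_exp)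

lemma ad_power_F:
  assumes "a \<in> F 1" "u \<in> F j"
  shows "endo_apply (ad a ^ p) u \<in> F (p + j)"
  by (induction p) (use assms commutator_F[of a 1] in auto)

lemma iterated_commutator_F:
  "set ws \<subseteq> F 1 \<Longrightarrow> ws \<noteq> [] \<Longrightarrow> iterated_bracket commutator ws \<in> F (length ws)"
proof (induction "commutator :: 'a \<Rightarrow> 'a \<Rightarrow> 'a" ws rule: iterated_bracket.induct)
  case (3 x y zs)
  then show ?case using commutator_F[of x 1 _ "length (y # zs)"] by simp
qed simp_all

lemma exp_ad_apply:
  assumes "a \<in> F 1" "u \<in> F 1"
  shows "endo_apply (exp (t *\<^sub>R ad a)) u = (\<Sum>p\<le>r. (t ^ p / fact p) *\<^sub>R endo_apply (ad a ^ p) u)"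
proof -
  \<comment> \<open>This is the nilpotency index that \<open>ad_nilpotent\<close> provides for
    \<open>ad a\<close> on the whole algebra. On \<open>F 1\<close> the filtration cuts the sum down
    to exponents up to \<open>r\<close>.\<close>
  define M where "M = 2 * Suc r"
  have "(t *\<^sub>R ad a) ^ M = 0"
    unfolding M_def by (simp only: scaleR_power ad_nilpotent[OF power_eq_0[OF assms(1)]]) simp
  note fps_eval_finite[OF this, of "fps_exp 1"]
  then have "endo_apply (exp (t *\<^sub>R ad a)) u =
      (\<Sum>p<M. (t ^ p / fact p) *\<^sub>R endo_apply (ad a ^ p) u)"
    by (simp add: fps_eval_exp endo.sum_left endo.scaleR_left scaleR_power)
  also have "\<dots> = (\<Sum>p\<le>r. (t ^ p / fact p) *\<^sub>R endo_apply (ad a ^ p) u)"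
    using F_eq_0[OF _ ad_power_F[OF assms]] by (intro sum.mono_neutral_right) (auto simp: M_def)
  finally show ?thesis .
qed

section \<open>Dynkin's series along the path \<open>(t x, t y)\<close>\<close>

context
  fixes x y :: 'a
  assumes x: "x \<in> F 1" and y: "y \<in> F 1"
begin

definition block_index :: "(nat \<times> nat) set" where
  "block_index = {(p, q). 0 < p + q \<and> p \<le> r \<and> q \<le> r}"

lemma finite_block_index: "finite block_index"
  by (rule finite_subset[of _ "{..r} \<times> {..r}"]) (auto simp: block_index_def)

text \<open>This is conjugation by \<open>exp (t x) exp (t y)\<close>, written through
  \<open>ad x\<close> and \<open>ad y\<close> so that it can be expanded into blocks of a Dynkin
  word.\<close>

definition Ad_prod :: "real \<Rightarrow> 'a endo" where
  "Ad_prod t = exp (t *\<^sub>R ad x) * exp (t *\<^sub>R ad y)"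

text \<open>Expanding both exponentials gives one term for each pair \<open>(p, q)\<close>.
  Subtracting the identity removes exactly the pair \<open>(0, 0)\<close>, which is not a block, and
  every remaining pair raises the filtration degree.\<close>

lemma Ad_prod_minus_one_apply:
  assumes "u \<in> F j" "1 \<le> j"
  shows "endo_apply (Ad_prod t - 1) u =
      (\<Sum>(p, q)\<in>block_index. (t ^ (p + q) / (fact p * fact q)) *\<^sub>R
        endo_apply (ad x ^ p) (endo_apply (ad y ^ q) u))"
    and "endo_apply (Ad_prod t - 1) u \<in> F (Suc j)"
proof -
  let ?f = "\<lambda>(p, q). (t ^ (p + q) / (fact p * fact q)) *\<^sub>R
        endo_apply (ad x ^ p) (endo_apply (ad y ^ q) u)"
  have u: "u \<in> F 1" using assms F_antimono by blast
  have yu: "endo_apply (ad y ^ q) u \<in> F 1" for q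
    using ad_power_F[OF y u, of q] F_antimono[of 1 "q + 1"] by auto
  have "endo_apply (Ad_prod t) u = (\<Sum>q\<le>r. (t ^ q / fact q) *\<^sub>R
      (\<Sum>p\<le>r. (t ^ p / fact p) *\<^sub>R endo_apply (ad x ^ p) (endo_apply (ad y ^ q) u)))"
    by (simp add: Ad_prod_def exp_ad_apply[OF y u] endo.sum_right endo.scaleR_right
        exp_ad_apply[OF x yu])
  also have "\<dots> = (\<Sum>p\<le>r. \<Sum>q\<le>r. ?f (p, q))"
    by (subst sum.swap) (simp add: scaleR_sum_right power_add field_simps)
  also have "\<dots> = (\<Sum>pq\<in>{..r} \<times> {..r}. ?f pq)"
    by (simp add: sum.cartesian_product)
  also have "{..r} \<times> {..r} = insert (0, 0) block_index"
    by (auto simp: block_index_def)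
  also have "(\<Sum>pq\<in>insert (0, 0) block_index. ?f pq) = u + (\<Sum>pq\<in>block_index. ?f pq)"
    by (subst sum.insert) (auto simp: finite_block_index, simp add: block_index_def)
  finally show eq: "endo_apply (Ad_prod t - 1) u = (\<Sum>pq\<in>block_index. ?f pq)"
    by (simp add: endo.diff_left)
  show "endo_apply (Ad_prod t - 1) u \<in> F (Suc j)"
    unfolding eq
  proof (intro subspace_sum[OF subspace_F])
    fix pq assume pq: "pq \<in> block_index"
    obtain p q where [simp]: "pq = (p, q)" by (cases pq)
    have "Suc j \<le> p + (q + j)" using pq by (auto simp: block_index_def)
    then show "?f pq \<in> F (Suc j)"
      using subsetD[OF F_antimono ad_power_F[OF x ad_power_F[OF y assms(1)]]]
      by (auto intro: subspace_scale[OF subspace_F])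
  qed
qed

lemma Ad_prod_minus_one_power_F: "u \<in> F 1 \<Longrightarrow> endo_apply ((Ad_prod t - 1) ^ k) u \<in> F (Suc k)"
  by (induction k) (auto intro: Ad_prod_minus_one_apply(2))

text \<open>While \<open>dynkin_index\<close> bounds the number of letters of the whole word, here
  only each block is bounded. So a list of \<open>k + 1\<close> blocks is a free choice of a block
  and a list of \<open>k\<close> blocks, and sums factorize. The additional words have more than
  \<open>r\<close> letters, so their brackets vanish.\<close>

definition block_lists :: "nat \<Rightarrow> (nat \<times> nat) list set" where
  "block_lists k = {s. set s \<subseteq> block_index \<and> length s = k}"

text \<open>
  Up to the factor \<open>(-1)\<^sup>k\<^sup>-\<^sup>1 / k\<close>, this is the derivative in \<open>t\<close> of the summand with index \<open>s\<close> of Dynkin's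
  series for \<open>t x\<close> and \<open>t y\<close>: the denominator \<open>\<Sum>\<^sub>i p\<^sub>i + q\<^sub>i\<close> is cancelled by the exponent of \<open>t\<close>.
\<close>

definition word_term :: "real \<Rightarrow> (nat \<times> nat) list \<Rightarrow> 'a" where
  "word_term t s = (t ^ ((\<Sum>(p, q)\<leftarrow>s. p + q) - 1) / (\<Prod>(p, q)\<leftarrow>s. fact p * fact q)) *\<^sub>R
     iterated_bracket commutator (dynkin_word x y s)"

lemma iterated_word_F:
  assumes "0 < (\<Sum>(p, q)\<leftarrow>s. p + q)"
  shows "iterated_bracket commutator (dynkin_word x y s) \<in> F (\<Sum>(p, q)\<leftarrow>s. p + q)"
proof -
  have "dynkin_word x y s \<noteq> []" using assms by (metis length_dynkin_word less_numeral_extra(3) list.size(3))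
  moreover have "set (dynkin_word x y s) \<subseteq> F 1" using set_dynkin_word[of x y s] x y by auto
  ultimately show ?thesis using iterated_commutator_F[of "dynkin_word x y s"] by simp
qed

lemma block_lists_sum_pos:
  assumes "s \<in> block_lists (Suc k)"
  shows "0 < (\<Sum>(p, q)\<leftarrow>s. p + q)"
  using assms by (cases s) (auto simp: block_lists_def block_index_def)

lemma sum_dynkin_index_eq:
  "(\<Sum>s\<in>dynkin_index r (Suc k). word_term t s) = (\<Sum>s\<in>block_lists (Suc k). word_term t s)"
proof (rule sum.mono_neutral_left)
  show "finite (block_lists (Suc k))"
    unfolding block_lists_def by (rule finite_lists_length_eq[OF finite_block_index])
  show "dynkin_index r (Suc k) \<subseteq> block_lists (Suc k)"
  proof
    fix s assume s: "s \<in> dynkin_index r (Suc k)"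
    have "p + q \<le> r" if "(p, q) \<in> set s" for p q
      by (rule dynkin_index_block_le[OF s that])
    then show "s \<in> block_lists (Suc k)"
      using s by (force simp: dynkin_index_def block_lists_def block_index_def)
  qed
  show "\<forall>s\<in>block_lists (Suc k) - dynkin_index r (Suc k). word_term t s = 0"
  proof
    fix s assume s: "s \<in> block_lists (Suc k) - dynkin_index r (Suc k)"
    then have "r < (\<Sum>(p, q)\<leftarrow>s. p + q)"
      by (auto simp: block_lists_def block_index_def dynkin_index_def)
    then have "iterated_bracket commutator (dynkin_word x y s) = 0"
      using iterated_word_F[OF block_lists_sum_pos[of s k]] s F_eq_0 by blast
    then show "word_term t s = 0" by (simp add: word_term_def)
  qed
qed

lemma funpow_commutator: "(commutator a ^^ p) u = endo_apply (ad a ^ p) u"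
  by (induction p) simp_all

text \<open>The bracket of \<open>x^p y^q\<close> contains an innermost \<open>[y, y]\<close> if
  \<open>q \<ge> 2\<close>, and \<open>[x, x]\<close> if \<open>q = 0\<close> and
  \<open>p \<ge> 2\<close>. What remains is the single letter \<open>x\<close> and the words
  \<open>x^p y\<close>, which add up to the exponential series of \<open>t ad x\<close> applied to
  \<open>y\<close>.\<close>

lemma sum_word_term_one:
  "(\<Sum>s\<in>block_lists (Suc 0). word_term t s) = x + endo_apply (exp (t *\<^sub>R ad x)) y"
proof -
  let ?it = "\<lambda>p q. iterated_bracket commutator (replicate p x @ replicate q y)"
  let ?g = "\<lambda>(p, q). (t ^ (p + q - 1) / (fact p * fact q)) *\<^sub>R ?it p q"
  have z: "iterated_bracket commutator (replicate p v) = 0" if "2 \<le> p" for p and v :: 'a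
    using that by (intro iterated_bracket_replicate_eq_0) (simp_all add: commutator_def)
  have it0: "?it p q = 0" if "2 \<le> q" for p q
    using that z[OF that]
    by (subst iterated_bracket_replicate_append) (auto simp: funpow_commutator endo.zero_right)
  have it1: "?it p 0 = 0" if "2 \<le> p" for p
    using z[OF that] by simp
  have "block_lists (Suc 0) = (\<lambda>pq. [pq]) ` block_index"
    by (auto simp: block_lists_def length_Suc_conv)
  then have "(\<Sum>s\<in>block_lists (Suc 0). word_term t s) = (\<Sum>pq\<in>block_index. word_term t [pq])"
    by (simp add: sum.reindex inj_on_def)
  also have "\<dots> = (\<Sum>pq\<in>block_index. ?g pq)"
    by (intro sum.cong refl) (auto simp: word_term_def dynkin_word_def)
  also have "\<dots> = (\<Sum>pq\<in>insert (1, 0) ((\<lambda>p. (p, 1)) ` {..r}). ?g pq)"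
  proof (rule sum.mono_neutral_right[OF finite_block_index])
    show "insert (1, 0) ((\<lambda>p. (p, 1)) ` {..r}) \<subseteq> block_index"
      using r_pos by (auto simp: block_index_def)
    show "\<forall>pq\<in>block_index - insert (1, 0) ((\<lambda>p. (p, 1)) ` {..r}). ?g pq = 0"
    proof
      fix pq assume pq: "pq \<in> block_index - insert (1, 0) ((\<lambda>p. (p, 1)) ` {..r})"
      obtain p q where [simp]: "pq = (p, q)" by (cases pq)
      have "(p, q) \<in> block_index" "(p, q) \<notin> insert (1, 0) ((\<lambda>p. (p, 1)) ` {..r})"
        using pq by auto
      then have "2 \<le> q \<or> (q = 0 \<and> 2 \<le> p)"
        by (cases "q = 0"; cases "q = 1") (auto simp: block_index_def image_iff)
      then show "?g pq = 0" using it0 it1 by auto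
    qed
  qed
  also have "\<dots> = ?g (1, 0) + (\<Sum>p\<le>r. ?g (p, 1))"
    by (subst sum.insert) (auto simp: sum.reindex inj_on_def)
  also have "(\<Sum>p\<le>r. ?g (p, 1)) = endo_apply (exp (t *\<^sub>R ad x)) y"
    unfolding exp_ad_apply[OF x y]
    by (intro sum.cong refl) (simp add: iterated_bracket_replicate_append funpow_commutator)
  finally show ?thesis by simp
qed

text \<open>Prefixing a block \<open>(p, q)\<close> to a nonempty word applies
  \<open>ad x ^ p * ad y ^ q\<close> to its bracket, with the factor
  \<open>t ^ (p + q) / (p! q!)\<close>. Summed over all blocks, these operators are
  \<open>Ad_prod t - 1\<close>.\<close>

lemma sum_word_term:
  "(\<Sum>s\<in>block_lists (Suc k). word_term t s) =
    endo_apply ((Ad_prod t - 1) ^ k) (x + endo_apply (exp (t *\<^sub>R ad x)) y)"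
proof (induction k)
  case 0
  show ?case by (simp add: sum_word_term_one)
next
  case (Suc k)
  let ?S = "\<Sum>s\<in>block_lists (Suc k). word_term t s"
  have S: "?S \<in> F 1"
  proof (rule subspace_sum[OF subspace_F])
    fix s assume "s \<in> block_lists (Suc k)"
    from block_lists_sum_pos[OF this] show "word_term t s \<in> F 1"
      using iterated_word_F[of s] F_antimono[of 1 "\<Sum>(p, q)\<leftarrow>s. p + q"]
      unfolding word_term_def by (intro subspace_scale[OF subspace_F]) auto
  qed
  have "block_lists (Suc (Suc k)) = (\<lambda>(pq, s). pq # s) ` (block_index \<times> block_lists (Suc k))"
    by (auto simp: block_lists_def length_Suc_conv image_iff)
  then have "(\<Sum>s\<in>block_lists (Suc (Suc k)). word_term t s) =
      (\<Sum>pq\<in>block_index. \<Sum>s\<in>block_lists (Suc k). word_term t (pq # s))"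
    by (subst sum.cartesian_product) (simp add: sum.reindex inj_on_def case_prod_unfold)
  also have "\<dots> = (\<Sum>(p, q)\<in>block_index. (t ^ (p + q) / (fact p * fact q)) *\<^sub>R
        endo_apply (ad x ^ p) (endo_apply (ad y ^ q) ?S))"
  proof (intro sum.cong refl, clarify)
    fix p q assume "(p, q) \<in> block_index"
    have "word_term t ((p, q) # s) = (t ^ (p + q) / (fact p * fact q)) *\<^sub>R
        endo_apply (ad x ^ p) (endo_apply (ad y ^ q) (word_term t s))"
      if s: "s \<in> block_lists (Suc k)" for s
    proof -
      have pos: "0 < (\<Sum>(p, q)\<leftarrow>s. p + q)" by (rule block_lists_sum_pos[OF s])
      then have ne: "dynkin_word x y s \<noteq> []"
        by (metis length_dynkin_word less_numeral_extra(3) list.size(3))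
      \<comment> \<open>The \<open>- 1\<close> in the exponent occurs once per word and stays with
        the tail \<open>s\<close>; the truncated subtraction is exact because \<open>s\<close> has a
        letter.\<close>
      have "t ^ (p + q + (\<Sum>(p, q)\<leftarrow>s. p + q) - 1) = t ^ (p + q) * t ^ ((\<Sum>(p, q)\<leftarrow>s. p + q) - 1)"
        using pos by (simp flip: power_add)
      then show ?thesis
        by (simp add: word_term_def dynkin_word_Cons iterated_bracket_replicate_append ne
            funpow_commutator endo.scaleR_right mult_ac)
    qed
    then show "(\<Sum>s\<in>block_lists (Suc k). word_term t ((p, q) # s)) =
      (t ^ (p + q) / (fact p * fact q)) *\<^sub>R endo_apply (ad x ^ p) (endo_apply (ad y ^ q) ?S)"
      by (simp add: endo.sum_right scaleR_sum_right)
  qed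
  also have "\<dots> = endo_apply (Ad_prod t - 1) ?S"
    by (rule Ad_prod_minus_one_apply(1)[OF S, symmetric]) simp
  finally show ?case by (simp add: Suc.IH)
qed

text \<open>A summand with \<open>m\<close> letters is homogeneous of degree \<open>m\<close> in
  \<open>t\<close>, and the factor \<open>m\<close> from differentiation cancels Dynkin's
  denominator. Grouping by the number of blocks then yields the series \<open>ln (1 + s) / s\<close>
  at \<open>s = Ad_prod t - 1\<close>.\<close>

lemma has_vector_derivative_dynkin_product:
  "((\<lambda>t. dynkin_product commutator r (t *\<^sub>R x) (t *\<^sub>R y)) has_vector_derivative
    (\<Sum>k<r. ((- 1) ^ k / real (Suc k)) *\<^sub>R
       endo_apply ((Ad_prod t - 1) ^ k) (x + endo_apply (exp (t *\<^sub>R ad x)) y))) (at t)"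
proof -
  let ?n = "\<lambda>s. \<Sum>(p, q)\<leftarrow>s. p + q" and ?f = "\<lambda>s. \<Prod>(p, q)\<leftarrow>s. fact p * fact q :: real"
  let ?it = "\<lambda>s. iterated_bracket commutator (dynkin_word x y s)"
  have gen: "m \<noteq> 0 \<Longrightarrow> (real m * T) *\<^sub>R ((e / (K * real m * f)) *\<^sub>R v) = (e / K) *\<^sub>R ((T / f) *\<^sub>R v)"
    for m :: nat and T e K f :: real and v :: 'a
    by simp
  have "dynkin_product commutator r (t *\<^sub>R x) (t *\<^sub>R y) =
      (\<Sum>k=1..r. \<Sum>s\<in>dynkin_index r k. (t ^ ?n s) *\<^sub>R
        (((- 1) ^ (k - 1) / (real k * real (?n s) * ?f s)) *\<^sub>R ?it s))" for t
    unfolding dynkin_product_def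
    by (simp add: iterated_bracket_scaleR[OF bilinear_commutator] mult.commute flip: map_dynkin_word)
  moreover have "((\<lambda>t. \<Sum>k=1..r. \<Sum>s\<in>dynkin_index r k. (t ^ ?n s) *\<^sub>R
        (((- 1) ^ (k - 1) / (real k * real (?n s) * ?f s)) *\<^sub>R ?it s)) has_vector_derivative
      (\<Sum>k=1..r. \<Sum>s\<in>dynkin_index r k. (real (?n s) * t ^ (?n s - 1)) *\<^sub>R
        (((- 1) ^ (k - 1) / (real k * real (?n s) * ?f s)) *\<^sub>R ?it s))) (at t)"
    by (intro has_vector_derivative_sum has_vector_derivative_scaleR[THEN has_vector_derivative_eq_rhs]
        has_vector_derivative_const) (auto intro!: derivative_eq_intros)
  moreover have "(\<Sum>k=1..r. \<Sum>s\<in>dynkin_index r k. (real (?n s) * t ^ (?n s - 1)) *\<^sub>R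
        (((- 1) ^ (k - 1) / (real k * real (?n s) * ?f s)) *\<^sub>R ?it s)) =
      (\<Sum>k=1..r. ((- 1) ^ (k - 1) / real k) *\<^sub>R (\<Sum>s\<in>dynkin_index r k. word_term t s))"
    unfolding scaleR_sum_right
  proof (intro sum.cong refl)
    fix k s assume "k \<in> {1..r}" "s \<in> dynkin_index r k"
    then have "?n s \<noteq> 0" using dynkin_index_sum_pos by fastforce
    then show "(real (?n s) * t ^ (?n s - 1)) *\<^sub>R
        (((- 1) ^ (k - 1) / (real k * real (?n s) * ?f s)) *\<^sub>R ?it s) =
        ((- 1) ^ (k - 1) / real k) *\<^sub>R word_term t s"
      unfolding word_term_def by (rule gen)
  qed
  moreover have "\<dots> = (\<Sum>k<r. ((- 1) ^ k / real (Suc k)) *\<^sub>R (\<Sum>s\<in>dynkin_index r (Suc k). word_term t s))"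
    by (rule sum.reindex_bij_witness[of _ Suc "\<lambda>k. k - 1"]) auto
  ultimately show ?thesis
    by (simp add: sum_dynkin_index_eq sum_word_term del: of_nat_Suc)
qed

text \<open>The logarithm \<open>L\<close> and Dynkin's series \<open>Z\<close> have the same
  derivative for all \<open>t\<close> and vanish at \<open>t = 0\<close>, so they agree at
  \<open>t = 1\<close>. No differential equation has to be solved: \<open>exp (ad (L t))\<close>
  equals the explicit operator \<open>Ad_prod t\<close>, so the formula for \<open>L'\<close> does
  not involve \<open>L\<close>.\<close>

theorem exp_mult_exp_eq_dynkin:
  "exp x * exp y = exp (dynkin_product commutator r x y)"
proof -
  define W where "W t = exp (t *\<^sub>R x) * exp (t *\<^sub>R y)" for t
  define L where "L t = fps_eval (fps_ln 1) (W t - 1)" for t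
  define Z where "Z t = dynkin_product commutator r (t *\<^sub>R x) (t *\<^sub>R y)" for t
  have tF: "t *\<^sub>R x \<in> F 1" "t *\<^sub>R y \<in> F 1" for t
    using x y subspace_scale[OF subspace_F] by auto
  have WF: "W t - 1 \<in> F 1" for t
  proof -
    have "W t - 1 = (exp (t *\<^sub>R x) - 1) * (exp (t *\<^sub>R y) - 1) + (exp (t *\<^sub>R x) - 1) + (exp (t *\<^sub>R y) - 1)"
      by (simp add: W_def algebra_simps)
    also have "\<dots> \<in> F 1"
      using mult_F[OF exp_F exp_F, OF tF(1)[of t] tF(2)[of t]] F_antimono[of 1 "1 + 1"]
      by (intro subspace_add[OF subspace_F] exp_F tF) auto
    finally show ?thesis .
  qed
  have LF: "L t \<in> F 1" for t
    unfolding L_def by (intro fps_eval_F WF) simp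
  have expL: "exp (L t) = W t" for t
    unfolding L_def by (rule exp_fps_eval_ln[OF power_eq_0[OF WF]])
  have exp_inv: "exp (L t) * exp (- L t) = 1" "exp (- L t) * exp (L t) = 1" for t
    by (simp_all add: exp_minus_inverse) (metis exp_minus_inverse minus_minus)
  have expmL: "exp (- L t) = exp (- (t *\<^sub>R y)) * exp (- (t *\<^sub>R x))" for t
  proof -
    have "W t * (exp (- (t *\<^sub>R y)) * exp (- (t *\<^sub>R x))) = 1"
      unfolding W_def
      by (metis exp_minus_inverse mult.assoc mult.right_neutral)
    then show ?thesis
      by (metis exp_inv(2) expL mult.assoc mult.left_neutral mult.right_neutral)
  qed
  have expad: "exp (ad (L t)) = Ad_prod t" for t
    by (simp only: exp_ad[OF power_eq_0[OF LF]] Ad_prod_def exp_ad[OF power_eq_0[OF tF(1)]]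
        exp_ad[OF power_eq_0[OF tF(2)]] flip: ad_scaleR)
       (rule endo_eqI, simp add: expL expmL W_def mult.assoc)
  define c where "c t = x + endo_apply (exp (t *\<^sub>R ad x)) y" for t
  have cF: "c t \<in> F 1" for t
  proof -
    have "endo_apply (exp (t *\<^sub>R ad x)) y \<in> F 1"
      unfolding exp_ad_apply[OF x y]
    proof (intro subspace_sum[OF subspace_F] subspace_scale[OF subspace_F])
      fix p show "endo_apply (ad x ^ p) y \<in> F 1"
        using ad_power_F[OF x y, of p] F_antimono[of 1 "p + 1"] by auto
    qed
    then show ?thesis unfolding c_def by (intro subspace_add[OF subspace_F] x)
  qed
  have W': "(W has_vector_derivative c t * W t) (at t)" for t
  proof -
    have "(W has_vector_derivative
        exp (t *\<^sub>R x) * (y * exp (t *\<^sub>R y)) + (x * exp (t *\<^sub>R x)) * exp (t *\<^sub>R y)) (at t)"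
      unfolding W_def
      by (intro has_vector_derivative_mult exp_scaleR_has_vector_derivative_left)
    moreover have "c t * W t = exp (t *\<^sub>R x) * (y * exp (t *\<^sub>R y)) + (x * exp (t *\<^sub>R x)) * exp (t *\<^sub>R y)"
    proof -
      have "endo_apply (exp (t *\<^sub>R ad x)) y = exp (t *\<^sub>R x) * y * exp (- (t *\<^sub>R x))"
        by (simp only: exp_ad[OF power_eq_0[OF tF(1)]] flip: ad_scaleR) (simp add: mult.assoc)
      moreover have "exp (- (t *\<^sub>R x)) * (exp (t *\<^sub>R x) * v) = v" for v
        by (metis exp_minus_inverse minus_minus mult.assoc mult.left_neutral)
      ultimately show ?thesis by (simp add: c_def W_def algebra_simps)
    qed
    ultimately show ?thesis by simp
  qed
  have L': "(L has_vector_derivative endo_apply (fps_eval fps_ln_quot (Ad_prod t - 1)) (c t)) (at t)" for t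
  proof -
    \<comment> \<open>Since \<open>L\<close> is a fixed polynomial in \<open>W - 1\<close>, it is
      differentiable. The polynomial gives no usable derivative; its value is found afterwards by
      differentiating \<open>exp (L t) = W t\<close>.\<close>
    have "\<exists>L'. (L has_vector_derivative L') (at t)"
    proof -
      have "L = (\<lambda>t. \<Sum>k<Suc r. fps_nth (fps_ln 1) k *\<^sub>R (W t - 1) ^ k)"
        unfolding L_def fps_eval_finite[OF power_eq_0[OF WF]] ..
      moreover have "((\<lambda>t. W t - 1) has_vector_derivative c t * W t - 0) (at t)"
        by (intro has_vector_derivative_diff W' has_vector_derivative_const)
      from has_vector_derivative_power_noncomm[OF this]
      have "((\<lambda>t. \<Sum>k<Suc r. fps_nth (fps_ln 1) k *\<^sub>R (W t - 1) ^ k) has_vector_derivative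
        (\<Sum>k<Suc r. fps_nth (fps_ln 1) k *\<^sub>R
          (\<Sum>i<k. (W t - 1) ^ i * (c t * W t - 0) * (W t - 1) ^ (k - Suc i)))) (at t)"
        by (intro has_vector_derivative_sum
            bounded_linear.has_vector_derivative[OF bounded_linear_scaleR_right])
      ultimately show ?thesis by auto
    qed
    then obtain L' where L': "(L has_vector_derivative L') (at t)" ..
    have "((\<lambda>s. exp (L s)) has_vector_derivative
        endo_apply (fps_eval fps_exp_quot (ad (L t))) L' * exp (L t)) (at t)"
      unfolding ad_def by (rule has_vector_derivative_exp_nilpotent[OF L' power_eq_0[OF LF]])
    then have "(W has_vector_derivative endo_apply (fps_eval fps_exp_quot (ad (L t))) L' * W t) (at t)"
      by (simp add: expL)
    \<comment> \<open>The two derivatives of \<open>W\<close> are compared, and the invertible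
      factor \<open>W t\<close> is cancelled.\<close>
    from vector_derivative_unique_at[OF this W']
    have "endo_apply (fps_eval fps_exp_quot (ad (L t))) L' = c t"
      by (metis exp_inv(1) expL mult.assoc mult.right_neutral)
    then have "endo_apply (fps_eval fps_ln_quot (Ad_prod t - 1)) (c t) =
        endo_apply (fps_eval fps_ln_quot (exp (ad (L t)) - 1) * fps_eval fps_exp_quot (ad (L t))) L'"
      by (simp add: expad)
    also have "\<dots> = L'"
      by (simp add: fps_eval_ln_quot_exp_quot[OF ad_nilpotent[OF power_eq_0[OF LF]]])
    finally show ?thesis using L' by simp
  qed
  have Z': "(Z has_vector_derivative endo_apply (fps_eval fps_ln_quot (Ad_prod t - 1)) (c t)) (at t)" for t
  proof -
    have "(Ad_prod t - 1) ^ (2 * Suc r) = 0"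
      unfolding expad[symmetric] by (intro exp_minus_one_nilpotent ad_nilpotent power_eq_0 LF)
    from fps_eval_finite[OF this, of fps_ln_quot]
    have "endo_apply (fps_eval fps_ln_quot (Ad_prod t - 1)) (c t) =
        (\<Sum>k<2 * Suc r. ((- 1) ^ k / real (Suc k)) *\<^sub>R endo_apply ((Ad_prod t - 1) ^ k) (c t))"
      by (simp only: endo.sum_left endo.scaleR_left fps_ln_quot_def fps_nth_Abs_fps)
    \<comment> \<open>Nilpotency of the operator alone gives \<open>2 * Suc r\<close> terms. Applied
      to \<open>c t\<close>, which lies in \<open>F 1\<close>, the \<open>k\<close>-th power lands
      in \<open>F (Suc k)\<close>, which is zero from \<open>k = r\<close> on.\<close>
    also have "\<dots> = (\<Sum>k<r. ((- 1) ^ k / real (Suc k)) *\<^sub>R endo_apply ((Ad_prod t - 1) ^ k) (c t))"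
      using F_eq_0[OF _ Ad_prod_minus_one_power_F[OF cF]]
      by (intro sum.mono_neutral_right) auto
    finally show ?thesis
      using has_vector_derivative_dynkin_product[of t] unfolding Z_def c_def by simp
  qed
  have "((\<lambda>t. L t - Z t) has_derivative (\<lambda>h. 0)) (at t)" for t
    using has_vector_derivative_diff[OF L' Z', of t] by (simp add: has_vector_derivative_def)
  then have "L 1 - Z 1 = L 0 - Z 0"
    using has_derivative_zero_unique[of UNIV "\<lambda>t. L t - Z t" 1 0] by simp
  moreover have "L 0 = 0"
    unfolding L_def by (subst fps_eval_finite[of _ 1]) (simp_all add: W_def)
  moreover have "Z 0 = 0"
  proof -
    have "iterated_bracket commutator (dynkin_word (0 *\<^sub>R x) (0 *\<^sub>R y) s) = 0"
      if "s \<in> dynkin_index r k" "1 \<le> k" for s k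
    proof -
      have "0 < (\<Sum>(p, q)\<leftarrow>s. p + q)"
        using that(2) by (intro dynkin_index_sum_pos[OF that(1)]) simp
      then show ?thesis
        using iterated_bracket_scaleR[OF bilinear_commutator, of 0 "dynkin_word x y s"]
        by (simp only: map_dynkin_word length_dynkin_word zero_power scaleR_zero_left)
    qed
    then show ?thesis unfolding Z_def dynkin_product_def by (intro sum.neutral ballI) simp
  qed
  ultimately have "L 1 = Z 1" by simp
  then show ?thesis using expL[of 1] by (simp add: W_def Z_def)
qed

end

end

section \<open>Smooth maps\<close>

lemma has_derivative_cong_open:
  assumes "open S" "x \<in> S" "\<And>y. y \<in> S \<Longrightarrow> f y = g y"
  shows "(f has_derivative D) (at x) \<longleftrightarrow> (g has_derivative D) (at x)"
  using has_derivative_transform_within_open[OF _ assms(1,2), of f D UNIV g]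
    has_derivative_transform_within_open[OF _ assms(1,2), of g D UNIV f] assms(3) by auto

lemma frechet_derivative_cong_open:
  assumes "open S" "x \<in> S" "\<And>y. y \<in> S \<Longrightarrow> f y = g y"
  shows "frechet_derivative f (at x) = frechet_derivative g (at x)"
  unfolding frechet_derivative_def using has_derivative_cong_open[OF assms] by simp

lemma differentiable_cong_open:
  assumes "open S" "x \<in> S" "\<And>y. y \<in> S \<Longrightarrow> f y = g y"
  shows "f differentiable (at x) \<longleftrightarrow> g differentiable (at x)"
  unfolding differentiable_def using has_derivative_cong_open[OF assms] by simp

lemma ck_on_cong:
  assumes "open S" "\<And>y. y \<in> S \<Longrightarrow> f y = g y"
  shows "ck_on k S f \<longleftrightarrow> ck_on k S g"
  using assms(2)
proof (induction k arbitrary: f g)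
  case 0
  then show ?case by (simp cong: continuous_on_cong)
next
  case (Suc k)
  have "ck_on k S (\<lambda>x. frechet_derivative f (at x) v) \<longleftrightarrow> ck_on k S (\<lambda>x. frechet_derivative g (at x) v)" for v
    using frechet_derivative_cong_open[OF assms(1) _ Suc.prems] by (intro Suc.IH) simp
  then show ?case using differentiable_cong_open[OF assms(1) _ Suc.prems] by simp
qed

lemma ck_on_subset: "ck_on k S f \<Longrightarrow> T \<subseteq> S \<Longrightarrow> ck_on k T f"
  by (induction k arbitrary: f) (auto intro: continuous_on_subset)

lemma ck_on_SucD: "ck_on (Suc k) S f \<Longrightarrow> ck_on k S f"
proof (induction k arbitrary: f)
  case 0
  then show ?case
    by (auto intro!: continuous_at_imp_continuous_on differentiable_imp_continuous_within)
next
  case (Suc k)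
  then show ?case by (metis ck_on.simps(2))
qed

lemma ck_on_const: "ck_on k S (\<lambda>x. c)"
  by (induction k arbitrary: c) (simp_all add: frechet_derivative_const)

lemma ck_on_ident: "ck_on k S (\<lambda>x. x)"
  by (cases k) (simp_all add: ck_on_const)

lemma ck_on_bounded_linear:
  assumes "open S" "bounded_linear h" "ck_on k S f"
  shows "ck_on k S (\<lambda>x. h (f x))"
  using assms(3)
proof (induction k arbitrary: f)
  case 0
  then show ?case by (simp add: bounded_linear.continuous_on[OF assms(2)])
next
  case (Suc k)
  have d: "((\<lambda>x. h (f x)) has_derivative (\<lambda>v. h (frechet_derivative f (at x) v))) (at x)"
    if "x \<in> S" for x
    using Suc.prems that
    by (intro bounded_linear.has_derivative[OF assms(2)]) (simp flip: frechet_derivative_works)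
  have "ck_on k S (\<lambda>x. frechet_derivative (\<lambda>x. h (f x)) (at x) v) \<longleftrightarrow>
      ck_on k S (\<lambda>x. h (frechet_derivative f (at x) v))" for v
    by (intro ck_on_cong[OF assms(1)]) (simp flip: frechet_derivative_at[OF d])
  then show ?case using Suc d by (auto intro: differentiableI)
qed

lemma ck_on_add:
  assumes "open S" "ck_on k S f" "ck_on k S g"
  shows "ck_on k S (\<lambda>x. f x + g x)"
  using assms(2,3)
proof (induction k arbitrary: f g)
  case 0
  then show ?case by (simp add: continuous_on_add)
next
  case (Suc k)
  have d: "((\<lambda>x. f x + g x) has_derivative
      (\<lambda>v. frechet_derivative f (at x) v + frechet_derivative g (at x) v)) (at x)"
    if "x \<in> S" for x
    using Suc.prems that by (intro has_derivative_add) (simp_all flip: frechet_derivative_works)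
  have "ck_on k S (\<lambda>x. frechet_derivative (\<lambda>x. f x + g x) (at x) v) \<longleftrightarrow>
      ck_on k S (\<lambda>x. frechet_derivative f (at x) v + frechet_derivative g (at x) v)" for v
    by (intro ck_on_cong[OF assms(1)]) (simp flip: frechet_derivative_at[OF d])
  then show ?case using Suc d by (auto intro: differentiableI)
qed

lemma ck_on_bounded_bilinear:
  assumes "open S" "bounded_bilinear h" "ck_on k S f" "ck_on k S g"
  shows "ck_on k S (\<lambda>x. h (f x) (g x))"
  using assms(3,4)
proof (induction k arbitrary: f g)
  case 0
  then show ?case by (simp add: bounded_bilinear.continuous_on[OF assms(2)])
next
  case (Suc k)
  have d: "((\<lambda>x. h (f x) (g x)) has_derivative
      (\<lambda>v. h (f x) (frechet_derivative g (at x) v) + h (frechet_derivative f (at x) v) (g x))) (at x)"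
    if "x \<in> S" for x
    using Suc.prems that
    by (intro bounded_bilinear.FDERIV[OF assms(2)]) (simp_all flip: frechet_derivative_works)
  have "ck_on k S (\<lambda>x. frechet_derivative (\<lambda>x. h (f x) (g x)) (at x) v) \<longleftrightarrow>
      ck_on k S (\<lambda>x. h (f x) (frechet_derivative g (at x) v) + h (frechet_derivative f (at x) v) (g x))" for v
    by (intro ck_on_cong[OF assms(1)]) (simp flip: frechet_derivative_at[OF d])
  \<comment> \<open>By the product rule the derivative still contains \<open>f\<close> and
    \<open>g\<close> undifferentiated, so their order is lowered from \<open>Suc k\<close> to
    \<open>k\<close> first.\<close>
  moreover have "ck_on k S (\<lambda>x. h (f x) (frechet_derivative g (at x) v) + h (frechet_derivative f (at x) v) (g x))" for v
    using Suc.prems ck_on_SucD[OF Suc.prems(1)] ck_on_SucD[OF Suc.prems(2)]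
    by (intro ck_on_add[OF assms(1)] Suc.IH) auto
  ultimately show ?case using d by (auto intro: differentiableI)
qed

lemma smooth_on_sum:
  assumes "open S" "\<And>i. i \<in> I \<Longrightarrow> smooth_on S (f i)"
  shows "smooth_on S (\<lambda>x. \<Sum>i\<in>I. f i x)"
proof (cases "finite I")
  case True
  then show ?thesis using assms(2)
    by (induction I) (auto simp: smooth_on_def ck_on_const intro: ck_on_add[OF assms(1)])
qed (simp add: smooth_on_def ck_on_const)

lemma smooth_on_bounded_linear:
  "open S \<Longrightarrow> bounded_linear h \<Longrightarrow> smooth_on S f \<Longrightarrow> smooth_on S (\<lambda>x. h (f x))"
  by (simp add: smooth_on_def ck_on_bounded_linear)

lemma bounded_linear_smooth_on: "bounded_linear h \<Longrightarrow> smooth_on UNIV h"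
  using smooth_on_bounded_linear[of UNIV h "\<lambda>x. x"] by (simp add: smooth_on_def ck_on_ident)

lemma smooth_on_differentiable: "smooth_on S f \<Longrightarrow> x \<in> S \<Longrightarrow> f differentiable (at x)"
  unfolding smooth_on_def by (metis ck_on.simps(2))

lemma smooth_on_subset: "smooth_on S f \<Longrightarrow> T \<subseteq> S \<Longrightarrow> smooth_on T f"
  by (auto simp: smooth_on_def intro: ck_on_subset)

section \<open>Derivatives at a point\<close>

lemma scaleR_differentiable:
  fixes f :: "'a::real_normed_vector \<Rightarrow> 'b::real_normed_vector"
  shows "f differentiable (at x) \<Longrightarrow> (\<lambda>x. a *\<^sub>R f x) differentiable (at x)"
  unfolding differentiable_def using has_derivative_scaleR_right by blast

lemma frechet_derivative_scaleR:
  fixes f :: "'a::real_normed_vector \<Rightarrow> 'b::real_normed_vector"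
  assumes "f differentiable (at x)"
  shows "frechet_derivative (\<lambda>x. a *\<^sub>R f x) (at x) v = a *\<^sub>R frechet_derivative f (at x) v"
proof -
  have "(f has_derivative frechet_derivative f (at x)) (at x)"
    using assms by (simp flip: frechet_derivative_works)
  from frechet_derivative_at[OF has_derivative_scaleR_right[OF this, of a]] show ?thesis by metis
qed

lemma frechet_derivative_sum:
  assumes "\<And>i. i \<in> I \<Longrightarrow> f i differentiable (at x)"
  shows "frechet_derivative (\<lambda>x. \<Sum>i\<in>I. f i x) (at x) v = (\<Sum>i\<in>I. frechet_derivative (f i) (at x) v)"
proof -
  have "((\<lambda>x. \<Sum>i\<in>I. f i x) has_derivative (\<lambda>v. \<Sum>i\<in>I. frechet_derivative (f i) (at x) v)) (at x)"
    using assms by (intro has_derivative_sum) (simp flip: frechet_derivative_works)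
  from frechet_derivative_at[OF this] show ?thesis by metis
qed

text \<open>On the line through \<open>v\<close> the map is \<open>t ^ n\<close> times
  \<open>f v\<close>, whose derivative at 0 vanishes unless \<open>n = 1\<close>. This gives the
  derivatives of the terms of Dynkin's series without differentiating brackets.\<close>

lemma frechet_derivative_homogeneous:
  assumes "f differentiable (at 0)" "\<And>t. f (t *\<^sub>R v) = t ^ n *\<^sub>R f v"
  shows "frechet_derivative f (at 0) v = (if n = 1 then f v else 0)"
proof -
  have "((\<lambda>t. t *\<^sub>R v) has_vector_derivative v) (at 0)"
    by (auto intro!: derivative_eq_intros)
  moreover have "(f has_derivative frechet_derivative f (at 0)) (at ((0::real) *\<^sub>R v))"
    using assms(1) by (simp flip: frechet_derivative_works)
  ultimately have "((f \<circ> (\<lambda>t. t *\<^sub>R v)) has_vector_derivative frechet_derivative f (at 0) v) (at 0)"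
    using vector_derivative_diff_chain_within[of "\<lambda>t. t *\<^sub>R v" v 0 UNIV f "frechet_derivative f (at 0)"]
    by (simp add: has_derivative_at_withinI)
  moreover have "f \<circ> (\<lambda>t. t *\<^sub>R v) = (\<lambda>t. t ^ n *\<^sub>R f v)"
    using assms(2) by auto
  moreover have "((\<lambda>t. t ^ n *\<^sub>R f v) has_vector_derivative (real n * 0 ^ (n - 1)) *\<^sub>R f v) (at 0)"
    by (auto intro!: derivative_eq_intros has_vector_derivative_scaleR[THEN has_vector_derivative_eq_rhs])
  ultimately have "frechet_derivative f (at 0) v = (real n * 0 ^ (n - 1)) *\<^sub>R f v"
    using vector_derivative_unique_at by metis
  then show ?thesis by (auto simp: power_0_left)
qed

section \<open>The Dynkin product of a bilinear bracket\<close>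

lemma iterated_bracket_hom:
  assumes "f 0 = 0" "\<And>u v. f (B u v) = B' (f u) (f v)"
  shows "f (iterated_bracket B ws) = iterated_bracket B' (map f ws)"
  by (induction ws rule: induct_list012) (simp_all add: assms)

text \<open>The product is a linear combination of iterated brackets, hence natural for
  homomorphisms. This is applied to the representation \<open>rho\<close> and to the
  dilations.\<close>

lemma dynkin_product_hom:
  assumes "linear f" "\<And>u v. f (B u v) = B' (f u) (f v)"
  shows "f (dynkin_product B N x y) = dynkin_product B' N (f x) (f y)"
  unfolding dynkin_product_def
  by (simp add: linear_sum[OF assms(1)] linear_scale[OF assms(1)]
      iterated_bracket_hom[of f B B', OF linear_0[OF assms(1)] assms(2)] map_dynkin_word)

definition dynkin_indices :: "nat \<Rightarrow> (nat \<times> nat) list set" where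
  "dynkin_indices N = (\<Union>k\<in>{1..N}. dynkin_index N k)"

definition dynkin_coeff :: "(nat \<times> nat) list \<Rightarrow> real" where
  "dynkin_coeff s = (- 1) ^ (length s - 1) /
     (real (length s) * real (\<Sum>(p, q)\<leftarrow>s. p + q) * (\<Prod>(p, q)\<leftarrow>s. fact p * fact q))"

lemma finite_dynkin_indices [simp]: "finite (dynkin_indices N)"
  by (simp add: dynkin_indices_def)

text \<open>A list determines \<open>k\<close> as its length, so the double sum is a single
  one.\<close>

lemma dynkin_product_eq:
  "dynkin_product B N x y =
    (\<Sum>s\<in>dynkin_indices N. dynkin_coeff s *\<^sub>R iterated_bracket B (dynkin_word x y s))"
proof -
  have "(\<Sum>s\<in>dynkin_indices N. dynkin_coeff s *\<^sub>R iterated_bracket B (dynkin_word x y s)) =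
    (\<Sum>k=1..N. \<Sum>s\<in>dynkin_index N k. dynkin_coeff s *\<^sub>R iterated_bracket B (dynkin_word x y s))"
    unfolding dynkin_indices_def
    by (rule sum.UNION_disjoint) (simp_all, auto simp: dynkin_index_def)
  then show ?thesis
    unfolding dynkin_product_def
    by (auto simp: dynkin_coeff_def dynkin_index_def intro!: sum.cong)
qed

text \<open>Every block has at least one letter, so the bound on letters also bounds the number of
  blocks.\<close>

lemma mem_dynkin_indices:
  "s \<in> dynkin_indices N \<longleftrightarrow> s \<noteq> [] \<and> (\<forall>(p, q)\<in>set s. 0 < p + q) \<and> (\<Sum>(p, q)\<leftarrow>s. p + q) \<le> N"
proof -
  have "length s \<le> (\<Sum>(p, q)\<leftarrow>s. p + q)" if "\<forall>(p, q)\<in>set s. 0 < p + q"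
    using that by (induction s) (auto simp: Suc_le_eq)
  then show ?thesis
    by (cases s) (force simp: dynkin_indices_def dynkin_index_def)+
qed

lemma dynkin_indices_sum_eq_1:
  assumes "1 \<le> N"
  shows "{s \<in> dynkin_indices N. (\<Sum>(p, q)\<leftarrow>s. p + q) = 1} = {[(1, 0)], [(0, 1)]}"
proof (intro equalityI subsetI)
  fix s assume s: "s \<in> {s \<in> dynkin_indices N. (\<Sum>(p, q)\<leftarrow>s. p + q) = 1}"
  then show "s \<in> {[(1, 0)], [(0, 1)]}"
    by (cases s; cases "tl s") (auto simp: mem_dynkin_indices add_is_1)
qed (use assms in \<open>auto simp: mem_dynkin_indices\<close>)

lemma dynkin_indices_bidegree_1_1:
  assumes "2 \<le> N"
  shows "{s \<in> dynkin_indices N. sum_list (map snd s) = 1 \<and> sum_list (map fst s) = 1} =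
    {[(1, 1)], [(1, 0), (0, 1)], [(0, 1), (1, 0)]}"
proof (intro equalityI subsetI)
  fix s assume s: "s \<in> {s \<in> dynkin_indices N. sum_list (map snd s) = 1 \<and> sum_list (map fst s) = 1}"
  then show "s \<in> {[(1, 1)], [(1, 0), (0, 1)], [(0, 1), (1, 0)]}"
    by (cases s; cases "tl s"; cases "tl (tl s)") (auto simp: mem_dynkin_indices add_is_1)
qed (use assms in \<open>auto simp: mem_dynkin_indices\<close>)

lemma iterated_bracket_scaleR_list:
  assumes "bilinear B"
  shows "iterated_bracket B (map (\<lambda>(c, v). c *\<^sub>R v) zs) =
    prod_list (map fst zs) *\<^sub>R iterated_bracket B (map snd zs)"
  by (induction zs rule: induct_list012)
     (auto simp: bilinear_lmul[OF assms] bilinear_rmul[OF assms] split: prod.splits)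

text \<open>
  This bihomogeneity reduces the Lie algebra bracket of the group to the words with exactly one \<open>x\<close>
  and one \<open>y\<close>.
\<close>

lemma iterated_bracket_word_scaleR:
  assumes "bilinear B"
  shows "iterated_bracket B (dynkin_word (a *\<^sub>R x) (b *\<^sub>R y) s) =
    (a ^ sum_list (map fst s) * b ^ sum_list (map snd s)) *\<^sub>R iterated_bracket B (dynkin_word x y s)"
proof -
  \<comment> \<open>The word in the letters \<open>(a, x)\<close> and \<open>(b, y)\<close> carries
    the scalars along with the vectors; the product of the first components counts the occurrences
    of each letter.\<close>
  have "prod_list (dynkin_word a b s) = a ^ sum_list (map fst s) * b ^ sum_list (map snd s)"
    by (induction s) (auto simp: dynkin_word_def power_add prod_list_replicate)
  then show ?thesis
    using iterated_bracket_scaleR_list[OF assms, of "dynkin_word (a, x) (b, y) s"]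
    by (simp add: map_dynkin_word)
qed

lemma smooth_on_iterated_bracket:
  fixes B :: "'v::euclidean_space \<Rightarrow> 'v \<Rightarrow> 'v"
  assumes "bilinear B"
  shows "smooth_on UNIV (\<lambda>(x, y). iterated_bracket B (dynkin_word x y s))"
proof -
  have B: "bounded_bilinear B" using assms by (simp add: bilinear_conv_bounded_bilinear)
  \<comment> \<open>Coding letters as booleans lets the induction run over arbitrary words,
    independently of the division into blocks.\<close>
  have "smooth_on UNIV (\<lambda>z. iterated_bracket B (map (\<lambda>b. if b then fst z else snd z) bs))" for bs
  proof (induction bs rule: induct_list012)
    case (3 b c bs)
    have b: "smooth_on UNIV (\<lambda>z. if b then fst z else snd (z :: 'v \<times> 'v))"
      by (cases b) (simp_all add: bounded_linear_smooth_on bounded_linear_fst bounded_linear_snd)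
    have "ck_on k UNIV (\<lambda>z. B (if b then fst z else snd z)
        (iterated_bracket B (map (\<lambda>b. if b then fst z else snd z) (c # bs))))" for k
      by (rule ck_on_bounded_bilinear[OF open_UNIV B])
         (use b "3.IH"(2) in \<open>simp_all only: smooth_on_def\<close>)
    then show ?case by (simp add: smooth_on_def)
  next
    case (2 b)
    show ?case by (cases b) (simp_all add: bounded_linear_smooth_on bounded_linear_fst bounded_linear_snd)
  qed (simp add: smooth_on_def ck_on_const)
  from this[of "dynkin_word True False s"] show ?thesis
    by (simp add: map_dynkin_word case_prod_unfold)
qed

section \<open>The group of a graded nilpotent Lie algebra\<close>

text \<open>The purely algebraic side. The manifold later supplies \<open>c\<close> as the part of
  the structure functions at \<open>a\<close> that is homogeneous in the weights.\<close>

locale graded_structure_constants =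
  fixes c :: "'n::finite \<Rightarrow> 'n \<Rightarrow> 'n \<Rightarrow> real" and w :: "'n \<Rightarrow> nat" and r :: nat
  assumes w_pos: "1 \<le> w j" and w_le: "w j \<le> r"
    and graded: "c i j k \<noteq> 0 \<Longrightarrow> w k = w i + w j"
    and antisym: "c i j k = - c j i k"
    and jacobi: "(\<Sum>l\<in>UNIV. c i j l * c l k m + c j k l * c l i m + c k i l * c l j m) = 0"
begin

definition br :: "real ^ 'n \<Rightarrow> real ^ 'n \<Rightarrow> real ^ 'n" where
  "br x y = (\<chi> k. \<Sum>i\<in>UNIV. \<Sum>j\<in>UNIV. x $ i * y $ j * c i j k)"

lemma r_pos: "1 \<le> r" using w_pos w_le order_trans by blast

lemma bilinear_br: "bilinear br"
  unfolding bilinear_def br_def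
  by (auto intro!: linearI simp: vec_eq_iff algebra_simps sum.distrib sum_distrib_left)

lemmas br_lin = bilinear_ladd[OF bilinear_br] bilinear_radd[OF bilinear_br]
  bilinear_lmul[OF bilinear_br] bilinear_rmul[OF bilinear_br]
  bilinear_lneg[OF bilinear_br] bilinear_rneg[OF bilinear_br]
  bilinear_lsub[OF bilinear_br] bilinear_rsub[OF bilinear_br]
  bilinear_lzero[OF bilinear_br] bilinear_rzero[OF bilinear_br]

lemma br_antisym: "br x y = - br y x"
proof -
  have "(\<Sum>i\<in>UNIV. \<Sum>j\<in>UNIV. x $ i * y $ j * c i j k) = - (\<Sum>i\<in>UNIV. \<Sum>j\<in>UNIV. y $ i * x $ j * c i j k)" for k
    by (subst sum.swap) (subst antisym, simp add: sum_negf mult.commute)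
  then show ?thesis by (simp add: br_def vec_eq_iff)
qed

lemma br_self [simp]: "br x x = 0"
  using br_antisym[of x x] by (simp add: eq_neg_iff_add_eq_0 flip: scaleR_2)

lemma br_br_nth: "br (br x y) z $ m =
  (\<Sum>i\<in>UNIV. \<Sum>j\<in>UNIV. \<Sum>k\<in>UNIV. x $ i * y $ j * z $ k * (\<Sum>l\<in>UNIV. c i j l * c l k m))"
proof -
  have "br (br x y) z $ m = (\<Sum>l\<in>UNIV. \<Sum>k\<in>UNIV. \<Sum>i\<in>UNIV. \<Sum>j\<in>UNIV. x $ i * y $ j * z $ k * (c i j l * c l k m))"
    by (simp add: br_def sum_distrib_right sum_distrib_left mult_ac)
  also have "\<dots> = (\<Sum>l\<in>UNIV. \<Sum>i\<in>UNIV. \<Sum>k\<in>UNIV. \<Sum>j\<in>UNIV. x $ i * y $ j * z $ k * (c i j l * c l k m))"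
    by (rule sum.cong[OF refl], rule sum.swap)
  also have "\<dots> = (\<Sum>i\<in>UNIV. \<Sum>l\<in>UNIV. \<Sum>j\<in>UNIV. \<Sum>k\<in>UNIV. x $ i * y $ j * z $ k * (c i j l * c l k m))"
    by (subst sum.swap) (rule sum.cong[OF refl], rule sum.cong[OF refl], rule sum.swap)
  also have "\<dots> = (\<Sum>i\<in>UNIV. \<Sum>j\<in>UNIV. \<Sum>l\<in>UNIV. \<Sum>k\<in>UNIV. x $ i * y $ j * z $ k * (c i j l * c l k m))"
    by (rule sum.cong[OF refl], rule sum.swap)
  also have "\<dots> = (\<Sum>i\<in>UNIV. \<Sum>j\<in>UNIV. \<Sum>k\<in>UNIV. x $ i * y $ j * z $ k * (\<Sum>l\<in>UNIV. c i j l * c l k m))"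
    unfolding sum_distrib_left
    by (rule sum.cong[OF refl], rule sum.cong[OF refl], rule sum.swap)
  finally show ?thesis .
qed

lemma br_jacobi: "br (br x y) z + br (br y z) x + br (br z x) y = 0"
proof -
  let ?C = "\<lambda>i j k m. \<Sum>l\<in>UNIV. c i j l * c l k m"
  have J: "?C i j k m + ?C j k i m + ?C k i j m = 0" for i j k m
    using jacobi[of i j k m] by (simp add: sum.distrib)
  have 2: "br (br y z) x $ m = (\<Sum>i\<in>UNIV. \<Sum>j\<in>UNIV. \<Sum>k\<in>UNIV. x $ i * y $ j * z $ k * ?C j k i m)" for m
  proof -
    have "br (br y z) x $ m = (\<Sum>j\<in>UNIV. \<Sum>k\<in>UNIV. \<Sum>i\<in>UNIV. x $ i * y $ j * z $ k * ?C j k i m)"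
      unfolding br_br_nth by (simp add: mult_ac)
    also have "\<dots> = (\<Sum>j\<in>UNIV. \<Sum>i\<in>UNIV. \<Sum>k\<in>UNIV. x $ i * y $ j * z $ k * ?C j k i m)"
      by (rule sum.cong[OF refl], rule sum.swap)
    also have "\<dots> = (\<Sum>i\<in>UNIV. \<Sum>j\<in>UNIV. \<Sum>k\<in>UNIV. x $ i * y $ j * z $ k * ?C j k i m)"
      by (rule sum.swap)
    finally show ?thesis .
  qed
  have 3: "br (br z x) y $ m = (\<Sum>i\<in>UNIV. \<Sum>j\<in>UNIV. \<Sum>k\<in>UNIV. x $ i * y $ j * z $ k * ?C k i j m)" for m
  proof -
    have "br (br z x) y $ m = (\<Sum>k\<in>UNIV. \<Sum>i\<in>UNIV. \<Sum>j\<in>UNIV. x $ i * y $ j * z $ k * ?C k i j m)"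
      unfolding br_br_nth by (simp add: mult_ac)
    also have "\<dots> = (\<Sum>i\<in>UNIV. \<Sum>k\<in>UNIV. \<Sum>j\<in>UNIV. x $ i * y $ j * z $ k * ?C k i j m)"
      by (rule sum.swap)
    also have "\<dots> = (\<Sum>i\<in>UNIV. \<Sum>j\<in>UNIV. \<Sum>k\<in>UNIV. x $ i * y $ j * z $ k * ?C k i j m)"
      by (rule sum.cong[OF refl], rule sum.swap)
    finally show ?thesis .
  qed
  have "(br (br x y) z + br (br y z) x + br (br z x) y) $ m = 0" for m
  proof -
    have "(br (br x y) z + br (br y z) x + br (br z x) y) $ m =
        (\<Sum>i\<in>UNIV. \<Sum>j\<in>UNIV. \<Sum>k\<in>UNIV. x $ i * y $ j * z $ k * (?C i j k m + ?C j k i m + ?C k i j m))"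
      unfolding vector_add_component br_br_nth[of x y z] 2 3
      by (simp only: sum.distrib[symmetric] distrib_left[symmetric])
    then show ?thesis by (simp only: J mult_zero_right sum.neutral_const)
  qed
  then show ?thesis by (simp add: vec_eq_iff)
qed

section \<open>Weight filtration and degree derivation\<close>

definition filt :: "nat \<Rightarrow> (real ^ 'n) set" where
  "filt k = {x. \<forall>j. w j < k \<longrightarrow> x $ j = 0}"

lemma subspace_filt: "subspace (filt k)"
  by (auto simp: filt_def subspace_def)

lemma filt_le_1: "k \<le> 1 \<Longrightarrow> filt k = UNIV"
proof -
  assume "k \<le> 1"
  then have "\<not> w j < k" for j using w_pos[of j] by linarith
  then show ?thesis by (auto simp: filt_def)
qed

lemma filt_Suc_r: "filt (Suc r) = {0}"
  using w_le by (auto simp: filt_def vec_eq_iff le_imp_less_Suc)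

lemma filt_antimono: "i \<le> j \<Longrightarrow> filt j \<subseteq> filt i"
  by (auto simp: filt_def)

lemma br_filt:
  assumes "x \<in> filt i" "y \<in> filt j"
  shows "br x y \<in> filt (i + j)"
  unfolding filt_def br_def mem_Collect_eq vec_lambda_beta
proof (intro allI impI sum.neutral ballI)
  fix k a b assume "w k < i + j"
  then have "c a b k = 0 \<or> w a < i \<or> w b < j" using graded[of a b k] by linarith
  then show "x $ a * y $ b * c a b k = 0" using assms by (auto simp: filt_def)
qed

definition degree_map :: "real ^ 'n \<Rightarrow> real ^ 'n" where
  "degree_map x = (\<chi> j. real (w j) * x $ j)"

lemma linear_degree_map: "linear degree_map"
  by (intro linearI) (simp_all add: degree_map_def vec_eq_iff algebra_simps)

lemma degree_map_br: "degree_map (br x y) = br (degree_map x) y + br x (degree_map y)"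
proof -
  have "real (w k) * (x $ i * y $ j * c i j k) =
    real (w i) * x $ i * y $ j * c i j k + x $ i * (real (w j) * y $ j) * c i j k" for i j k
    using graded[of i j k] by (cases "c i j k = 0") (auto simp: algebra_simps)
  then show ?thesis
    by (simp add: degree_map_def br_def vec_eq_iff sum_distrib_left flip: sum.distrib)
qed

lemma degree_map_eq_0: "degree_map x = 0 \<Longrightarrow> x = 0"
proof -
  assume *: "degree_map x = 0"
  have "x $ j = 0" for j
    using * w_pos[of j] by (auto simp: degree_map_def vec_eq_iff dest: spec[of _ j])
  then show ?thesis by (simp add: vec_eq_iff)
qed

section \<open>The faithful representation by nilpotent operators\<close>

definition rho :: "real ^ 'n \<Rightarrow> ((real ^ 'n) \<times> real) endo" where
  "rho x = endo_of (\<lambda>v. (br x (fst v) - snd v *\<^sub>R degree_map x, 0))"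

lemma rho_apply [simp]: "endo_apply (rho x) v = (br x (fst v) - snd v *\<^sub>R degree_map x, 0)"
  unfolding rho_def
  by (intro endo_apply_endo_of linear_conv_bounded_linear[THEN iffD1] linearI)
     (auto simp: br_lin algebra_simps)

lemma linear_rho: "linear rho"
  by (intro linearI endo_eqI)
     (simp_all add: endo.add_left endo.scaleR_left br_lin linear_add[OF linear_degree_map]
       linear_scale[OF linear_degree_map] algebra_simps)

text \<open>The part depending on \<open>fst v\<close> is the Jacobi identity, the part depending on
  \<open>snd v\<close> the derivation rule of \<open>degree_map\<close>.\<close>

lemma rho_br: "rho (br x y) = commutator (rho x) (rho y)"
proof (rule endo_eqI)
  fix v :: "(real ^ 'n) \<times> real"
  have "br (br x y) (fst v) = br x (br y (fst v)) - br y (br x (fst v))"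
  proof -
    have 1: "br (br y (fst v)) x = - br x (br y (fst v))" by (rule br_antisym)
    have 2: "br (br (fst v) x) y = br y (br x (fst v))"
      using br_antisym[of "br (fst v) x" y] br_antisym[of "fst v" x] by (simp add: br_lin)
    have "br (br x y) (fst v) - (br x (br y (fst v)) - br y (br x (fst v))) =
        br (br x y) (fst v) + - br x (br y (fst v)) + br y (br x (fst v))"
      by simp
    also have "\<dots> = 0" using br_jacobi[of x y "fst v"] unfolding 1 2 .
    finally show ?thesis by (rule right_minus_eq[THEN iffD1])
  qed
  then show "endo_apply (rho (br x y)) v = endo_apply (commutator (rho x) (rho y)) v"
    by (simp add: commutator_def endo.diff_left degree_map_br br_lin br_antisym[of "degree_map x" y]
        algebra_simps)
qed

lemma rho_inject: "rho x = rho y \<Longrightarrow> x = y"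
proof -
  assume "rho x = rho y"
  then have "endo_apply (rho (x - y)) (0, 1) = 0" by (simp add: linear_diff[OF linear_rho] endo.zero_left)
  then have "degree_map (x - y) = 0" by (simp add: br_lin zero_prod_def)
  from degree_map_eq_0[OF this] show "x = y" by simp
qed

text \<open>The additional coordinate has weight \<open>0\<close>.\<close>

definition filt_ext :: "nat \<Rightarrow> ((real ^ 'n) \<times> real) set" where
  "filt_ext k = {v. fst v \<in> filt k \<and> (1 \<le> k \<longrightarrow> snd v = 0)}"

definition filt_endo :: "nat \<Rightarrow> ((real ^ 'n) \<times> real) endo set" where
  "filt_endo k = {T. \<forall>i. \<forall>v\<in>filt_ext i. endo_apply T v \<in> filt_ext (i + k)}"

lemma subspace_filt_ext: "subspace (filt_ext k)"
  using subspace_filt[of k] by (auto simp: filt_ext_def subspace_def)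

lemma filt_ext_antimono: "i \<le> j \<Longrightarrow> filt_ext j \<subseteq> filt_ext i"
  using filt_antimono[of i j] by (auto simp: filt_ext_def)

text \<open>The map \<open>degree_map\<close> preserves weights and so would not raise the
  filtration. But its factor \<open>snd v\<close> vanishes from level 1 on, and at level 0 the
  vector component faces no condition, since all weights are at least 1.\<close>

lemma rho_filt_endo: "rho x \<in> filt_endo 1"
proof -
  have *: "br x (fst v) - snd v *\<^sub>R degree_map x \<in> filt (i + 1)" if "v \<in> filt_ext i" for v i
  proof (cases "i = 0")
    case True
    then show ?thesis using filt_le_1[of 1] by simp
  next
    case False
    have "br x (fst v) \<in> filt (1 + i)"
      using that filt_le_1[of 1] by (intro br_filt) (auto simp: filt_ext_def)
    then show ?thesis using that False by (simp add: filt_ext_def)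
  qed
  show ?thesis
    unfolding filt_endo_def mem_Collect_eq
  proof (intro allI ballI)
    fix i v assume "v \<in> filt_ext i"
    from *[OF this] show "endo_apply (rho x) v \<in> filt_ext (i + 1)" by (simp add: filt_ext_def)
  qed
qed

interpretation filtered_algebra filt_endo r
proof
  show "subspace (filt_endo k)" for k
    using subspace_filt_ext
    by (auto simp: filt_endo_def subspace_def endo.add_left endo.scaleR_left endo.zero_left)
  show "S * T \<in> filt_endo (i + j)" if "S \<in> filt_endo i" "T \<in> filt_endo j" for S T i j
  proof -
    have "endo_apply (S * T) v \<in> filt_ext (m + (i + j))" if "v \<in> filt_ext m" for v m
    proof -
      have "endo_apply T v \<in> filt_ext (m + j)" using \<open>T \<in> filt_endo j\<close> that by (simp add: filt_endo_def)
      then have "endo_apply S (endo_apply T v) \<in> filt_ext (m + j + i)"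
        using \<open>S \<in> filt_endo i\<close> by (simp add: filt_endo_def)
      then show ?thesis by (simp add: ac_simps)
    qed
    then show ?thesis by (simp add: filt_endo_def)
  qed
  show "1 \<in> filt_endo 0" by (simp add: filt_endo_def)
  show "filt_endo (Suc k) \<subseteq> filt_endo k" for k
  proof -
    have "filt_ext (i + Suc k) \<subseteq> filt_ext (i + k)" for i by (rule filt_ext_antimono) simp
    then show ?thesis unfolding filt_endo_def by blast
  qed
  show "filt_endo (Suc r) = {0}"
  proof (intro equalityI subsetI)
    fix T assume T: "T \<in> filt_endo (Suc r)"
    have "endo_apply T v = endo_apply 0 v" for v
    proof -
      have "v \<in> filt_ext 0" using filt_le_1[of 0] by (simp add: filt_ext_def)
      then have "endo_apply T v \<in> filt_ext (0 + Suc r)" using T unfolding filt_endo_def by blast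
      then show ?thesis by (simp add: filt_ext_def filt_Suc_r endo.zero_left prod_eq_iff)
    qed
    then have "T = 0" by (rule endo_eqI)
    then show "T \<in> {0}" by simp
  qed (auto simp: filt_endo_def endo.zero_left subspace_0[OF subspace_filt_ext])
  show "1 \<le> r" by (rule r_pos)
qed

section \<open>The group and its smooth structure\<close>

abbreviation dmult :: "real ^ 'n \<Rightarrow> real ^ 'n \<Rightarrow> real ^ 'n" where
  "dmult \<equiv> dynkin_product br r"

lemma exp_rho_dmult: "exp (rho (dmult x y)) = exp (rho x) * exp (rho y)"
  using exp_mult_exp_eq_dynkin[OF rho_filt_endo rho_filt_endo, of x y]
  by (simp add: dynkin_product_hom[of rho br commutator, OF linear_rho rho_br])

lemma exp_rho_inject: "exp (rho x) = exp (rho y) \<Longrightarrow> x = y"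
  by (rule rho_inject)
     (rule exp_inject_nilpotent[OF power_eq_0[OF rho_filt_endo] power_eq_0[OF rho_filt_endo]])

lemma rho_zero [simp]: "rho 0 = 0" by (rule linear_0[OF linear_rho])

lemma dmult_assoc: "dmult (dmult x y) z = dmult x (dmult y z)"
  by (rule exp_rho_inject) (simp add: exp_rho_dmult mult.assoc)

text \<open>The unit laws come from the same injection \<open>exp \<circ> rho\<close> as
  associativity, without inspecting Dynkin's series; so does the inverse.\<close>

lemma dmult_0_left [simp]: "dmult 0 x = x"
  and dmult_0_right [simp]: "dmult x 0 = x"
  by (rule exp_rho_inject; simp add: exp_rho_dmult)+

lemma dmult_minus [simp]: "dmult x (- x) = 0"
  by (rule exp_rho_inject) (simp add: exp_rho_dmult linear_neg[OF linear_rho] exp_minus_inverse)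

lemma dmult_minus_left [simp]: "dmult (- x) x = 0"
  using dmult_minus[of "- x"] by simp

definition dgroup :: "(real ^ 'n) monoid" where
  "dgroup = \<lparr>carrier = UNIV, mult = dmult, one = 0\<rparr>"

lemma dgroup_simps [simp]:
  "carrier dgroup = UNIV" "x \<otimes>\<^bsub>dgroup\<^esub> y = dmult x y" "\<one>\<^bsub>dgroup\<^esub> = 0"
  by (simp_all add: dgroup_def)

lemma group_dgroup: "group dgroup"
proof (rule groupI)
  fix x assume "x \<in> carrier dgroup"
  show "\<exists>y\<in>carrier dgroup. y \<otimes>\<^bsub>dgroup\<^esub> x = \<one>\<^bsub>dgroup\<^esub>"
    by (rule bexI[of _ "- x"]) simp_all
qed (simp_all add: dmult_assoc)

lemma inv_dgroup [simp]: "inv\<^bsub>dgroup\<^esub> x = - x"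
  by (rule group.inv_equality[OF group_dgroup]) simp_all

lemma smooth_on_dmult: "smooth_on UNIV (\<lambda>(x, y). dmult x y)"
proof -
  have "smooth_on UNIV (\<lambda>z. \<Sum>s\<in>dynkin_indices r. dynkin_coeff s *\<^sub>R
      (case z of (x, y) \<Rightarrow> iterated_bracket br (dynkin_word x y s)))"
    by (intro smooth_on_sum open_UNIV smooth_on_bounded_linear[OF _ bounded_linear_scaleR_right]
        smooth_on_iterated_bracket bilinear_br)
  then show ?thesis by (simp add: dynkin_product_eq case_prod_unfold)
qed

lemma lie_group_dgroup: "lie_group_on_Rn dgroup"
  using smooth_on_dmult group_dgroup bounded_linear_smooth_on[OF bounded_linear_minus[OF bounded_linear_ident]]
  by (simp add: lie_group_on_Rn_def)

definition dil :: "real \<Rightarrow> real ^ 'n \<Rightarrow> real ^ 'n" where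
  "dil t x = (\<chi> j. t ^ w j * x $ j)"

lemma dil_br: "dil t (br x y) = br (dil t x) (dil t y)"
proof -
  have *: "t ^ w k * (x $ i * y $ j * c i j k) = t ^ w i * x $ i * (t ^ w j * y $ j) * c i j k" for i j k
    using graded[of i j k] by (cases "c i j k = 0") (auto simp: power_add)
  show ?thesis
    unfolding dil_def br_def vec_eq_iff vec_lambda_beta sum_distrib_left * by simp
qed

lemma linear_dil: "linear (dil t)"
  by (intro linearI) (simp_all add: dil_def vec_eq_iff algebra_simps)

lemma dil_iso:
  assumes "t \<noteq> 0"
  shows "dil t \<in> iso dgroup dgroup"
proof -
  have "bij (dil t)"
    by (rule bijI'[where f = "dil t"])
       (use assms in \<open>auto simp: dil_def vec_eq_iff intro!: exI[of _ "\<chi> j. _ $ j / t ^ w j"]\<close>)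
  then show ?thesis
    by (simp add: iso_def hom_def dynkin_product_hom[of "dil t" br br, OF linear_dil dil_br])
qed

section \<open>The Lie algebra of the group\<close>

definition wterm :: "(nat \<times> nat) list \<Rightarrow> real ^ 'n \<Rightarrow> real ^ 'n \<Rightarrow> real ^ 'n" where
  "wterm s x y = iterated_bracket br (dynkin_word x y s)"

lemma wterm_scaleR:
  "wterm s (a *\<^sub>R x) (b *\<^sub>R y) = (a ^ sum_list (map fst s) * b ^ sum_list (map snd s)) *\<^sub>R wterm s x y"
  unfolding wterm_def by (rule iterated_bracket_word_scaleR[OF bilinear_br])

lemma dmult_eq: "dmult x y = (\<Sum>s\<in>dynkin_indices r. dynkin_coeff s *\<^sub>R wterm s x y)"
  by (simp add: dynkin_product_eq wterm_def)

lemma wterm_differentiable: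
  "(\<lambda>y. wterm s x y) differentiable (at z)" "(\<lambda>x. wterm s x y) differentiable (at z)"
proof -
  have d: "(\<lambda>(x, y). wterm s x y) differentiable (at p)" for p
    using smooth_on_iterated_bracket[OF bilinear_br, of s]
    by (intro smooth_on_differentiable[where S = UNIV]) (simp_all add: wterm_def)
  have "(\<lambda>y. (x, y)) differentiable (at z)" "(\<lambda>x. (x, y)) differentiable (at z)"
    by (rule differentiable_Pair; simp)+
  then show "(\<lambda>y. wterm s x y) differentiable (at z)" "(\<lambda>x. wterm s x y) differentiable (at z)"
    using differentiable_chain_at[of "\<lambda>y. (x, y)" z "\<lambda>(x, y). wterm s x y"]
      differentiable_chain_at[of "\<lambda>x. (x, y)" z "\<lambda>(x, y). wterm s x y"] d
    by (simp_all add: o_def)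
qed

text \<open>In \<open>y\<close> each word is homogeneous of degree its number of letters
  \<open>y\<close>, so differentiating at the unit keeps exactly the words linear in
  \<open>y\<close>.\<close>

lemma left_invariant_vf_dgroup:
  "left_invariant_vf dgroup v x =
    (\<Sum>s\<in>dynkin_indices r. (if sum_list (map snd s) = 1 then dynkin_coeff s else 0) *\<^sub>R wterm s x v)"
proof -
  have "frechet_derivative (\<lambda>y. wterm s x y) (at 0) v =
      (if sum_list (map snd s) = 1 then wterm s x v else 0)" for s
    using wterm_scaleR[of s 1 x _ v]
    by (intro frechet_derivative_homogeneous wterm_differentiable) simp
  then show ?thesis
    by (simp add: left_invariant_vf_def dmult_eq frechet_derivative_sum frechet_derivative_scaleR
        scaleR_differentiable wterm_differentiable if_distrib cong: if_cong)
       (intro sum.cong refl, simp)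
qed

lemma frechet_left_invariant_vf:
  "frechet_derivative (left_invariant_vf dgroup v) (at 0) u = (1 / 2) *\<^sub>R br u v"
proof -
  have "frechet_derivative (\<lambda>x. wterm s x v) (at 0) u =
      (if sum_list (map fst s) = 1 then wterm s u v else 0)" for s
    using wterm_scaleR[of s _ u 1 v]
    by (intro frechet_derivative_homogeneous wterm_differentiable) simp
  then have "frechet_derivative (left_invariant_vf dgroup v) (at 0) u =
      (\<Sum>s\<in>dynkin_indices r. (if sum_list (map snd s) = 1 then dynkin_coeff s else 0) *\<^sub>R
        (if sum_list (map fst s) = 1 then wterm s u v else 0))"
    unfolding left_invariant_vf_dgroup[abs_def]
    by (simp add: frechet_derivative_sum frechet_derivative_scaleR
        scaleR_differentiable wterm_differentiable)
  also have "\<dots> = (\<Sum>s\<in>dynkin_indices r. if sum_list (map snd s) = 1 \<and> sum_list (map fst s) = 1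
      then dynkin_coeff s *\<^sub>R wterm s u v else 0)"
    by (intro sum.cong refl) simp
  also have "\<dots> = (\<Sum>s\<in>{s \<in> dynkin_indices r. sum_list (map snd s) = 1 \<and> sum_list (map fst s) = 1}.
      dynkin_coeff s *\<^sub>R wterm s u v)"
    by (rule sum.inter_filter[symmetric]) simp
  also have "\<dots> = (1 / 2) *\<^sub>R br u v"
  proof (cases "2 \<le> r")
    case True
    \<comment> \<open>The single block \<open>xy\<close> has coefficient \<open>1/2\<close>; the
      two-block words \<open>x|y\<close> and \<open>y|x\<close> have \<open>-1/4\<close> each, and
      their opposite brackets cancel.\<close>
    have "(\<Sum>s\<in>{[(1, 1)], [(1, 0), (0, 1)], [(0, 1), (1, 0)]}. dynkin_coeff s *\<^sub>R wterm s u v) =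
        (1 / 2) *\<^sub>R br u v + ((- 1 / 4) *\<^sub>R br u v + (- 1 / 4) *\<^sub>R br v u)"
      by (simp add: dynkin_coeff_def wterm_def dynkin_word_def)
    also have "\<dots> = (1 / 2) *\<^sub>R br u v"
      using br_antisym[of v u] by simp
    finally show ?thesis unfolding dynkin_indices_bidegree_1_1[OF True] .
  next
    \<comment> \<open>For \<open>r = 1\<close> the truncated series contains no word with two
      letters, but the bracket is zero as well, since it would have weight at least 2.\<close>
    case False
    then have "br u v = 0"
      using br_filt[of u 1 v 1] filt_le_1[of 1] filt_Suc_r r_pos by (auto simp: numeral_2_eq_2 not_less_eq_eq)
    moreover have "wterm s u v = 0" if "s \<in> dynkin_indices r" "sum_list (map snd s) = 1" "sum_list (map fst s) = 1" for s
    proof -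
      have "(\<Sum>(p, q)\<leftarrow>s. p + q) = sum_list (map fst s) + sum_list (map snd s)"
        by (induction s) auto
      then show ?thesis using that False by (simp add: mem_dynkin_indices)
    qed
    ultimately show ?thesis by (intro trans[OF sum.neutral]) auto
  qed
  finally show ?thesis .
qed

text \<open>The two derivatives at the unit are half of \<open>[u, v]\<close> and half of
  \<open>[v, u]\<close>; antisymmetry makes their difference the full bracket.\<close>

lemma lie_algebra_bracket_dgroup: "lie_algebra_bracket dgroup u v = br u v"
proof -
  have "left_invariant_vf dgroup v 0 = v" for v
    by (simp add: left_invariant_vf_def)
  then show ?thesis
    using br_antisym[of v u]
    by (simp add: lie_algebra_bracket_def vf_bracket_def frechet_left_invariant_vf flip: scaleR_add_left)
qed

section \<open>Nilpotency of the group\<close>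

lemma iterated_br_congruent:
  assumes "length us = length vs" "\<And>i. i < length us \<Longrightarrow> us ! i - vs ! i \<in> filt k"
  shows "iterated_bracket br us - iterated_bracket br vs \<in> filt k"
  using assms
proof (induction us arbitrary: vs rule: induct_list012)
  case 1
  then show ?case by (simp add: subspace_0[OF subspace_filt])
next
  case (2 u)
  then show ?case by (cases vs) auto
next
  case (3 u u' us)
  then obtain v v' vs' where vs: "vs = v # v' # vs'" by (metis Suc_length_conv length_Cons)
  let ?a = "iterated_bracket br (u' # us)" and ?b = "iterated_bracket br (v' # vs')"
  have "u - v \<in> filt k" using "3.prems"(2)[of 0] vs by simp
  moreover have "?a - ?b \<in> filt k"
    using "3.prems" by (intro "3.IH"(2)) (force simp: vs dest: spec[of _ "Suc _"])+
  moreover have "br s t \<in> filt k" "br t s \<in> filt k" if "t \<in> filt k" for s t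
  proof -
    have "s \<in> filt 0" by (simp add: filt_le_1)
    then show "br s t \<in> filt k" "br t s \<in> filt k" using br_filt[of s 0 t k] br_filt[of t k s 0] that by auto
  qed
  ultimately have "br (u - v) ?a + br v (?a - ?b) \<in> filt k"
    by (intro subspace_add[OF subspace_filt])
  then show ?case by (simp add: vs br_lin)
qed

text \<open>Since \<open>filt 0\<close> is everything, \<open>filt k\<close> is an ideal, and
  iterated brackets depend modulo an ideal only on the classes of their letters.\<close>

lemma dmult_congruent:
  assumes "x - x' \<in> filt k" "y - y' \<in> filt k"
  shows "dmult x y - dmult x' y' \<in> filt k"
proof -
  have "wterm s x y - wterm s x' y' \<in> filt k" for s
  proof -
    let ?z = "\<lambda>b. if b then x else y" and ?z' = "\<lambda>b. if b then x' else y'"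
    have "wterm s x y = iterated_bracket br (map ?z (dynkin_word True False s))"
      "wterm s x' y' = iterated_bracket br (map ?z' (dynkin_word True False s))"
      by (simp_all add: wterm_def map_dynkin_word)
    then show ?thesis using assms iterated_br_congruent[of "map ?z (dynkin_word True False s)" "map ?z' (dynkin_word True False s)"]
      by simp
  qed
  then show ?thesis
    unfolding dmult_eq sum_subtractf[symmetric] scaleR_diff_right[symmetric]
    by (intro subspace_sum[OF subspace_filt] subspace_scale[OF subspace_filt])
qed

text \<open>The one-letter words give \<open>x + y\<close>. In a longer word the innermost bracket
  is zero or a bracket of \<open>x\<close> and \<open>y\<close>, one of which lies in
  \<open>filt k\<close> and the other in \<open>filt 1\<close>; further brackets stay in the ideal
  \<open>filt (Suc k)\<close>.\<close>

lemma dmult_congruent_add: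
  assumes "x \<in> filt k \<or> y \<in> filt k"
  shows "dmult x y - (x + y) \<in> filt (Suc k)"
proof -
  have ab: "br a b \<in> filt (Suc k)" if "a \<in> {x, y}" "b \<in> {x, y}" for a b
  proof -
    have "x \<in> filt 1" "y \<in> filt 1" by (simp_all add: filt_le_1)
    then show ?thesis
      using that assms br_filt[of x k y 1] br_filt[of x 1 y k] br_filt[of y k x 1] br_filt[of y 1 x k]
      by (auto simp: subspace_0[OF subspace_filt])
  qed
  have it: "iterated_bracket br us \<in> filt (Suc k)" if "set us \<subseteq> {x, y}" "2 \<le> length us" for us
    using that
  proof (induction us rule: induct_list012)
    case (3 u u' us)
    show ?case
    proof (cases us)
      case Nil
      then show ?thesis using ab 3 by simp
    next
      case (Cons a as)
      then have "iterated_bracket br (u' # us) \<in> filt (Suc k)" using 3 by simp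
      moreover have "u \<in> filt 0" by (simp add: filt_le_1)
      ultimately show ?thesis using br_filt[of u 0 _ "Suc k"] by simp
    qed
  qed auto
  let ?tot = "\<lambda>s. \<Sum>(p, q)\<leftarrow>s. p + q" and ?I1 = "{s \<in> dynkin_indices r. (\<Sum>(p, q)\<leftarrow>s. p + q) = 1}"
  have "dmult x y = (\<Sum>s\<in>dynkin_indices r - ?I1. dynkin_coeff s *\<^sub>R wterm s x y) +
      (\<Sum>s\<in>?I1. dynkin_coeff s *\<^sub>R wterm s x y)"
    unfolding dmult_eq by (rule sum.subset_diff) auto
  also have "(\<Sum>s\<in>?I1. dynkin_coeff s *\<^sub>R wterm s x y) = x + y"
    unfolding dynkin_indices_sum_eq_1[OF r_pos]
    by (simp add: dynkin_coeff_def wterm_def dynkin_word_def)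
  finally have "dmult x y - (x + y) = (\<Sum>s\<in>dynkin_indices r - ?I1. dynkin_coeff s *\<^sub>R wterm s x y)"
    by simp
  also have "\<dots> \<in> filt (Suc k)"
  proof (intro subspace_sum[OF subspace_filt] subspace_scale[OF subspace_filt])
    fix s assume s: "s \<in> dynkin_indices r - ?I1"
    then have "0 < ?tot s" "?tot s \<noteq> 1"
      using dynkin_index_sum_pos[of s r] by (auto simp: dynkin_indices_def simp del: sum_list_eq_0_iff)
    then show "wterm s x y \<in> filt (Suc k)"
      unfolding wterm_def by (intro it set_dynkin_word) simp
  qed
  finally show ?thesis .
qed

lemma subgroup_filt: "subgroup (filt k) dgroup"
proof
  fix x y assume xy: "x \<in> filt k" "y \<in> filt k"
  have "dmult x y - (x + y) \<in> filt (Suc k)" using xy by (intro dmult_congruent_add) simp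
  then have "(dmult x y - (x + y)) + (x + y) \<in> filt k"
    using filt_antimono[of k "Suc k"] xy by (intro subspace_add[OF subspace_filt]) auto
  then show "x \<otimes>\<^bsub>dgroup\<^esub> y \<in> filt k" by simp
qed (simp_all add: subspace_0[OF subspace_filt] subspace_neg[OF subspace_filt])

text \<open>Modulo \<open>filt (Suc k)\<close> both \<open>x y\<close> and \<open>y x\<close> are
  \<open>x + y\<close>. Multiplying this congruence by the inverse of \<open>y x\<close> gives the
  commutator on one side and the unit on the other.\<close>

lemma commutator_dmult_filt:
  assumes "y \<in> filt k"
  shows "dmult (dmult (dmult x y) (- x)) (- y) \<in> filt (Suc k)"
proof -
  have inv: "dmult (- x) (- y) = - dmult y x"
    using group.inv_mult_group[OF group_dgroup, of y x] by simp
  have "(dmult x y - (x + y)) - (dmult y x - (y + x)) \<in> filt (Suc k)"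
    using assms by (intro subspace_diff[OF subspace_filt] dmult_congruent_add) auto
  then have "dmult x y - dmult y x \<in> filt (Suc k)" by (simp add: algebra_simps)
  then have "dmult (dmult x y) (- dmult y x) - dmult (dmult y x) (- dmult y x) \<in> filt (Suc k)"
    by (rule dmult_congruent) (simp add: subspace_0[OF subspace_filt])
  then show ?thesis by (simp add: dmult_assoc inv)
qed

lemma lower_central_dgroup: "lower_central dgroup k \<subseteq> filt (Suc k)"
proof (induction k)
  case 0
  then show ?case by (simp add: filt_le_1)
next
  case (Suc k)
  have "{x \<otimes>\<^bsub>dgroup\<^esub> y \<otimes>\<^bsub>dgroup\<^esub> inv\<^bsub>dgroup\<^esub> x \<otimes>\<^bsub>dgroup\<^esub> inv\<^bsub>dgroup\<^esub> y |x y.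
      x \<in> carrier dgroup \<and> y \<in> lower_central dgroup k} \<subseteq> filt (Suc (Suc k))"
    using Suc.IH commutator_dmult_filt by auto
  then show ?case
    unfolding lower_central.simps
    by (rule group.generate_subgroup_incl[OF group_dgroup _ subgroup_filt])
qed

lemma nilpotent_dgroup: "nilpotent_group dgroup"
proof -
  obtain k where k: "r = Suc k" using r_pos by (cases r) auto
  have "\<one>\<^bsub>dgroup\<^esub> \<in> lower_central dgroup r"
    unfolding k lower_central.simps by (rule generate.one)
  then have "lower_central dgroup r = {\<one>\<^bsub>dgroup\<^esub>}"
    using lower_central_dgroup[of r] by (auto simp: filt_Suc_r)
  then show ?thesis using group_dgroup by (auto simp: nilpotent_group_def)
qed

end

section \<open>Tangent vectors in charts\<close>

lemma is_chartD:
  assumes "is_chart (D, \<phi>)"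
  shows "open D" "open (\<phi> ` D)" "inj_on \<phi> D" "continuous_on (\<phi> ` D) (inv_into D \<phi>)"
proof -
  from assms have *: "open D" "open (\<phi> ` D)" "homeomorphism D (\<phi> ` D) \<phi> (inv_into D \<phi>)"
    by (simp_all add: is_chart_def)
  then show "open D" "open (\<phi> ` D)" by simp_all
  from *(3) show "inj_on \<phi> D" "continuous_on (\<phi> ` D) (inv_into D \<phi>)"
    by (auto simp: homeomorphism_def intro: inj_on_inverseI)
qed

lemma chart_image_open:
  assumes "is_chart (D, \<phi>)" "open U"
  shows "open (\<phi> ` (U \<inter> D))"
proof -
  note c = is_chartD[OF assms(1)]
  have "\<phi> ` (U \<inter> D) = inv_into D \<phi> -` U \<inter> \<phi> ` D"
    using c(3) by (auto simp: image_iff inv_into_f_f intro!: bexI)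
  then show ?thesis
    using continuous_on_open_vimage[OF c(2)] c(4) assms(2) by metis
qed

lemma frechet_derivative_bounded_linear:
  "bounded_linear h \<Longrightarrow> frechet_derivative h (at x) = h"
  by (rule frechet_derivative_at[symmetric]) (rule bounded_linear_imp_has_derivative)

locale manifold_atlas =
  fixes A :: "('m::{t2_space, second_countable_topology}, 'n::finite) chart set"
  assumes atlas: "smooth_atlas A"
begin

section \<open>Charts and smooth functions\<close>

lemma chart: "(D, \<phi>) \<in> A \<Longrightarrow> is_chart (D, \<phi>)"
  using atlas by (auto simp: smooth_atlas_def)

lemma ex_chart: "\<exists>D \<phi>. (D, \<phi>) \<in> A \<and> p \<in> D"
proof -
  have "p \<in> \<Union> (fst ` A)" using atlas by (auto simp: smooth_atlas_def)
  then show ?thesis by auto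
qed

lemma chart_inv: "(D, \<phi>) \<in> A \<Longrightarrow> p \<in> D \<Longrightarrow> inv_into D \<phi> (\<phi> p) = p"
  using is_chartD(3)[OF chart] by (simp add: inv_into_f_f)

lemma transition_smooth:
  "(D, \<phi>) \<in> A \<Longrightarrow> (D', \<phi>') \<in> A \<Longrightarrow> smooth_on (\<phi> ` (D \<inter> D')) (\<phi>' \<circ> inv_into D \<phi>)"
  using atlas unfolding smooth_atlas_def by blast

lemma smooth_fun_onD:
  "smooth_fun_on A U f \<Longrightarrow> (D, \<phi>) \<in> A \<Longrightarrow> smooth_on (\<phi> ` (U \<inter> D)) (f \<circ> inv_into D \<phi>)"
  unfolding smooth_fun_on_def by blast

lemma smooth_fun_on_subset:
  assumes "smooth_fun_on A U f" "open V" "V \<subseteq> U"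
  shows "smooth_fun_on A V f"
proof -
  have "smooth_on (\<phi> ` (V \<inter> D)) (f \<circ> inv_into D \<phi>)" if "(D, \<phi>) \<in> A" for D \<phi>
    by (rule smooth_on_subset[OF smooth_fun_onD[OF assms(1) that]]) (use assms(3) in auto)
  then show ?thesis using assms(2) unfolding smooth_fun_on_def by blast
qed

lemma smooth_fun_on_cong:
  assumes "smooth_fun_on A U f" "\<And>q. q \<in> U \<Longrightarrow> f q = g q"
  shows "smooth_fun_on A U g"
proof -
  have U: "open U" using assms(1) by (simp add: smooth_fun_on_def)
  have "smooth_on (\<phi> ` (U \<inter> D)) (g \<circ> inv_into D \<phi>)" if c: "(D, \<phi>) \<in> A" for D \<phi>
  proof -
    have "(f \<circ> inv_into D \<phi>) y = (g \<circ> inv_into D \<phi>) y" if "y \<in> \<phi> ` (U \<inter> D)" for y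
      using that assms(2) chart_inv[OF c] by auto
    from ck_on_cong[OF chart_image_open[OF chart[OF c] U], of "f \<circ> inv_into D \<phi>" "g \<circ> inv_into D \<phi>", OF this]
    show ?thesis
      using smooth_fun_onD[OF assms(1) c] by (simp add: smooth_on_def)
  qed
  then show ?thesis using U unfolding smooth_fun_on_def by blast
qed

lemma smooth_nearI: "smooth_fun_on A U f \<Longrightarrow> p \<in> U \<Longrightarrow> smooth_near A p f"
  unfolding smooth_near_def by blast

lemma smooth_near_differentiable:
  assumes "smooth_near A p f" "(D, \<phi>) \<in> A" "p \<in> D"
  shows "(f \<circ> inv_into D \<phi>) differentiable (at (\<phi> p))"
proof -
  obtain U where U: "p \<in> U" "smooth_fun_on A U f" using assms(1) by (auto simp: smooth_near_def)
  show ?thesis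
    by (rule smooth_on_differentiable[OF smooth_fun_onD[OF U(2) assms(2)]]) (use U assms in auto)
qed

lemma chart_frechet_cong:
  assumes "(D, \<phi>) \<in> A" "p \<in> D" "open V" "p \<in> V" "\<And>q. q \<in> V \<Longrightarrow> f q = g q"
  shows "frechet_derivative (f \<circ> inv_into D \<phi>) (at (\<phi> p)) = frechet_derivative (g \<circ> inv_into D \<phi>) (at (\<phi> p))"
    and "(f \<circ> inv_into D \<phi>) differentiable (at (\<phi> p)) \<longleftrightarrow> (g \<circ> inv_into D \<phi>) differentiable (at (\<phi> p))"
proof -
  note o = chart_image_open[OF chart[OF assms(1)] assms(3)]
  have m: "\<phi> p \<in> \<phi> ` (V \<inter> D)" using assms by auto
  have e: "(f \<circ> inv_into D \<phi>) y = (g \<circ> inv_into D \<phi>) y" if "y \<in> \<phi> ` (V \<inter> D)" for y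
    using that assms(5) chart_inv[OF assms(1)] by auto
  show "frechet_derivative (f \<circ> inv_into D \<phi>) (at (\<phi> p)) = frechet_derivative (g \<circ> inv_into D \<phi>) (at (\<phi> p))"
    by (rule frechet_derivative_cong_open[OF o m e])
  show "(f \<circ> inv_into D \<phi>) differentiable (at (\<phi> p)) \<longleftrightarrow> (g \<circ> inv_into D \<phi>) differentiable (at (\<phi> p))"
    by (rule differentiable_cong_open[OF o m e])
qed

section \<open>Tangent vectors in a fixed chart\<close>

lemma coord_vector_change:
  assumes "(D, \<phi>) \<in> A" "p \<in> D" "(D', \<phi>') \<in> A" "p \<in> D'"
  shows "coord_vector A (D', \<phi>') p u =
    coord_vector A (D, \<phi>) p (frechet_derivative (\<phi> \<circ> inv_into D' \<phi>') (at (\<phi>' p)) u)"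
proof
  fix f :: "'m \<Rightarrow> real"
  let ?h = "\<phi> \<circ> inv_into D' \<phi>'" and ?g = "f \<circ> inv_into D \<phi>"
  show "coord_vector A (D', \<phi>') p u f =
    coord_vector A (D, \<phi>) p (frechet_derivative ?h (at (\<phi>' p)) u) f"
  proof (cases "smooth_near A p f")
    case True
    have hp: "?h (\<phi>' p) = \<phi> p" using chart_inv[OF assms(3,4)] by simp
    have "?h differentiable (at (\<phi>' p))"
      by (rule smooth_on_differentiable[OF transition_smooth[OF assms(3,1)]]) (use assms in auto)
    then have h: "(?h has_derivative frechet_derivative ?h (at (\<phi>' p))) (at (\<phi>' p))"
      by (simp add: frechet_derivative_works)
    have g: "(?g has_derivative frechet_derivative ?g (at (\<phi> p))) (at (?h (\<phi>' p)))"
      using smooth_near_differentiable[OF True assms(1,2)] unfolding hp by (simp add: frechet_derivative_works)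
    have "frechet_derivative (f \<circ> inv_into D' \<phi>') (at (\<phi>' p)) = frechet_derivative (?g \<circ> ?h) (at (\<phi>' p))"
    proof (rule frechet_derivative_cong_open)
      show "open (\<phi>' ` (D \<inter> D'))"
        by (rule chart_image_open[OF chart[OF assms(3)] is_chartD(1)[OF chart[OF assms(1)]]])
      show "\<phi>' p \<in> \<phi>' ` (D \<inter> D')" using assms by auto
      show "(f \<circ> inv_into D' \<phi>') y = (?g \<circ> ?h) y" if "y \<in> \<phi>' ` (D \<inter> D')" for y
        using that chart_inv[OF assms(1)] chart_inv[OF assms(3)] by auto
    qed
    also have "\<dots> = frechet_derivative ?g (at (\<phi> p)) \<circ> frechet_derivative ?h (at (\<phi>' p))"
      by (rule frechet_derivative_at[OF diff_chain_at[OF h g], symmetric])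
    finally show ?thesis using True by (simp add: coord_vector_def)
  qed (simp add: coord_vector_def)
qed

text \<open>The definition of \<open>tangent_space\<close> lets the chart vary with the vector. By
  the chain rule for the transition map, one chart serves all vectors at \<open>p\<close>.\<close>

lemma tangent_space_chart:
  assumes "v \<in> tangent_space A p" "(D, \<phi>) \<in> A" "p \<in> D"
  obtains u where "v = coord_vector A (D, \<phi>) p u"
proof -
  obtain c u' where "c \<in> A" "p \<in> fst c" "v = coord_vector A c p u'"
    using assms(1) unfolding tangent_space_def by blast
  moreover obtain D' \<phi>' where "c = (D', \<phi>')" by (cases c)
  ultimately have c: "(D', \<phi>') \<in> A" "p \<in> D'" and v: "v = coord_vector A (D', \<phi>') p u'" by auto
  from v have "v = coord_vector A (D, \<phi>) p (frechet_derivative (\<phi> \<circ> inv_into D' \<phi>') (at (\<phi>' p)) u')"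
    unfolding coord_vector_change[OF assms(2,3) c] .
  then show thesis by (rule that)
qed

lemma smooth_fun_on_coord:
  assumes "(D, \<phi>) \<in> A"
  shows "smooth_fun_on A D (\<lambda>q. \<phi> q $ m)"
proof -
  have "smooth_on (\<phi>' ` (D \<inter> D')) ((\<lambda>q. \<phi> q $ m) \<circ> inv_into D' \<phi>')" if c: "(D', \<phi>') \<in> A" for D' \<phi>'
  proof -
    have "smooth_on (\<phi>' ` (D \<inter> D')) (\<lambda>y. (\<phi> \<circ> inv_into D' \<phi>') y $ m)"
    proof (rule smooth_on_bounded_linear[of _ "\<lambda>y. y $ m" "\<phi> \<circ> inv_into D' \<phi>'"])
      show "open (\<phi>' ` (D \<inter> D'))"
        by (rule chart_image_open[OF chart[OF c] is_chartD(1)[OF chart[OF assms]]])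
      show "smooth_on (\<phi>' ` (D \<inter> D')) (\<phi> \<circ> inv_into D' \<phi>')"
        using transition_smooth[OF c assms] by (simp only: Int_commute)
    qed (rule bounded_linear_vec_nth)
    then show ?thesis by (simp add: o_def)
  qed
  then show ?thesis using is_chartD(1)[OF chart[OF assms]] unfolding smooth_fun_on_def by blast
qed

lemma coord_vector_coord:
  assumes "(D, \<phi>) \<in> A" "p \<in> D"
  shows "coord_vector A (D, \<phi>) p u (\<lambda>q. \<phi> q $ m) = u $ m"
proof -
  have "frechet_derivative ((\<lambda>q. \<phi> q $ m) \<circ> inv_into D \<phi>) (at (\<phi> p)) = frechet_derivative (\<lambda>y. y $ m) (at (\<phi> p))"
  proof (rule frechet_derivative_cong_open[OF is_chartD(2)[OF chart[OF assms(1)]]])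
    show "\<phi> p \<in> \<phi> ` D" using assms(2) by (rule imageI)
    show "((\<lambda>q. \<phi> q $ m) \<circ> inv_into D \<phi>) y = y $ m" if "y \<in> \<phi> ` D" for y
      using f_inv_into_f[OF that] by simp
  qed
  then show ?thesis
    using smooth_nearI[OF smooth_fun_on_coord[OF assms(1)] assms(2)]
    by (simp add: coord_vector_def frechet_derivative_bounded_linear bounded_linear_vec_nth)
qed

lemma tangent_vector_eqI:
  assumes "v \<in> tangent_space A p" "v' \<in> tangent_space A p" "(D, \<phi>) \<in> A" "p \<in> D"
    and "\<And>m. v (\<lambda>q. \<phi> q $ m) = v' (\<lambda>q. \<phi> q $ m)"
  shows "v = v'"
proof -
  obtain u where u: "v = coord_vector A (D, \<phi>) p u" by (rule tangent_space_chart[OF assms(1,3,4)])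
  obtain u' where u': "v' = coord_vector A (D, \<phi>) p u'" by (rule tangent_space_chart[OF assms(2,3,4)])
  have "u = u'" using assms(5) by (simp add: u u' coord_vector_coord[OF assms(3,4)] vec_eq_iff)
  then show ?thesis by (simp add: u u')
qed

lemma tangent_not_smooth: "v \<in> tangent_space A p \<Longrightarrow> \<not> smooth_near A p f \<Longrightarrow> v f = 0"
  unfolding tangent_space_def mem_Collect_eq coord_vector_def by (elim exE conjE) simp

lemma tangent_cong:
  assumes "v \<in> tangent_space A p" "smooth_near A p f" "smooth_near A p g"
    and "open V" "p \<in> V" "\<And>q. q \<in> V \<Longrightarrow> f q = g q"
  shows "v f = v g"
proof -
  obtain D \<phi> where c: "(D, \<phi>) \<in> A" "p \<in> D" using ex_chart by blast
  obtain u where u: "v = coord_vector A (D, \<phi>) p u" by (rule tangent_space_chart[OF assms(1) c])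
  show ?thesis using chart_frechet_cong(1)[OF c assms(4-6)] assms(2,3) by (simp add: u coord_vector_def)
qed

lemma tangent_diff:
  assumes "v \<in> tangent_space A p" "smooth_near A p f" "smooth_near A p g"
    "smooth_near A p (\<lambda>q. f q - g q)"
  shows "v (\<lambda>q. f q - g q) = v f - v g"
proof -
  obtain D \<phi> where c: "(D, \<phi>) \<in> A" "p \<in> D" using ex_chart by blast
  obtain u where u: "v = coord_vector A (D, \<phi>) p u" by (rule tangent_space_chart[OF assms(1) c])
  have hf: "(f \<circ> inv_into D \<phi> has_derivative frechet_derivative (f \<circ> inv_into D \<phi>) (at (\<phi> p))) (at (\<phi> p))"
    using smooth_near_differentiable[OF assms(2) c] by (simp only: frechet_derivative_works)
  have hg: "(g \<circ> inv_into D \<phi> has_derivative frechet_derivative (g \<circ> inv_into D \<phi>) (at (\<phi> p))) (at (\<phi> p))"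
    using smooth_near_differentiable[OF assms(3) c] by (simp only: frechet_derivative_works)
  from has_derivative_diff[OF hf hg]
  have "((\<lambda>q. f q - g q) \<circ> inv_into D \<phi> has_derivative
    (\<lambda>u. frechet_derivative (f \<circ> inv_into D \<phi>) (at (\<phi> p)) u - frechet_derivative (g \<circ> inv_into D \<phi>) (at (\<phi> p)) u)) (at (\<phi> p))"
    by (simp only: o_def)
  from frechet_derivative_at[OF this, symmetric]
  show ?thesis using assms(2-4) by (simp add: u coord_vector_def)
qed

text \<open>A product rule in which the coefficients \<open>L k\<close> need only be differentiable
  in a chart. As \<open>v\<close> takes the default value 0 on functions that are not smooth near
  \<open>p\<close>, their derivative is written in the chart instead of as
  \<open>v (L k)\<close>.\<close>

lemma tangent_sum_mult:
  assumes "v = coord_vector A (D, \<phi>) p u" "(D, \<phi>) \<in> A" "p \<in> D"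
    and "smooth_near A p h" "open V" "p \<in> V" "\<And>q. q \<in> V \<Longrightarrow> h q = (\<Sum>k\<in>K. L k q * g k q)"
    and "\<And>k. k \<in> K \<Longrightarrow> smooth_near A p (g k)"
    and "\<And>k. k \<in> K \<Longrightarrow> (L k \<circ> inv_into D \<phi>) differentiable (at (\<phi> p))"
  shows "v h = (\<Sum>k\<in>K. L k p * v (g k) + frechet_derivative (L k \<circ> inv_into D \<phi>) (at (\<phi> p)) u * g k p)"
proof -
  let ?L = "\<lambda>k. L k \<circ> inv_into D \<phi>" and ?g = "\<lambda>k. g k \<circ> inv_into D \<phi>"
  have "((\<lambda>y. \<Sum>k\<in>K. ?L k y * ?g k y) has_derivative
    (\<lambda>u. \<Sum>k\<in>K. ?L k (\<phi> p) * frechet_derivative (?g k) (at (\<phi> p)) u +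
      frechet_derivative (?L k) (at (\<phi> p)) u * ?g k (\<phi> p))) (at (\<phi> p))"
  proof (rule has_derivative_sum)
    fix k assume k: "k \<in> K"
    have hL: "(?L k has_derivative frechet_derivative (?L k) (at (\<phi> p))) (at (\<phi> p))"
      using assms(9)[OF k] by (simp only: frechet_derivative_works)
    have hg: "(?g k has_derivative frechet_derivative (?g k) (at (\<phi> p))) (at (\<phi> p))"
      using smooth_near_differentiable[OF assms(8)[OF k] assms(2,3)] by (simp only: frechet_derivative_works)
    show "((\<lambda>y. ?L k y * ?g k y) has_derivative (\<lambda>u. ?L k (\<phi> p) * frechet_derivative (?g k) (at (\<phi> p)) u +
      frechet_derivative (?L k) (at (\<phi> p)) u * ?g k (\<phi> p))) (at (\<phi> p))"
      by (rule has_derivative_mult[OF hL hg])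
  qed
  moreover have "(\<lambda>y. \<Sum>k\<in>K. ?L k y * ?g k y) = (\<lambda>q. \<Sum>k\<in>K. L k q * g k q) \<circ> inv_into D \<phi>"
    by (simp add: o_def)
  ultimately have "((\<lambda>q. \<Sum>k\<in>K. L k q * g k q) \<circ> inv_into D \<phi> has_derivative
    (\<lambda>u. \<Sum>k\<in>K. L k p * frechet_derivative (?g k) (at (\<phi> p)) u +
      frechet_derivative (?L k) (at (\<phi> p)) u * g k p)) (at (\<phi> p))"
    by (simp only: o_apply[of _ _ "\<phi> p"] chart_inv[OF assms(2,3)])
  note frechet_derivative_at[OF this, symmetric]
  moreover have "frechet_derivative (h \<circ> inv_into D \<phi>) (at (\<phi> p)) =
      frechet_derivative ((\<lambda>q. \<Sum>k\<in>K. L k q * g k q) \<circ> inv_into D \<phi>) (at (\<phi> p))"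
    by (rule chart_frechet_cong(1)[OF assms(2,3,5,6,7)])
  ultimately show ?thesis using assms(4,8) by (simp add: assms(1) coord_vector_def)
qed

section \<open>Brackets of vector fields\<close>

lemma smooth_vfD:
  assumes "smooth_vf A U X"
  shows "p \<in> U \<Longrightarrow> X p \<in> tangent_space A p" "V \<subseteq> U \<Longrightarrow> smooth_fun_on A V f \<Longrightarrow> smooth_fun_on A V (\<lambda>p. X p f)"
    "open U"
  using assms unfolding smooth_vf_def by blast+

lemma smooth_vf_smooth_near:
  assumes "smooth_vf A U X" "p \<in> U" "smooth_near A p f"
  shows "smooth_near A p (\<lambda>q. X q f)"
proof -
  obtain V where V: "p \<in> V" "smooth_fun_on A V f" using assms(3) by (auto simp: smooth_near_def)
  then have "smooth_fun_on A (U \<inter> V) f"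
    using smooth_vfD(3)[OF assms(1)] by (intro smooth_fun_on_subset[OF V(2)]) (auto simp: smooth_fun_on_def)
  from smooth_vfD(2)[OF assms(1) _ this] show ?thesis
    using V assms(2) by (intro smooth_nearI[of "U \<inter> V"]) auto
qed

lemma lie_bracket_antisym: "lie_bracket A Y X p f = - lie_bracket A X Y p f"
  by (simp add: lie_bracket_def)

text \<open>Where \<open>f\<close> is not smooth, the bracket defaults to 0, so the function
  \<open>[X, Y] f\<close> is replaced by \<open>X (Y f) - Y (X f)\<close> only near
  \<open>p\<close>, by locality of \<open>Z p\<close>. Smoothness of the bracket field is assumed
  because it will come from the Carnot condition.\<close>

lemma lie_bracket_lie_bracket:
  assumes X: "smooth_vf A U X" and Y: "smooth_vf A U Y" and Z: "smooth_vf A U Z"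
    and XY: "smooth_vf A U (lie_bracket A X Y)" and p: "p \<in> U" and f: "smooth_near A p f"
  shows "lie_bracket A (lie_bracket A X Y) Z p f =
    X p (\<lambda>q. Y q (\<lambda>q. Z q f)) - Y p (\<lambda>q. X q (\<lambda>q. Z q f))
    - (Z p (\<lambda>q. X q (\<lambda>q. Y q f)) - Z p (\<lambda>q. Y q (\<lambda>q. X q f)))"
proof -
  obtain V0 where V0: "p \<in> V0" "smooth_fun_on A V0 f" using f by (auto simp: smooth_near_def)
  define V where "V = U \<inter> V0"
  have V: "p \<in> V" "open V" "V \<subseteq> U"
    using V0 p smooth_vfD(3)[OF X] by (auto simp: V_def smooth_fun_on_def)
  have fV: "smooth_fun_on A V f"
    using V by (intro smooth_fun_on_subset[OF V0(2)]) (auto simp: V_def)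
  note XV = smooth_vfD(2)[OF X V(3)] and YV = smooth_vfD(2)[OF Y V(3)] and ZV = smooth_vfD(2)[OF Z V(3)]
  have eq: "lie_bracket A X Y q f = X q (\<lambda>q. Y q f) - Y q (\<lambda>q. X q f)" if "q \<in> V" for q
    using smooth_nearI[OF fV that] by (simp add: lie_bracket_def)
  have XYf: "smooth_fun_on A V (\<lambda>q. lie_bracket A X Y q f)"
    by (rule smooth_vfD(2)[OF XY V(3) fV])
  have d: "smooth_fun_on A V (\<lambda>q. X q (\<lambda>q. Y q f) - Y q (\<lambda>q. X q f))"
    by (rule smooth_fun_on_cong[OF XYf]) (rule eq)
  have "Z p (\<lambda>q. lie_bracket A X Y q f) = Z p (\<lambda>q. X q (\<lambda>q. Y q f) - Y q (\<lambda>q. X q f))"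
    by (rule tangent_cong[OF smooth_vfD(1)[OF Z p] smooth_nearI[OF XYf V(1)] smooth_nearI[OF d V(1)] V(2,1)])
       (rule eq)
  also have "\<dots> = Z p (\<lambda>q. X q (\<lambda>q. Y q f)) - Z p (\<lambda>q. Y q (\<lambda>q. X q f))"
    by (intro tangent_diff[OF smooth_vfD(1)[OF Z p]] smooth_nearI[OF _ V(1)] d XV YV fV)
  moreover have "smooth_near A p (\<lambda>q. Z q f)" by (intro smooth_nearI[OF _ V(1)] ZV fV)
  ultimately show ?thesis using f by (simp add: lie_bracket_def[of A "lie_bracket A X Y"] lie_bracket_def[of A X Y p])
qed

lemma lie_bracket_jacobi:
  assumes X: "smooth_vf A U X" and Y: "smooth_vf A U Y" and Z: "smooth_vf A U Z"
    and "smooth_vf A U (lie_bracket A X Y)" "smooth_vf A U (lie_bracket A Y Z)"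
      "smooth_vf A U (lie_bracket A Z X)" and p: "p \<in> U"
  shows "lie_bracket A (lie_bracket A X Y) Z p f + lie_bracket A (lie_bracket A Y Z) X p f +
    lie_bracket A (lie_bracket A Z X) Y p f = 0"
proof (cases "smooth_near A p f")
  case True
  show ?thesis
    using lie_bracket_lie_bracket[OF X Y Z assms(4) p True] lie_bracket_lie_bracket[OF Y Z X assms(5) p True]
      lie_bracket_lie_bracket[OF Z X Y assms(6) p True] by linarith
qed (simp add: lie_bracket_def)

end

section \<open>Frames and structure functions of a Carnot manifold\<close>

lemma sum_fun_apply: "(\<Sum>k\<in>K. g k) x = (\<Sum>k\<in>K. g k x)"
  by (induction K rule: infinite_finite_induct) (simp_all add: zero_fun_def plus_fun_def)

lemma tvec_span_representation:
  fixes b :: "'k::finite \<Rightarrow> 'm tvec"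
  assumes "inj b" "v \<in> tvec.span (b ` K)"
  obtains c where "\<And>k. k \<notin> K \<Longrightarrow> c k = 0" "v = (\<Sum>k\<in>UNIV. tscale (c k) (b k))"
proof -
  obtain u where "v = (\<Sum>x\<in>b ` K. tscale (u x) x)"
    using assms(2) tvec.span_finite[of "b ` K"] by auto
  also have "\<dots> = (\<Sum>k\<in>K. tscale (u (b k)) (b k))"
    using assms(1) by (simp add: sum.reindex inj_on_subset)
  also have "\<dots> = (\<Sum>k\<in>UNIV. tscale (if k \<in> K then u (b k) else 0) (b k))"
    by (rule sum.mono_neutral_cong_left) (auto simp: tvec.scale_zero_left)
  finally show thesis by (intro that[of "\<lambda>k. if k \<in> K then u (b k) else 0"]) auto
qed

lemma tvec_representation_unique:
  fixes b :: "'k::finite \<Rightarrow> 'm tvec"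
  assumes "inj b" "tvec.independent (range b)"
    and "(\<Sum>k\<in>UNIV. tscale (c k) (b k)) = (\<Sum>k\<in>UNIV. tscale (d k) (b k))"
  shows "c k = d k"
proof -
  have "(\<Sum>x\<in>range b. tscale (c (inv_into UNIV b x) - d (inv_into UNIV b x)) x) = (\<Sum>k\<in>UNIV. tscale (c k - d k) (b k))"
    using assms(1) by (simp add: sum.reindex)
  also have "\<dots> = 0" using assms(3) by (simp add: tvec.scale_left_diff_distrib sum_subtractf)
  finally have "c (inv_into UNIV b (b k)) - d (inv_into UNIV b (b k)) = 0"
    by (intro tvec.independentD[OF assms(2) _ subset_refl, of "\<lambda>x. c (inv_into UNIV b x) - d (inv_into UNIV b x)"]) auto
  then show ?thesis using assms(1) by simp
qed

text \<open>The positions are distinct elements of \<open>{1..n}\<close> with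
  \<open>n = CARD('k)\<close>, hence take every value there once.\<close>

lemma card_position_le:
  assumes "m \<le> CARD('k::{finite, linorder})"
  shows "card {k :: 'k. card {..k} \<le> m} = m"
proof -
  let ?p = "\<lambda>k :: 'k. card {..k}"
  have "?p k < ?p l" if "k < l" for k l
    using that by (intro psubset_card_mono) auto
  then have inj: "inj ?p"
    by (metis (mono_tags, lifting) injI less_irrefl linorder_neqE)
  have "?p ` UNIV \<subseteq> {1..CARD('k)}"
    by (auto simp: card_mono Suc_le_eq card_gt_0_iff)
  then have "?p ` UNIV = {1..CARD('k)}"
    using inj by (intro card_subset_eq) (simp_all add: card_image)
  then have "?p ` {k. ?p k \<le> m} = {1..m}"
    using assms by (auto simp: set_eq_iff image_iff) (metis atLeastAtMost_iff order_trans rangeE rangeI)+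
  then show ?thesis
    using card_image[OF inj_on_subset[OF inj, of "{k. ?p k \<le> m}"]] by simp
qed

lemma det_differentiable:
  fixes M :: "'a::real_normed_vector \<Rightarrow> real ^ 'k ^ 'k"
  assumes "\<And>i j. (\<lambda>x. M x $ i $ j) differentiable (at x0)"
  shows "(\<lambda>x. det (M x)) differentiable (at x0)"
proof -
  have "(\<lambda>x. \<Prod>i\<in>UNIV. M x $ i $ p i) differentiable (at x0)" for p
  proof -
    have "((\<lambda>x. M x $ i $ p i) has_derivative frechet_derivative (\<lambda>x. M x $ i $ p i) (at x0)) (at x0)" for i
      using assms by (simp only: frechet_derivative_works)
    from has_derivative_prod[of UNIV, OF this] show ?thesis by (rule differentiableI)
  qed
  then show ?thesis
    unfolding det_def by (intro differentiable_sum ballI differentiable_mult differentiable_const) simp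
qed

section \<open>Weights and spans\<close>

locale carnot_frame = manifold_atlas A
  for A :: "('m::{t2_space, second_countable_topology}, 'n::{finite, linorder}) chart set" +
  fixes r :: nat and H :: "nat \<Rightarrow> 'm \<Rightarrow> 'm tvec set" and X :: "'n \<Rightarrow> 'm \<Rightarrow> 'm tvec"
    and U :: "'m set" and a :: 'm
  assumes carnot: "carnot_manifold A r H"
    and a_in_U: "a \<in> U"
    and frame: "tangent_frame A U X"
    and frame_section: "local_section A (H (weight H j)) U (X j)"
begin

abbreviation wt :: "'n \<Rightarrow> nat" where "wt \<equiv> weight H"

lemma r_ge_1: "1 \<le> r" using carnot by (simp add: carnot_manifold_def)

lemma H_r: "H r p = tangent_space A p" using carnot by (simp add: carnot_manifold_def)

lemma H_mono:
  assumes "1 \<le> w" "w \<le> w'" "w' \<le> r"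
  shows "H w p \<subseteq> H w' p"
  using assms(2,3)
proof (induction w' rule: dec_induct)
  case (step n)
  have "H n p \<subseteq> H (Suc n) p"
    using carnot step assms(1) unfolding carnot_manifold_def by simp
  then show ?case using step by simp
qed simp

lemma H_basis:
  assumes "1 \<le> w" "w \<le> r"
  obtains B where "finite B" "card B = bundle_rank (H w)" "tvec.independent B" "tvec.span B = H w p"
proof -
  have "subbundle A (H w)" using carnot assms by (simp add: carnot_manifold_def)
  then obtain k where k: "\<forall>p. \<exists>U (Y :: nat \<Rightarrow> 'm \<Rightarrow> 'm tvec). p \<in> U \<and> open U \<and>
       (\<forall>i<k. smooth_vf A U (Y i)) \<and>
       (\<forall>q\<in>U. inj_on (\<lambda>i. Y i q) {..<k} \<and>
              tvec.independent ((\<lambda>i. Y i q) ` {..<k}) \<and>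
              tvec.span ((\<lambda>i. Y i q) ` {..<k}) = H w q)"
    unfolding subbundle_def by blast
  have B: "\<exists>B. finite B \<and> card B = k \<and> tvec.independent B \<and> tvec.span B = H w p" for p
  proof -
    obtain Y :: "nat \<Rightarrow> 'm \<Rightarrow> 'm tvec" where Y: "inj_on (\<lambda>i. Y i p) {..<k}"
        "tvec.independent ((\<lambda>i. Y i p) ` {..<k})" "tvec.span ((\<lambda>i. Y i p) ` {..<k}) = H w p"
      using k by blast
    then show ?thesis by (intro exI[of _ "(\<lambda>i. Y i p) ` {..<k}"]) (simp add: card_image)
  qed
  have "tvec.dim (H w p) = k" for p
    using B[of p] tvec.dim_eq_card by (metis tvec.span_span)
  \<comment> \<open>The dimension is the same \<open>k\<close> at every point, so the
    \<open>THE\<close> is determined.\<close>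
  then have "bundle_rank (H w) = k"
    unfolding bundle_rank_def by (intro the_equality) auto
  then show thesis using B[of p] that by blast
qed

lemma frame_at:
  assumes "q \<in> U"
  shows "inj (\<lambda>j. X j q)" "tvec.independent (range (\<lambda>j. X j q))"
    "tvec.span (range (\<lambda>j. X j q)) = tangent_space A q"
  using frame assms by (auto simp: tangent_frame_def)

lemma rank_mono:
  assumes "1 \<le> w" "w \<le> w'" "w' \<le> r"
  shows "bundle_rank (H w) \<le> bundle_rank (H w')"
proof -
  obtain B where B: "finite B" "card B = bundle_rank (H w)" "tvec.independent B" "tvec.span B = H w a"
    using H_basis[of w] assms by auto
  obtain B' where B': "finite B'" "card B' = bundle_rank (H w')" "tvec.independent B'" "tvec.span B' = H w' a"
    using H_basis[of w'] assms by auto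
  have "B \<subseteq> tvec.span B'"
    using tvec.span_superset[of B] H_mono[OF assms, of a] B(4) B'(4) by blast
  from tvec.independent_span_bound[OF B'(1) B(3) this] show ?thesis using B B' by simp
qed

lemma rank_r: "bundle_rank (H r) = CARD('n)"
proof -
  obtain B where B: "finite B" "card B = bundle_rank (H r)" "tvec.independent B" "tvec.span B = H r a"
    using H_basis[of r] r_ge_1 by auto
  note f = frame_at[OF a_in_U]
  have s: "tvec.span B = tvec.span (range (\<lambda>j. X j a))" by (simp add: B(4) H_r f(3))
  have "card B = card (range (\<lambda>j. X j a))"
    using tvec.dim_eq_card[OF s[symmetric] f(2)] tvec.dim_eq_card[OF refl B(3)] by simp
  then show ?thesis using B(2) f(1) by (simp add: card_image)
qed

text \<open>The value \<open>r\<close> is a candidate for the \<open>LEAST\<close>, because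
  \<open>H r\<close> is the full tangent space and has rank \<open>CARD('n)\<close>.\<close>

lemma weight_spec: "1 \<le> wt j" "card {..j} \<le> bundle_rank (H (wt j))" "wt j \<le> r"
proof -
  have r: "1 \<le> r \<and> card {..j} \<le> bundle_rank (H r)"
    using r_ge_1 by (simp add: rank_r card_mono)
  from LeastI[of "\<lambda>w. 1 \<le> w \<and> card {..j} \<le> bundle_rank (H w)", OF r]
  show "1 \<le> wt j" "card {..j} \<le> bundle_rank (H (wt j))" by (simp_all add: weight_def)
  show "wt j \<le> r" unfolding weight_def by (rule Least_le) (rule r)
qed

lemma weight_le_iff:
  assumes "1 \<le> w" "w \<le> r"
  shows "wt j \<le> w \<longleftrightarrow> card {..j} \<le> bundle_rank (H w)"
proof
  assume "wt j \<le> w"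
  then show "card {..j} \<le> bundle_rank (H w)"
    using rank_mono[OF weight_spec(1) _ assms(2)] weight_spec(2) order_trans by blast
next
  assume "card {..j} \<le> bundle_rank (H w)"
  then show "wt j \<le> w" unfolding weight_def using assms(1) by (intro Least_le) simp
qed

text \<open>The frame fields of weight at most \<open>w\<close> are independent and lie in
  \<open>H w\<close>; by the definition of the weights there are as many as the rank of
  \<open>H w\<close>.\<close>

lemma H_span:
  assumes "q \<in> U" "1 \<le> w" "w \<le> r"
  shows "H w q = tvec.span ((\<lambda>k. X k q) ` {k. wt k \<le> w})"
proof -
  let ?S = "(\<lambda>k. X k q) ` {k. wt k \<le> w}"
  note f = frame_at[OF assms(1)]
  obtain B where B: "finite B" "card B = bundle_rank (H w)" "tvec.independent B" "tvec.span B = H w q"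
    using H_basis[OF assms(2,3)] by blast
  have S: "?S \<subseteq> H w q"
  proof clarify
    fix k assume "wt k \<le> w"
    then show "X k q \<in> H w q"
      using frame_section[of k] assms H_mono[OF weight_spec(1), of k w q]
      by (auto simp: local_section_def)
  qed
  have indep: "tvec.independent ?S" by (rule tvec.independent_mono[OF f(2)]) auto
  have "bundle_rank (H w) \<le> CARD('n)" using rank_mono[OF assms(2,3) order_refl] by (simp add: rank_r)
  then have card: "card ?S = card B"
    using f(1) by (simp add: card_image inj_on_subset weight_le_iff[OF assms(2,3)] card_position_le B(2))
  have "v \<in> tvec.span ?S" if v: "v \<in> H w q" for v
  proof (rule ccontr)
    assume n: "v \<notin> tvec.span ?S"
    then have "tvec.independent (insert v ?S)" by (rule tvec.independent_insertI[OF _ indep])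
    moreover have "insert v ?S \<subseteq> tvec.span B" using v S B(4) by simp
    ultimately have "card (insert v ?S) \<le> card B" using tvec.independent_span_bound[OF B(1)] by blast
    moreover have "v \<notin> ?S" by (rule contrapos_nn[OF n tvec.span_base])
    ultimately show False using card by simp
  qed
  moreover have "tvec.span ?S \<subseteq> H w q"
    using tvec.span_minimal[OF S[folded B(4)] tvec.subspace_span] B(4) by simp
  ultimately show ?thesis by blast
qed

lemma X_vf: "smooth_vf A U (X j)"
  using frame by (simp add: tangent_frame_def)

lemma bracket_section:
  assumes "local_section A (H w) U Y" "1 \<le> w" "w + wt j \<le> r"
  shows "local_section A (H (w + wt j)) U (lie_bracket A Y (X j))"
proof -
  have "\<forall>w w' U X Y. 1 \<le> w \<and> 1 \<le> w' \<and> w + w' \<le> r \<and>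
        local_section A (H w) U X \<and> local_section A (H w') U Y \<longrightarrow>
        local_section A (H (w + w')) U (lie_bracket A X Y)"
    using carnot unfolding carnot_manifold_def by blast
  then show ?thesis using assms frame_section[of j] weight_spec(1)[of j] by blast
qed

lemma bracket_vf:
  assumes "wt i + wt j \<le> r"
  shows "smooth_vf A U (lie_bracket A (X i) (X j))"
  using bracket_section[OF frame_section weight_spec(1) assms] by (simp add: local_section_def)

section \<open>Structure functions\<close>

abbreviation L :: "'n \<Rightarrow> 'n \<Rightarrow> 'n \<Rightarrow> 'm \<Rightarrow> real" where
  "L \<equiv> struct_fun A X"

text \<open>The Carnot condition puts the bracket into \<open>H (wt i + wt j)\<close>, and
  \<open>H_span\<close> then admits only frame fields up to that weight.\<close>

lemma bracket_expansion:
  assumes "q \<in> U" "wt i + wt j \<le> r"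
  shows "lie_bracket A (X i) (X j) q = (\<Sum>l\<in>UNIV. tscale (L i j l q) (X l q))"
    and "wt i + wt j < wt k \<Longrightarrow> L i j k q = 0"
proof -
  note f = frame_at[OF assms(1)]
  have "lie_bracket A (X i) (X j) q \<in> H (wt i + wt j) q"
    using bracket_section[OF frame_section weight_spec(1) assms(2)] assms(1) by (simp add: local_section_def)
  then have "lie_bracket A (X i) (X j) q \<in> tvec.span ((\<lambda>k. X k q) ` {k. wt k \<le> wt i + wt j})"
    using H_span[OF assms(1) _ assms(2)] weight_spec(1)[of i] by simp
  then obtain c where c: "\<And>k. k \<notin> {k. wt k \<le> wt i + wt j} \<Longrightarrow> c k = 0"
      "lie_bracket A (X i) (X j) q = (\<Sum>k\<in>UNIV. tscale (c k) (X k q))"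
    using tvec_span_representation[OF f(1)] by metis
  have "(THE c :: (real, 'n) vec. lie_bracket A (X i) (X j) q = (\<Sum>l\<in>UNIV. tscale (c $ l) (X l q))) = (\<chi> k. c k)"
  proof (rule the_equality)
    fix d :: "(real, 'n) vec" assume "lie_bracket A (X i) (X j) q = (\<Sum>l\<in>UNIV. tscale (d $ l) (X l q))"
    then have "(\<Sum>l\<in>UNIV. tscale (d $ l) (X l q)) = (\<Sum>l\<in>UNIV. tscale (c l) (X l q))" by (simp only: c(2))
    from tvec_representation_unique[OF f(1,2) this] show "d = (\<chi> k. c k)" by (simp add: vec_eq_iff)
  qed (simp add: c(2))
  then have "L i j l q = c l" for l by (simp add: struct_fun_def)
  then show "lie_bracket A (X i) (X j) q = (\<Sum>l\<in>UNIV. tscale (L i j l q) (X l q))"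
    "wt i + wt j < wt k \<Longrightarrow> L i j k q = 0" using c by simp_all
qed

lemma bracket_expansion_apply:
  assumes "q \<in> U" "wt i + wt j \<le> r"
  shows "lie_bracket A (X i) (X j) q f = (\<Sum>k\<in>UNIV. L i j k q * X k q f)"
  by (simp add: bracket_expansion(1)[OF assms] sum_fun_apply tscale_def)

lemma L_antisym:
  assumes "q \<in> U" "wt i + wt j \<le> r"
  shows "L i j k q = - L j i k q"
proof -
  have "lie_bracket A (X i) (X j) q = - lie_bracket A (X j) (X i) q"
    by (rule ext) (simp add: fun_Compl_def lie_bracket_antisym[of "X i" "X j"])
  then have "(\<Sum>k\<in>UNIV. tscale (L i j k q) (X k q)) = (\<Sum>k\<in>UNIV. tscale (- L j i k q) (X k q))"
    using bracket_expansion(1)[OF assms] bracket_expansion(1)[of q j i] assms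
    by (simp add: add.commute tvec.scale_minus_left sum_negf)
  from tvec_representation_unique[OF frame_at(1,2)[OF assms(1)] this] show ?thesis .
qed

text \<open>Applied to the coordinate functions, the expansion of the bracket is a linear system
  \<open>M L = b\<close> whose entries are smooth near \<open>a\<close>; Cramer's rule exhibits the
  solution as a quotient of determinants.\<close>

lemma L_differentiable:
  assumes "(D, \<phi>) \<in> A" "a \<in> D" "wt i + wt j \<le> r"
  shows "(L i j k \<circ> inv_into D \<phi>) differentiable (at (\<phi> a))"
proof -
  let ?x = "\<lambda>m q. \<phi> q $ m" and ?Y = "lie_bracket A (X i) (X j)"
  define M :: "'m \<Rightarrow> ((real, 'n) vec, 'n) vec" where "M q = (\<chi> m l. X l q (?x m))" for q
  define b :: "'m \<Rightarrow> (real, 'n) vec" where "b q = (\<chi> m. ?Y q (?x m))" for q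
  define N :: "'m \<Rightarrow> ((real, 'n) vec, 'n) vec" where "N q = (\<chi> m l. if l = k then b q $ m else M q $ m $ l)" for q
  have det: "det (M q) \<noteq> 0" if q: "q \<in> U \<inter> D" for q
  proof -
    \<comment> \<open>A kernel vector of \<open>M q\<close> is a linear combination of the frame
      that kills all coordinate functions. Such a tangent vector is zero, and the frame is
      independent.\<close>
    have "y = 0" if "M q *v y = 0" for y
    proof -
      let ?v = "\<Sum>l\<in>UNIV. tscale (y $ l) (X l q)"
      have "?v = 0"
      proof (rule tangent_vector_eqI[OF _ _ assms(1)])
        have "?v \<in> tvec.span (range (\<lambda>j. X j q))"
          by (intro tvec.span_sum tvec.span_scale tvec.span_base) auto
        then show "?v \<in> tangent_space A q" using frame_at(3) q by simp
        show "0 \<in> tangent_space A q" using frame_at(3)[of q] tvec.span_zero q by auto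
        show "q \<in> D" using q by simp
        show "?v (?x m) = 0 (?x m)" for m
        proof -
          have "(M q *v y) $ m = 0" using that by simp
          then show ?thesis
            by (simp add: M_def matrix_vector_mult_def sum_fun_apply tscale_def zero_fun_def mult.commute)
        qed
      qed
      then have "(\<Sum>l\<in>UNIV. tscale (y $ l) (X l q)) = (\<Sum>l\<in>UNIV. tscale ((\<lambda>_. 0) l) (X l q))"
        by (simp add: tvec.scale_zero_left)
      from tvec_representation_unique[OF frame_at(1,2) this] q show "y = 0" by (simp add: vec_eq_iff)
    qed
    then show ?thesis by (metis invertible_det_nz invertible_left_inverse matrix_left_invertible_ker)
  qed
  have L: "L i j k q = det (N q) / det (M q)" if q: "q \<in> U \<inter> D" for q
  proof -
    have "M q *v (\<chi> l. L i j l q) = b q"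
      using bracket_expansion_apply[of q i j] q assms(3)
      by (simp add: vec_eq_iff M_def b_def matrix_vector_mult_def mult.commute)
    then have "(\<chi> l. L i j l q) = (\<chi> l. det (\<chi> m l'. if l' = l then b q $ m else M q $ m $ l') / det (M q))"
      using cramer[OF det[OF q]] by blast
    then show ?thesis by (simp add: vec_eq_iff N_def)
  qed
  have sm: "smooth_near A a (\<lambda>q. Y q (?x m))" if "smooth_vf A U Y" for Y m
    by (rule smooth_vf_smooth_near[OF that a_in_U smooth_nearI[OF smooth_fun_on_coord[OF assms(1)] assms(2)]])
  have M: "(\<lambda>y. M (inv_into D \<phi> y) $ m $ l) differentiable (at (\<phi> a))" for m l
    using smooth_near_differentiable[OF sm[OF X_vf] assms(1,2)] by (simp add: M_def o_def)
  have "(\<lambda>y. b (inv_into D \<phi> y) $ m) differentiable (at (\<phi> a))" for m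
    using smooth_near_differentiable[OF sm[OF bracket_vf[OF assms(3)]] assms(1,2)] by (simp add: b_def o_def)
  then have N: "(\<lambda>y. N (inv_into D \<phi> y) $ m $ l) differentiable (at (\<phi> a))" for m l
    using M by (cases "l = k") (simp_all add: N_def)
  have aUD: "a \<in> U \<inter> D" using a_in_U assms(2) by simp
  have "(\<lambda>y. det (N (inv_into D \<phi> y)) / det (M (inv_into D \<phi> y))) differentiable (at (\<phi> a))"
    using det[OF aUD] chart_inv[OF assms(1,2)]
    by (intro differentiable_divide det_differentiable M N) simp
  moreover have "open (U \<inter> D)"
    using smooth_vfD(3)[OF X_vf] is_chartD(1)[OF chart[OF assms(1)]] by auto
  ultimately show ?thesis
    using chart_frechet_cong(2)[of D \<phi> a "U \<inter> D" "L i j k" "\<lambda>q. det (N q) / det (M q)"] assms(1,2) aUD L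
    by (simp add: o_def)
qed

definition C :: "'n \<Rightarrow> 'n \<Rightarrow> 'n \<Rightarrow> real" where
  "C i j k = (if wt i + wt j \<le> r \<and> wt k = wt i + wt j then L i j k a else 0)"

lemma double_bracket:
  assumes "wt i + wt j + wt l \<le> r"
  obtains d where
    "lie_bracket A (lie_bracket A (X i) (X j)) (X l) a = (\<Sum>m\<in>UNIV. tscale (d m) (X m a))"
    "\<And>m. wt m = wt i + wt j + wt l \<Longrightarrow> d m = (\<Sum>k\<in>UNIV. C i j k * C k l m)"
proof -
  have ij: "wt i + wt j \<le> r" using assms by simp
  let ?Y = "lie_bracket A (X i) (X j)"
  \<comment> \<open>Only these \<open>k\<close> occur in the bracket. For them
    \<open>wt k + wt l \<le> r\<close>, so the bracket with \<open>X l\<close> can again be expanded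
    in the frame.\<close>
  define K where "K = {k. wt k \<le> wt i + wt j}"
  have kl: "wt k + wt l \<le> r" if "k \<in> K" for k using that assms by (simp add: K_def)
  obtain D \<phi> where c: "(D, \<phi>) \<in> A" "a \<in> D" using ex_chart by blast
  obtain u where u: "X l a = coord_vector A (D, \<phi>) a u"
    by (rule tangent_space_chart[OF smooth_vfD(1)[OF X_vf a_in_U] c])
  define \<beta> where "\<beta> k = frechet_derivative (L i j k \<circ> inv_into D \<phi>) (at (\<phi> a)) u" for k
  \<comment> \<open>Read off from \<open>[\<Sum> L_k X_k, X_l] = \<Sum> L_k [X_k, X_l] - \<Sum>
    X_l(L_k) X_k\<close>; the last sum reaches only indices in \<open>K\<close>.\<close>
  define d where "d m = (\<Sum>k\<in>K. L i j k a * L k l m a) - (if m \<in> K then \<beta> m else 0)" for m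
  have Y: "?Y q f = (\<Sum>k\<in>K. L i j k q * X k q f)" if "q \<in> U" for q f
    unfolding bracket_expansion_apply[OF that ij]
    by (rule sum.mono_neutral_right) (use bracket_expansion(2)[OF that ij] in \<open>auto simp: K_def\<close>)
  have "lie_bracket A ?Y (X l) a f = (\<Sum>m\<in>UNIV. d m * X m a f)" for f
  proof (cases "smooth_near A a f")
    case f: True
    have "X l a (\<lambda>q. ?Y q f) = (\<Sum>k\<in>K. L i j k a * X l a (\<lambda>q. X k q f) + \<beta> k * X k a f)"
      unfolding \<beta>_def
      by (rule tangent_sum_mult[OF u c _ smooth_vfD(3)[OF X_vf] a_in_U])
         (auto intro: Y smooth_vf_smooth_near X_vf bracket_vf ij f a_in_U L_differentiable c)
    then have "lie_bracket A ?Y (X l) a f =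
        (\<Sum>k\<in>K. L i j k a * X k a (\<lambda>q. X l q f)) -
        (\<Sum>k\<in>K. L i j k a * X l a (\<lambda>q. X k q f) + \<beta> k * X k a f)"
      using f by (simp add: lie_bracket_def[of A ?Y] Y[OF a_in_U])
    also have "\<dots> = (\<Sum>k\<in>K. L i j k a * lie_bracket A (X k) (X l) a f) - (\<Sum>k\<in>K. \<beta> k * X k a f)"
      using f by (simp add: lie_bracket_def algebra_simps sum.distrib sum_subtractf)
    also have "(\<Sum>k\<in>K. L i j k a * lie_bracket A (X k) (X l) a f) =
        (\<Sum>k\<in>K. \<Sum>m\<in>UNIV. L i j k a * L k l m a * X m a f)"
      by (rule sum.cong[OF refl]) (simp add: bracket_expansion_apply[OF a_in_U kl] sum_distrib_left mult.assoc)
    also have "\<dots> = (\<Sum>m\<in>UNIV. (\<Sum>k\<in>K. L i j k a * L k l m a) * X m a f)"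
      unfolding sum_distrib_right by (rule sum.swap)
    also have "(\<Sum>k\<in>K. \<beta> k * X k a f) = (\<Sum>m\<in>UNIV. (if m \<in> K then \<beta> m else 0) * X m a f)"
      by (rule sum.mono_neutral_cong_left) auto
    finally show ?thesis
      by (simp add: d_def left_diff_distrib sum_subtractf)
  next
    case False
    then show ?thesis
      using tangent_not_smooth[OF smooth_vfD(1)[OF X_vf a_in_U]] by (simp add: lie_bracket_def[of A ?Y])
  qed
  then have "lie_bracket A ?Y (X l) a = (\<Sum>m\<in>UNIV. tscale (d m) (X m a))"
    by (intro ext) (simp add: sum_fun_apply tscale_def)
  moreover have "d m = (\<Sum>k\<in>UNIV. C i j k * C k l m)" if m: "wt m = wt i + wt j + wt l" for m
  proof -
    have "m \<notin> K" using m weight_spec(1)[of l] by (simp add: K_def)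
    then have "d m = (\<Sum>k\<in>K. L i j k a * L k l m a)" by (simp add: d_def)
    also have "\<dots> = (\<Sum>k\<in>UNIV. C i j k * C k l m)"
    proof (rule sum.mono_neutral_cong_left)
      show "\<forall>k\<in>UNIV - K. C i j k * C k l m = 0" by (auto simp: K_def C_def)
      fix k assume k: "k \<in> K"
      show "L i j k a * L k l m a = C i j k * C k l m"
      proof (cases "wt k = wt i + wt j")
        case True
        then show ?thesis using ij kl[OF k] m by (simp add: C_def)
      next
        case False
        \<comment> \<open>A summand with smaller \<open>wt k\<close> cannot reach the top weight of
          \<open>m\<close>, so dropping it in \<open>C\<close> changes nothing.\<close>
        then have "wt k + wt l < wt m" using k m by (simp add: K_def)
        from bracket_expansion(2)[OF a_in_U kl[OF k] this] show ?thesis using False by (simp add: C_def)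
      qed
    qed simp_all
    finally show ?thesis .
  qed
  ultimately show thesis by (rule that)
qed

text \<open>If \<open>wt m\<close> is the total weight of \<open>i\<close>, \<open>j\<close> and
  \<open>k\<close>, that weight is at most \<open>r\<close>, so all brackets fall under the Carnot
  condition, and the coefficients of \<open>X m\<close> in the Jacobi identity of vector fields can
  be compared. For other \<open>m\<close> every product vanishes by grading.\<close>

lemma C_jacobi:
  "(\<Sum>l\<in>UNIV. C i j l * C l k m + C j k l * C l i m + C k i l * C l j m) = 0"
proof (cases "wt m = wt i + wt j + wt k")
  case True
  then have le: "wt i + wt j + wt k \<le> r" "wt j + wt k + wt i \<le> r" "wt k + wt i + wt j \<le> r"
    using weight_spec(3)[of m] by simp_all
  obtain d1 where d1: "lie_bracket A (lie_bracket A (X i) (X j)) (X k) a = (\<Sum>m\<in>UNIV. tscale (d1 m) (X m a))"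
    "\<And>m. wt m = wt i + wt j + wt k \<Longrightarrow> d1 m = (\<Sum>l\<in>UNIV. C i j l * C l k m)"
    using double_bracket[OF le(1)] by blast
  obtain d2 where d2: "lie_bracket A (lie_bracket A (X j) (X k)) (X i) a = (\<Sum>m\<in>UNIV. tscale (d2 m) (X m a))"
    "\<And>m. wt m = wt j + wt k + wt i \<Longrightarrow> d2 m = (\<Sum>l\<in>UNIV. C j k l * C l i m)"
    using double_bracket[OF le(2)] by blast
  obtain d3 where d3: "lie_bracket A (lie_bracket A (X k) (X i)) (X j) a = (\<Sum>m\<in>UNIV. tscale (d3 m) (X m a))"
    "\<And>m. wt m = wt k + wt i + wt j \<Longrightarrow> d3 m = (\<Sum>l\<in>UNIV. C k i l * C l j m)"
    using double_bracket[OF le(3)] by blast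
  have "(\<Sum>m\<in>UNIV. tscale (d1 m + d2 m + d3 m) (X m a)) = (\<Sum>m\<in>UNIV. tscale ((\<lambda>_. 0) m) (X m a))"
  proof
    fix f
    have "lie_bracket A (lie_bracket A (X i) (X j)) (X k) a f + lie_bracket A (lie_bracket A (X j) (X k)) (X i) a f +
        lie_bracket A (lie_bracket A (X k) (X i)) (X j) a f = 0"
      by (rule lie_bracket_jacobi[OF X_vf X_vf X_vf bracket_vf bracket_vf bracket_vf a_in_U]) (use le in simp_all)
    then show "(\<Sum>m\<in>UNIV. tscale (d1 m + d2 m + d3 m) (X m a)) f = (\<Sum>m\<in>UNIV. tscale ((\<lambda>_. 0) m) (X m a)) f"
      unfolding d1(1) d2(1) d3(1)
      by (simp add: sum_fun_apply tscale_def distrib_right sum.distrib)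
  qed
  from tvec_representation_unique[OF frame_at(1,2)[OF a_in_U] this, of m] show ?thesis
    using True by (simp add: d1(2) d2(2) d3(2) sum.distrib)
next
  case False
  then have "C i j l * C l k m + C j k l * C l i m + C k i l * C l j m = 0" for l
    by (auto simp: C_def)
  then show ?thesis by simp
qed

sublocale graded_structure_constants C wt r
proof
  show "C i j k = - C j i k" for i j k
    using L_antisym[OF a_in_U, of i j k] by (auto simp: C_def add.commute)
qed (use weight_spec C_jacobi in \<open>auto simp: C_def split: if_splits\<close>)

lemma model_bracket_eq: "model_bracket A r H X a = br"
proof (intro ext, rule vec_eq_iff[THEN iffD2], rule allI)
  fix x y :: "(real, 'n) vec" and m
  have "(if wt i + wt j \<le> r then \<Sum>k | wt k = wt i + wt j. L i j k a *\<^sub>R axis k 1 else (0 :: (real, 'n) vec)) $ m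
      = C i j m" for i j
  proof -
    have "(\<Sum>k | wt k = wt i + wt j. L i j k a *\<^sub>R axis k 1 :: (real, 'n) vec) $ m =
        (\<Sum>k | wt k = wt i + wt j. if k = m then L i j k a else 0)"
      unfolding sum_component by (rule sum.cong[OF refl]) (simp add: axis_def)
    then show ?thesis by (simp add: C_def)
  qed
  then show "model_bracket A r H X a x y $ m = br x y $ m"
    by (simp add: model_bracket_def br_def)
qed

lemma tangent_group_in_class_N: "tangent_group A r H X a \<in> class_N A r H X a"
proof -
  have "tangent_group A r H X a = dgroup"
    by (simp add: tangent_group_def dgroup_def model_bracket_eq)
  moreover have "dilation H = dil"
    by (intro ext) (simp add: dilation_def dil_def)
  ultimately show ?thesis
    by (simp add: class_N_def model_bracket_eq lie_group_dgroup nilpotent_dgroup dil_iso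
        lie_algebra_bracket_dgroup)
qed

end

theorem proposition5p4:
  fixes A :: "('m::{t2_space, second_countable_topology}, 'n::{finite, linorder}) chart set"
    and r :: nat
    and H :: "nat \<Rightarrow> 'm \<Rightarrow> 'm tvec set"
    and a :: 'm
    and X :: "'n \<Rightarrow> 'm \<Rightarrow> 'm tvec"
  assumes "carnot_manifold A r H"
    and "H_frame_near A H a X"
  shows "tangent_group A r H X a \<in> class_N A r H X a"
proof -
  obtain U where "a \<in> U" "tangent_frame A U X" "\<And>j. local_section A (H (weight H j)) U (X j)"
    using assms(2) by (auto simp: H_frame_near_def)
  then interpret carnot_frame A r H X U a
    using assms(1) by unfold_locales (auto simp: carnot_manifold_def)
  show ?thesis by (rule tangent_group_in_class_N)
qed

end
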